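(* Let $N\ge1$ be an integer, $\alpha>0$, and let $H$ be the self-adjoint operator $-\frac{d^2}{dx^2}$ on the infinite star graph with the Exner--Šeba vertex condition, as defined in the context. For $t>0$ and $x,y>0$, the integral kernel of $e^{-t\sqrt H}$ (the cylinder kernel) is $$G_{Sj}{}^{l}(t,x,y)=\delta_j{}^{l}\,\frac{t/\pi}{t^2+(x-y)^2}+\left(\frac2N-\delta_j{}^{l}\right)\frac{t/\pi}{t^2+(x+y)^2}+\frac{2\alpha}{\pi N^2}\,e^{\alpha(x+y)/N}\,\operatorname{Im}\left[e^{-i\alpha t/N}\operatorname{Ei}\left(\frac{i\alpha t}{N}-\frac{\alpha}{N}(x+y)\right)\right].$$
   Context: Operator $H$: on $L^2(0,\infty)^N$, $(Hu)_j=-u_j''$ with domain consisting of all $u=(u_1,\dots,u_N)$ with $u_j\in H^2(0,\infty)$ (Sobolev space) satisfying $u_1(0)=\dots=u_N(0)=:u(0)$ and $\sum_{j=1}^N u_j'(0)=\alpha u(0)$. For $\alpha>0$, $H$ is self-adjoint and nonnegative. The function $u(t)=e^{-t\sqrt H}f$ solves $u_{tt}=Hu$, $u(0,x)=f(x)$, $u(t,x)\to0$ as $t\to+\infty$. The kernel acts by $(e^{-t\sqrt H}f)_j(x)=\sum_{l=1}^N\int_0^\infty G_{Sj}{}^{l}(t,x,y)f_l(y)\,dy$. $\delta_j{}^{l}$ is the Kronecker delta. $\operatorname{Ei}$ is the exponential integral, for $\operatorname{Re}\zeta>0$ given by $\operatorname{Ei}(-\zeta)=-\int_\zeta^{\infty}\frac{e^{-w}}{w}\,dw$,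 the integration being along the horizontal ray $w=\zeta+r$, $r\ge0$ (equivalently, $\operatorname{Ei}(-\zeta)=-E_1(\zeta)$ with the principal branch of $E_1$). *)

theory Defs
  imports "HOL-Analysis.Analysis"
begin

(* The star graph has N = CARD('n) edges, indexed by 'n, each a copy of (0,infinity).
   Elements of L^2(0,infinity)^N are given by representatives 'n => real => complex; only the
   values on (0,infinity) matter, and equality in L^2 is almost-everywhere equality there.
   Operators, possibly unbounded, are given by their graphs, sets of pairs (u, h) closed
   under almost-everywhere equality in both components. *)

type_synonym 'n star_fun = "'n \<Rightarrow> real \<Rightarrow> complex"

definition halfline :: "real measure" where
  "halfline = restrict_space lborel {0<..}"

definition star_L2 :: "('n::finite) star_fun set" where
  "star_L2 = {f. \<forall>j. f j \<in> borel_measurable halfline \<and>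
                     integrable halfline (\<lambda>x. (cmod (f j x))\<^sup>2)}"

definition star_eq :: "('n::finite) star_fun \<Rightarrow> 'n star_fun \<Rightarrow> bool" where
  "star_eq f g \<longleftrightarrow> (\<forall>j. AE x in halfline. f j x = g j x)"

(* Conjugate-linear in the first argument. *)
definition star_inner :: "('n::finite) star_fun \<Rightarrow> 'n star_fun \<Rightarrow> complex" where
  "star_inner f g = (\<Sum>j\<in>UNIV. \<integral>x. cnj (f j x) * g j x \<partial>halfline)"

definition test_function :: "(real \<Rightarrow> real) \<Rightarrow> bool" where
  "test_function \<phi> \<longleftrightarrow>
     (\<forall>k x. (deriv ^^ k) \<phi> field_differentiable (at x)) \<and>
     (\<exists>a b. 0 < a \<and> (\<forall>x. x \<notin> {a..b} \<longrightarrow> \<phi> x = 0))"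

definition weak_deriv :: "(real \<Rightarrow> complex) \<Rightarrow> (real \<Rightarrow> complex) \<Rightarrow> bool" where
  "weak_deriv u v \<longleftrightarrow>
     (\<forall>\<phi>. test_function \<phi> \<longrightarrow>
        (\<integral>x. of_real (deriv \<phi> x) * u x \<partial>halfline) = - (\<integral>x. of_real (\<phi> x) * v x \<partial>halfline))"

(* c is the boundary value at 0 of the representative of u that is continuous on [0,infinity).
   If u and its weak derivative are in L^2, it exists and is unique. *)
definition boundary_value :: "(real \<Rightarrow> complex) \<Rightarrow> complex \<Rightarrow> bool" where
  "boundary_value u c \<longleftrightarrow>
     (\<exists>w. continuous_on {0..} w \<and> (AE x in halfline. u x = w x) \<and> w 0 = c)"

(* Graph of H = -d^2/dx^2 with the Exner-Seba condition: u is in H^2 on each edge (u, u1, u2 in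
   L^2, where u1 and u2 are the first and second weak derivatives), all edges have the same
   boundary value c, the boundary values d j of the first derivatives sum to alpha c, and
   h = -u2. *)
definition star_H :: "real \<Rightarrow> (('n::finite) star_fun \<times> 'n star_fun) set" where
  "star_H \<alpha> =
     {(u, h). u \<in> star_L2 \<and> h \<in> star_L2 \<and>
        (\<exists>u1\<in>star_L2. \<exists>u2\<in>star_L2.
           (\<forall>j. weak_deriv (u j) (u1 j) \<and> weak_deriv (u1 j) (u2 j)) \<and>
           (\<exists>c d. (\<forall>j. boundary_value (u j) c \<and> boundary_value (u1 j) (d j)) \<and>
                  (\<Sum>j\<in>UNIV. d j) = of_real \<alpha> * c) \<and>
           star_eq h (\<lambda>j x. - u2 j x))}"

(* Projection-valued measure on the Borel sets of the real line. *)
definition star_pvm :: "(real set \<Rightarrow> ('n::finite) star_fun \<Rightarrow> 'n star_fun) \<Rightarrow> bool" where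
  "star_pvm E \<longleftrightarrow>
     (\<forall>B\<in>sets borel. \<forall>f\<in>star_L2. E B f \<in> star_L2) \<and>
     (\<forall>B\<in>sets borel. \<forall>f\<in>star_L2. \<forall>g\<in>star_L2. star_eq f g \<longrightarrow> star_eq (E B f) (E B g)) \<and>
     (\<forall>B\<in>sets borel. \<forall>f\<in>star_L2. \<forall>g\<in>star_L2. \<forall>a.
        star_eq (E B (\<lambda>j x. a * f j x + g j x)) (\<lambda>j x. a * E B f j x + E B g j x)) \<and>
     (\<forall>B\<in>sets borel. \<forall>f\<in>star_L2. star_eq (E B (E B f)) (E B f)) \<and>
     (\<forall>B\<in>sets borel. \<forall>f\<in>star_L2. \<forall>g\<in>star_L2. star_inner (E B f) g = star_inner f (E B g)) \<and>
     (\<forall>f\<in>star_L2. star_eq (E UNIV f) f) \<and>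
     (\<forall>A. range A \<subseteq> sets borel \<longrightarrow> disjoint_family A \<longrightarrow>
        (\<forall>f\<in>star_L2. \<forall>g\<in>star_L2.
           (\<lambda>i::nat. star_inner f (E (A i) g)) sums star_inner f (E (\<Union>i. A i) g)))"

definition spectral_measure ::
  "(real set \<Rightarrow> ('n::finite) star_fun \<Rightarrow> 'n star_fun) \<Rightarrow> 'n star_fun \<Rightarrow> real measure" where
  "spectral_measure E f =
     measure_of UNIV (sets borel) (\<lambda>B. ennreal (Re (star_inner f (E B f))))"

(* The integral of \<phi> with respect to the complex measure B |-> <g, E(B) f>, by polarization. *)
definition spectral_form ::
  "(real set \<Rightarrow> ('n::finite) star_fun \<Rightarrow> 'n star_fun) \<Rightarrow> (real \<Rightarrow> real) \<Rightarrow>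
     'n star_fun \<Rightarrow> 'n star_fun \<Rightarrow> complex" where
  "spectral_form E \<phi> g f =
     (1/4) * (\<Sum>k<4. (- \<i>) ^ k *
        of_real (\<integral>s. \<phi> s \<partial>spectral_measure E (\<lambda>j x. g j x + \<i> ^ k * f j x)))"

definition spectral_domain ::
  "(real set \<Rightarrow> ('n::finite) star_fun \<Rightarrow> 'n star_fun) \<Rightarrow> (real \<Rightarrow> real) \<Rightarrow> 'n star_fun set" where
  "spectral_domain E \<phi> = {f \<in> star_L2. integrable (spectral_measure E f) (\<lambda>s. (\<phi> s)\<^sup>2)}"

(* Graph of the operator given by the integral of \<phi> with respect to E. The domain is dense, so
   testing against g in the domain determines h. *)
definition spectral_integral ::
  "(real set \<Rightarrow> ('n::finite) star_fun \<Rightarrow> 'n star_fun) \<Rightarrow> (real \<Rightarrow> real) \<Rightarrow>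
     ('n star_fun \<times> 'n star_fun) set" where
  "spectral_integral E \<phi> =
     {(f, h). f \<in> spectral_domain E \<phi> \<and> h \<in> star_L2 \<and>
        (\<forall>g\<in>spectral_domain E \<phi>. star_inner g h = spectral_form E \<phi> g f)}"

(* E is the spectral measure of the self-adjoint operator with graph A, i.e. A is the integral of
   the identity with respect to E. Functions of A are then \<phi>(A) = spectral_integral E \<phi>. *)
definition is_spectral_measure_of ::
  "(real set \<Rightarrow> ('n::finite) star_fun \<Rightarrow> 'n star_fun) \<Rightarrow> ('n star_fun \<times> 'n star_fun) set \<Rightarrow> bool" where
  "is_spectral_measure_of E A \<longleftrightarrow> star_pvm E \<and> A = spectral_integral E (\<lambda>s. s)"

(* The operator T is defined on all of L^2 and is given by the (matrix-valued) kernel K; the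
   integrability clause excludes integrals that are zero by convention. *)
definition has_integral_kernel ::
  "(('n::finite) star_fun \<times> 'n star_fun) set \<Rightarrow> ('n \<Rightarrow> 'n \<Rightarrow> real \<Rightarrow> real \<Rightarrow> complex) \<Rightarrow> bool" where
  "has_integral_kernel T K \<longleftrightarrow>
     (\<forall>j l. (\<lambda>(x, y). K j l x y) \<in> borel_measurable (halfline \<Otimes>\<^sub>M halfline)) \<and>
     (\<forall>f\<in>star_L2.
        (\<forall>j l x. 0 < x \<longrightarrow> integrable halfline (\<lambda>y. K j l x y * f l y)) \<and>
        (f, \<lambda>j x. \<Sum>l\<in>UNIV. \<integral>y. K j l x y * f l y \<partial>halfline) \<in> T)"

(* Exponential integral, used for Re z < 0 only: with \<zeta> = -z, the integral of exp(-w)/w along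
   the ray w = \<zeta> + r, r >= 0, with a minus sign in front. *)
definition Ei :: "complex \<Rightarrow> complex" where
  "Ei z = - (\<integral>r. exp (- (- z + of_real r)) / (- z + of_real r) \<partial>halfline)"

definition kronecker :: "'n \<Rightarrow> 'n \<Rightarrow> real" where
  "kronecker j l = (if j = l then 1 else 0)"

definition star_cylinder_kernel ::
  "real \<Rightarrow> real \<Rightarrow> ('n::finite) \<Rightarrow> 'n \<Rightarrow> real \<Rightarrow> real \<Rightarrow> real" where
  "star_cylinder_kernel \<alpha> t j l x y =
     (let N = real CARD('n) in
        kronecker j l * ((t / pi) / (t\<^sup>2 + (x - y)\<^sup>2))
        + (2 / N - kronecker j l) * ((t / pi) / (t\<^sup>2 + (x + y)\<^sup>2))
        + 2 * \<alpha> / (pi * N\<^sup>2) * exp (\<alpha> * (x + y) / N)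
          * Im (exp (- \<i> * of_real (\<alpha> * t / N))
                * Ei (\<i> * of_real (\<alpha> * t / N) - of_real (\<alpha> / N * (x + y)))))"

end

(* H is the spectral integral of the identity, so an explicit bounded right inverse R_k of H + k^2
   (the kernel from Krein's formula) forces E to vanish on the negative half-line and yields
   <f, R_k f> = integral of 1/(s + k^2) d<f, E f>. Both e^{-t sqrt s} and the claimed kernel G_t arise
   from the resolvent by the same formula,
     integral over 0 < r < t of e^{-r sqrt s} = (2/pi) * integral over k > 0 of (1 - cos (k t)) / (k^2 + s),
     integral over 0 < r < t of G_r          = (2/pi) * integral over k > 0 of (1 - cos (k t)) R_k,
   where (1 - cos (k t))/k^2 makes the k-integrals absolutely convergent. Continuity in t removes
   the r-integration, and polarization passes from quadratic to sesquilinear forms. *)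

theory Submission
  imports Defs "HOL-Probability.Sinc_Integral" "HOL-Real_Asymp.Real_Asymp"
begin

section \<open>The Hilbert space\<close>

text \<open>All that is known about \<open>E\<close> is that it is a projection-valued measure whose
  integral of the identity has the graph \<open>star_H\<close>. Nonnegativity of the spectrum has to
  be derived, and it matters: \<open>sqrt s\<close> is negative for \<open>s < 0\<close>, so
  \<open>exp (- t * sqrt s)\<close> would be unbounded there. The direct route would be the sine
  transform: e^{-t m} is 2/pi times the integral of k sin (k t)/(k^2 + m^2) over k > 0. It converges
  only conditionally, which blocks the exchange with the spectral integral; one integration in t
  replaces k sin (k t) by 1 - cos (k t), which also compensates the norm bound of order k^-2 for the
  resolvent near k = 0. For the explicit kernels at x \<noteq> y the sine transform itself converges
  absolutely, thanks to exp (-k |x - y|). Origin of the Ei term: with a = \<alpha>/N, the vertex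
  factor is k/(\<alpha> + N k) = (1 - a/(a + k))/N, and a/(a + k) is the Laplace transform of a exp
  (-a s). The vertex coupling thus averages Poisson kernels over shifts s, and this average is an
  exponential integral.\<close>

abbreviation lin_comb :: "('n::finite) star_fun \<Rightarrow> complex \<Rightarrow> 'n star_fun \<Rightarrow> 'n star_fun" where
  "lin_comb g c f \<equiv> (\<lambda>j x. g j x + c * f j x)"

lemma sets_halfline: "sets halfline = sets (restrict_space borel {0<..})"
  unfolding halfline_def by (rule sets_restrict_space_cong) simp

lemma space_halfline [simp]: "space halfline = {0<..}"
  by (simp add: halfline_def space_restrict_space)

lemma sigma_finite_halfline: "sigma_finite_measure halfline"
  unfolding halfline_def by (rule sigma_finite_measure_restrict_space) (auto intro: lborel.sigma_finite_measure_axioms)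

interpretation halfline: sigma_finite_measure halfline
  by (rule sigma_finite_halfline)

interpretation halfline_pair: pair_sigma_finite halfline halfline
  by (simp add: pair_sigma_finite_def sigma_finite_halfline)

lemma borel_measurable_halflineI [measurable (raw)]:
  "f \<in> borel_measurable borel \<Longrightarrow> f \<in> borel_measurable halfline"
  by (subst measurable_cong_sets[OF sets_halfline refl]) (rule measurable_restrict_space1)

lemma borel_measurable_cnj [measurable (raw)]:
  "f \<in> borel_measurable M \<Longrightarrow> (\<lambda>x. cnj (f x)) \<in> borel_measurable M"
  by (erule measurable_compose) (intro borel_measurable_continuous_onI continuous_intros)

definition hL2 :: "(real \<Rightarrow> complex) set" where
  "hL2 = {f. f \<in> borel_measurable halfline \<and> integrable halfline (\<lambda>x. (cmod (f x))\<^sup>2)}"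

lemma star_L2_iff: "f \<in> star_L2 \<longleftrightarrow> (\<forall>j. f j \<in> hL2)"
  by (simp add: star_L2_def hL2_def)

lemma hL2_measurable [measurable_dest]: "f \<in> hL2 \<Longrightarrow> f \<in> borel_measurable halfline"
  by (simp add: hL2_def)

lemma hL2_integrable: "f \<in> hL2 \<Longrightarrow> integrable halfline (\<lambda>x. (cmod (f x))\<^sup>2)"
  by (simp add: hL2_def)

lemma hL2_mult_integrable:
  assumes "f \<in> hL2" "g \<in> hL2"
  shows "integrable halfline (\<lambda>x. cnj (f x) * g x)"
proof (rule Bochner_Integration.integrable_bound)
  show "integrable halfline (\<lambda>x. (cmod (f x))\<^sup>2 + (cmod (g x))\<^sup>2)"
    using assms by (intro Bochner_Integration.integrable_add hL2_integrable)
  have [measurable]: "f \<in> borel_measurable halfline" "g \<in> borel_measurable halfline"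
    using assms by (auto dest: hL2_measurable)
  show "(\<lambda>x. cnj (f x) * g x) \<in> borel_measurable halfline"
    by measurable
  have "cmod a * cmod b \<le> (cmod a)\<^sup>2 + (cmod b)\<^sup>2" for a b
    using sum_squares_bound[of "cmod a" "cmod b"] mult_nonneg_nonneg[OF norm_ge_zero[of a] norm_ge_zero[of b]]
    unfolding mult.assoc by linarith
  then show "AE x in halfline. cmod (cnj (f x) * g x) \<le> norm ((cmod (f x))\<^sup>2 + (cmod (g x))\<^sup>2)"
    by (simp add: norm_mult)
qed

lemma hL2_lin_comb:
  assumes "f \<in> hL2" "g \<in> hL2"
  shows "(\<lambda>x. g x + c * f x) \<in> hL2"
proof -
  have [measurable]: "f \<in> borel_measurable halfline" "g \<in> borel_measurable halfline"
    using assms by (auto dest: hL2_measurable)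
  have "integrable halfline (\<lambda>x. (cmod (g x + c * f x))\<^sup>2)"
  proof (rule Bochner_Integration.integrable_bound)
    show "integrable halfline (\<lambda>x. 2 * (cmod (g x))\<^sup>2 + 2 * (cmod c)\<^sup>2 * (cmod (f x))\<^sup>2)"
      using assms by (auto intro!: Bochner_Integration.integrable_add hL2_integrable)
    have "(cmod (a + c * b))\<^sup>2 \<le> 2 * (cmod a)\<^sup>2 + 2 * (cmod c)\<^sup>2 * (cmod b)\<^sup>2" for a b
    proof -
      have "(cmod (a + c * b))\<^sup>2 \<le> (cmod a + cmod c * cmod b)\<^sup>2"
        using norm_triangle_ineq[of a "c * b"] by (intro power_mono) (auto simp: norm_mult)
      also have "\<dots> \<le> 2 * (cmod a)\<^sup>2 + 2 * (cmod c * cmod b)\<^sup>2"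
        using sum_squares_bound[of "cmod a" "cmod c * cmod b"] by (simp add: power2_sum)
      finally show ?thesis by (simp add: power_mult_distrib)
    qed
    then show "AE x in halfline. norm ((cmod (g x + c * f x))\<^sup>2)
        \<le> norm (2 * (cmod (g x))\<^sup>2 + 2 * (cmod c)\<^sup>2 * (cmod (f x))\<^sup>2)"
      by (intro AE_I2) (simp add: order.trans[OF _ abs_ge_self])
  qed measurable
  then show ?thesis by (simp add: hL2_def)
qed

lemma zero_hL2 [simp]: "(\<lambda>x. 0) \<in> hL2" by (simp add: hL2_def)

lemma hL2_scale: "f \<in> hL2 \<Longrightarrow> (\<lambda>x. c * f x) \<in> hL2"
  using hL2_lin_comb[of f "\<lambda>x. 0" c] by simp

lemma hL2_sum: "finite I \<Longrightarrow> (\<And>i. i \<in> I \<Longrightarrow> f i \<in> hL2) \<Longrightarrow> (\<lambda>x. \<Sum>i\<in>I. f i x) \<in> hL2"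
proof (induction I rule: finite_induct)
  case (insert i I)
  then have "(\<lambda>x. (\<Sum>i\<in>I. f i x) + 1 * f i x) \<in> hL2"
    by (intro hL2_lin_comb) auto
  then show ?case using insert by (simp add: add.commute)
qed simp

lemma star_L2_lin_comb: "f \<in> star_L2 \<Longrightarrow> g \<in> star_L2 \<Longrightarrow> lin_comb g c f \<in> star_L2"
  by (simp add: star_L2_iff hL2_lin_comb)

lemma star_L2_zero [simp]: "(\<lambda>j x. 0) \<in> star_L2"
  by (simp add: star_L2_iff)

lemma star_eq_refl [simp]: "star_eq f f"
  by (simp add: star_eq_def)

lemma star_eq_sym: "star_eq f g \<Longrightarrow> star_eq g f"
  by (simp add: star_eq_def eq_commute)

lemma star_inner_lin_right:
  assumes "f \<in> star_L2" "g \<in> star_L2" "h \<in> star_L2"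
  shows "star_inner h (lin_comb g c f) = star_inner h g + c * star_inner h f"
proof -
  have "(\<integral>x. cnj (h j x) * (g j x + c * f j x) \<partial>halfline) =
      (\<integral>x. cnj (h j x) * g j x \<partial>halfline) + c * (\<integral>x. cnj (h j x) * f j x \<partial>halfline)" for j
  proof -
    have "(\<integral>x. cnj (h j x) * (g j x + c * f j x) \<partial>halfline) =
      (\<integral>x. cnj (h j x) * g j x + c * (cnj (h j x) * f j x) \<partial>halfline)"
      by (simp add: algebra_simps)
    also have "\<dots> = (\<integral>x. cnj (h j x) * g j x \<partial>halfline) + (\<integral>x. c * (cnj (h j x) * f j x) \<partial>halfline)"
      using assms by (intro Bochner_Integration.integral_add integrable_mult_right hL2_mult_integrable)
        (auto simp: star_L2_iff)
    finally show ?thesis by simp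
  qed
  then show ?thesis by (simp add: star_inner_def sum.distrib sum_distrib_left)
qed

lemma star_inner_cnj: "cnj (star_inner f g) = star_inner g f"
proof -
  have "cnj (\<integral>x. cnj (f j x) * g j x \<partial>halfline) = (\<integral>x. cnj (g j x) * f j x \<partial>halfline)" for j
    by (simp add: mult.commute flip: Bochner_Integration.integral_cnj)
  then show ?thesis by (simp add: star_inner_def)
qed

lemma star_inner_lin_left:
  assumes "f \<in> star_L2" "g \<in> star_L2" "h \<in> star_L2"
  shows "star_inner (lin_comb g c f) h = star_inner g h + cnj c * star_inner f h"
  using arg_cong[OF star_inner_lin_right[OF assms], of cnj c]
  by (simp add: star_inner_cnj)

lemma star_inner_zero_left [simp]: "star_inner (\<lambda>j x. 0) g = 0"
  and star_inner_zero_right [simp]: "star_inner g (\<lambda>j x. 0) = 0"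
  by (simp_all add: star_inner_def)

lemma star_inner_self:
  "star_inner f f = of_real (\<Sum>j\<in>UNIV. \<integral>x. (cmod (f j x))\<^sup>2 \<partial>halfline)"
proof -
  have "cnj z * z = complex_of_real ((cmod z)\<^sup>2)" for z
    by (metis complex_norm_square mult.commute)
  then show ?thesis unfolding star_inner_def by (simp only: integral_complex_of_real of_real_sum)
qed

lemma star_inner_self_nonneg: "0 \<le> Re (star_inner f f)"
  by (simp add: star_inner_self sum_nonneg)

text \<open>The axioms of \<open>star_pvm\<close> are equations up to \<open>star_eq\<close>, and
  this is how they enter inner products. Membership in \<open>star_L2\<close> supplies the
  measurability without which two almost everywhere equal integrands could have different Bochner
  integrals.\<close>

lemma star_inner_cong:
  assumes "f \<in> star_L2" "f' \<in> star_L2" "g \<in> star_L2" "g' \<in> star_L2" "star_eq f f'" "star_eq g g'"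
  shows "star_inner f g = star_inner f' g'"
  unfolding star_inner_def
proof (intro sum.cong refl Bochner_Integration.integral_cong_AE)
  fix j
  show "(\<lambda>x. cnj (f j x) * g j x) \<in> borel_measurable halfline"
       "(\<lambda>x. cnj (f' j x) * g' j x) \<in> borel_measurable halfline"
    using assms by (auto intro!: borel_measurable_integrable hL2_mult_integrable simp: star_L2_iff)
  have "AE x in halfline. f j x = f' j x" "AE x in halfline. g j x = g' j x"
    using assms by (auto simp: star_eq_def)
  then show "AE x in halfline. cnj (f j x) * g j x = cnj (f' j x) * g' j x"
    by eventually_elim simp
qed

lemma star_inner_self_eq_0:
  assumes "f \<in> star_L2" "Re (star_inner f f) = 0"
  shows "star_eq f (\<lambda>j x. 0)"
proof -
  have "(\<Sum>j\<in>UNIV. \<integral>x. (cmod (f j x))\<^sup>2 \<partial>halfline) = 0"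
    using assms by (simp add: star_inner_self)
  then have z: "(\<integral>x. (cmod (f j x))\<^sup>2 \<partial>halfline) = 0" for j
    by (subst (asm) sum_nonneg_eq_0_iff) auto
  have i: "integrable halfline (\<lambda>x. (cmod (f j x))\<^sup>2)" for j
    using assms by (simp add: star_L2_iff hL2_def)
  have "AE x in halfline. (cmod (f j x))\<^sup>2 = 0" for j
    using integral_nonneg_eq_0_iff_AE[OF i[of j]] z[of j] by simp
  then show ?thesis by (simp add: star_eq_def)
qed

lemma star_inner_eq_0_left:
  assumes "f \<in> star_L2" "g \<in> star_L2" "Re (star_inner f f) = 0"
  shows "star_inner f g = 0"
  using star_inner_cong[of f "\<lambda>j x. 0" g g] star_inner_self_eq_0[of f] assms
  by (auto simp: star_eq_def)

lemma star_inner_eq_0_right: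
  assumes "f \<in> star_L2" "g \<in> star_L2" "Re (star_inner f f) = 0"
  shows "star_inner g f = 0"
  using star_inner_eq_0_left[OF assms] star_inner_cnj[of f g] by simp

section \<open>Projection-valued measures\<close>

locale star_projections =
  fixes E :: "real set \<Rightarrow> ('n::finite) star_fun \<Rightarrow> 'n star_fun"
  assumes pvm: "star_pvm E"
begin

lemma E_L2 [simp]: "B \<in> sets borel \<Longrightarrow> f \<in> star_L2 \<Longrightarrow> E B f \<in> star_L2"
  using pvm[unfolded star_pvm_def, THEN conjunct1] by simp

lemma E_idem: "B \<in> sets borel \<Longrightarrow> f \<in> star_L2 \<Longrightarrow> star_eq (E B (E B f)) (E B f)"
  using pvm[unfolded star_pvm_def, THEN conjunct2, THEN conjunct2, THEN conjunct2, THEN conjunct1] by simp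

lemma E_sym: "B \<in> sets borel \<Longrightarrow> f \<in> star_L2 \<Longrightarrow> g \<in> star_L2 \<Longrightarrow>
    star_inner (E B f) g = star_inner f (E B g)"
  using pvm[unfolded star_pvm_def, THEN conjunct2, THEN conjunct2, THEN conjunct2, THEN conjunct2, THEN conjunct1] by simp

lemma E_lin:
  assumes "B \<in> sets borel" "f \<in> star_L2" "g \<in> star_L2"
  shows "star_eq (E B (lin_comb g c f)) (lin_comb (E B g) c (E B f))"
  using pvm[unfolded star_pvm_def, THEN conjunct2, THEN conjunct2, THEN conjunct1, rule_format, OF assms, of c]
  by (simp add: add.commute)

lemma E_UNIV: "f \<in> star_L2 \<Longrightarrow> star_eq (E UNIV f) f"
  using pvm[unfolded star_pvm_def, THEN conjunct2, THEN conjunct2, THEN conjunct2, THEN conjunct2, THEN conjunct2, THEN conjunct1] by simp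

lemma E_sums: "range A \<subseteq> sets borel \<Longrightarrow> disjoint_family A \<Longrightarrow> f \<in> star_L2 \<Longrightarrow> g \<in> star_L2 \<Longrightarrow>
    (\<lambda>i::nat. star_inner f (E (A i) g)) sums star_inner f (E (\<Union>i. A i) g)"
  using pvm[unfolded star_pvm_def, THEN conjunct2, THEN conjunct2, THEN conjunct2, THEN conjunct2, THEN conjunct2, THEN conjunct2] by simp

lemma inner_E_lin_right:
  assumes "B \<in> sets borel" "f \<in> star_L2" "g \<in> star_L2" "h \<in> star_L2"
  shows "star_inner h (E B (lin_comb g c f)) = star_inner h (E B g) + c * star_inner h (E B f)"
proof -
  have "star_inner h (E B (lin_comb g c f)) = star_inner h (lin_comb (E B g) c (E B f))"
    using assms by (intro star_inner_cong E_lin star_L2_lin_comb E_L2) auto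
  then show ?thesis using assms by (simp add: star_inner_lin_right)
qed

lemma inner_E_UNIV: "f \<in> star_L2 \<Longrightarrow> g \<in> star_L2 \<Longrightarrow> star_inner g (E UNIV f) = star_inner g f"
  by (rule star_inner_cong) (auto intro: E_UNIV)

text \<open>Idempotence and symmetry turn the form into a squared norm, the source of all positivity
  below.\<close>

lemma inner_E_self:
  assumes "B \<in> sets borel" "f \<in> star_L2"
  shows "star_inner f (E B f) = star_inner (E B f) (E B f)"
proof -
  have "star_inner f (E B f) = star_inner f (E B (E B f))"
    using assms by (intro star_inner_cong) (auto intro: E_idem star_eq_sym)
  also have "\<dots> = star_inner (E B f) (E B f)"
    using assms by (simp add: E_sym)
  finally show ?thesis .
qed

lemma inner_E_nonneg: "B \<in> sets borel \<Longrightarrow> f \<in> star_L2 \<Longrightarrow> 0 \<le> Re (star_inner f (E B f))"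
  by (simp add: inner_E_self star_inner_self_nonneg)

text \<open>A constant sequence is summable only if it is zero, so countable additivity over empty
  sets gives this.\<close>

lemma inner_E_empty:
  assumes "f \<in> star_L2" "g \<in> star_L2"
  shows "star_inner f (E {} g) = 0"
proof -
  have "(\<lambda>i::nat. star_inner f (E {} g)) sums star_inner f (E (\<Union>i::nat. {}) g)"
    using E_sums[of "\<lambda>_. {}" f g] assms by (auto simp: disjoint_family_on_def)
  then have "summable (\<lambda>i::nat. star_inner f (E {} g))" by (rule sums_summable)
  then have "(\<lambda>i::nat. star_inner f (E {} g)) \<longlonglongrightarrow> 0" by (rule summable_LIMSEQ_zero)
  then show ?thesis by (simp add: LIMSEQ_const_iff)
qed

lemma inner_E_Un:
  assumes "A \<in> sets borel" "B \<in> sets borel" "A \<inter> B = {}" "f \<in> star_L2" "g \<in> star_L2"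
  shows "star_inner f (E (A \<union> B) g) = star_inner f (E A g) + star_inner f (E B g)"
proof -
  let ?A = "binaryset A B"
  have "(\<lambda>i. star_inner f (E (?A i) g)) sums star_inner f (E (\<Union>i. ?A i) g)"
    using assms by (intro E_sums) (auto simp: binaryset_def disjoint_family_on_def)
  moreover have "(\<lambda>i. star_inner f (E (?A i) g)) sums (\<Sum>i\<in>{0,1}. star_inner f (E (?A i) g))"
    using assms by (intro sums_finite) (auto simp: binaryset_def inner_E_empty)
  ultimately show ?thesis
    by (simp add: sums_unique2 UN_binaryset_eq) (simp add: binaryset_def sums_iff)
qed

text \<open>\<open>star_pvm\<close> asks for idempotence of each projection but does not state E(A)
  E(C) = E(A \<inter> C). Orthogonality comes from positivity: for x = E(A) g, additivity over A and
  its complement leaves <x, E(-A) x> = 0, and <x, E(C) x> is one of two nonnegative parts of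
  it.\<close>

lemma inner_E_disjoint:
  assumes "A \<in> sets borel" "C \<in> sets borel" "A \<inter> C = {}" "f \<in> star_L2" "g \<in> star_L2"
  shows "star_inner f (E C (E A g)) = 0"
proof -
  let ?x = "E A g"
  have x: "?x \<in> star_L2" using assms by simp
  have "star_inner ?x ?x = star_inner ?x (E (A \<union> - A) ?x)"
    using x by (simp add: inner_E_UNIV)
  also have "\<dots> = star_inner ?x (E A ?x) + star_inner ?x (E (- A) ?x)"
    using assms x by (intro inner_E_Un) auto
  also have "star_inner ?x (E A ?x) = star_inner ?x ?x"
    using assms x by (intro star_inner_cong) (auto intro: E_idem)
  finally have "star_inner ?x (E (- A) ?x) = 0" by simp
  moreover have "- A = C \<union> (- A - C)" using assms by auto
  ultimately have "star_inner ?x (E C ?x) + star_inner ?x (E (- A - C) ?x) = 0"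
    using inner_E_Un[of C "- A - C" ?x ?x] assms x by auto
  then have "Re (star_inner ?x (E C ?x)) + Re (star_inner ?x (E (- A - C) ?x)) = 0"
    by (metis plus_complex.sel(1) zero_complex.sel(1))
  then have "Re (star_inner ?x (E C ?x)) = 0"
    using inner_E_nonneg[of C ?x] inner_E_nonneg[of "- A - C" ?x] assms x by auto
  then have "Re (star_inner (E C ?x) (E C ?x)) = 0"
    using assms x by (simp add: inner_E_self)
  then show ?thesis using assms x by (intro star_inner_eq_0_right) auto
qed

text \<open>Split g along A and its complement; the complementary part is orthogonal to the range of
  E(C).\<close>

lemma inner_E_subset:
  assumes "A \<in> sets borel" "C \<in> sets borel" "C \<subseteq> A" "f \<in> star_L2" "g \<in> star_L2"
  shows "star_inner f (E C (E A g)) = star_inner f (E C g)"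
proof -
  let ?y = "E C f"
  have "star_inner f (E C g) = star_inner ?y (E (A \<union> - A) g)"
    using assms by (simp add: E_sym inner_E_UNIV)
  also have "\<dots> = star_inner ?y (E A g) + star_inner ?y (E (- A) g)"
    using assms by (intro inner_E_Un) auto
  also have "star_inner ?y (E (- A) g) = cnj (star_inner g (E (- A) ?y))"
    using assms by (simp add: star_inner_cnj E_sym)
  also have "star_inner g (E (- A) ?y) = 0"
    using assms by (intro inner_E_disjoint) auto
  finally show ?thesis using assms by (simp add: E_sym)
qed

section \<open>Scalar spectral measures\<close>

abbreviation \<mu> :: "'n star_fun \<Rightarrow> real measure" where "\<mu> \<equiv> spectral_measure E"

lemma sets_spectral [simp, measurable_cong]: "sets (\<mu> f) = sets borel"
  and space_spectral [simp]: "space (\<mu> f) = UNIV"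
  by (simp_all add: spectral_measure_def sets.sigma_sets_eq[of borel, simplified])

text \<open>\<open>measure_of\<close> yields the zero measure unless the set function is positive
  and countably additive, and \<open>ennreal\<close> truncates negative reals. Both properties
  therefore have to be checked before the definition can be unfolded.\<close>

lemma emeasure_spectral:
  assumes f: "f \<in> star_L2" and B: "B \<in> sets borel"
  shows "emeasure (\<mu> f) B = ennreal (Re (star_inner f (E B f)))"
proof (rule emeasure_measure_of[OF spectral_measure_def])
  show "positive (sets (\<mu> f)) (\<lambda>B. ennreal (Re (star_inner f (E B f))))"
    using f by (simp add: positive_def inner_E_empty)
  show "countably_additive (sets (\<mu> f)) (\<lambda>B. ennreal (Re (star_inner f (E B f))))"
  proof (rule countably_additiveI)
    fix A :: "nat \<Rightarrow> real set"
    assume A: "range A \<subseteq> sets (\<mu> f)" "disjoint_family A"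
    then have "(\<lambda>i. star_inner f (E (A i) f)) sums star_inner f (E (\<Union>i. A i) f)"
      using f by (intro E_sums) auto
    then have s: "(\<lambda>i. Re (star_inner f (E (A i) f))) sums Re (star_inner f (E (\<Union>i. A i) f))"
      by (rule sums_Re)
    show "(\<Sum>i. ennreal (Re (star_inner f (E (A i) f)))) = ennreal (Re (star_inner f (E (\<Union>i. A i) f)))"
      using A f by (subst suminf_ennreal2)
        (auto simp: sums_unique[OF s, symmetric] intro!: inner_E_nonneg sums_summable[OF s])
  qed
qed (use B in auto)

lemma finite_measure_spectral: "f \<in> star_L2 \<Longrightarrow> finite_measure (\<mu> f)"
  by (rule finite_measureI) (simp add: emeasure_spectral)

lemma measure_spectral:
  "f \<in> star_L2 \<Longrightarrow> B \<in> sets borel \<Longrightarrow> measure (\<mu> f) B = Re (star_inner f (E B f))"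
  by (simp add: measure_def emeasure_spectral inner_E_nonneg)

lemma inner_E_quadratic:
  assumes "B \<in> sets borel" "f \<in> star_L2" "g \<in> star_L2"
  shows "star_inner (lin_comb g c f) (E B (lin_comb g c f)) =
     star_inner g (E B g) + c * star_inner g (E B f) + cnj c * cnj (star_inner g (E B f))
       + cnj c * c * star_inner f (E B f)"
proof -
  have "star_inner f (E B g) = cnj (star_inner g (E B f))"
    using assms by (simp add: star_inner_cnj E_sym)
  then show ?thesis
    using assms by (simp add: inner_E_lin_right star_inner_lin_left star_L2_lin_comb algebra_simps)
qed

text \<open>Replacing g by E(A) g can be noticed only off A, where it removes g altogether and
  leaves the measure of c u.\<close>

lemma inner_E_project:
  assumes "A \<in> sets borel" "B \<in> sets borel" "u \<in> star_L2" "g \<in> star_L2"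
  shows "B \<subseteq> A \<Longrightarrow> star_inner (lin_comb (E A g) c u) (E B (lin_comb (E A g) c u)) =
           star_inner (lin_comb g c u) (E B (lin_comb g c u))"
    and "B \<inter> A = {} \<Longrightarrow> star_inner (lin_comb (E A g) c u) (E B (lin_comb (E A g) c u)) =
           cnj c * c * star_inner u (E B u)"
proof -
  assume "B \<subseteq> A"
  have 1: "star_inner (E A g) (E B u) = star_inner g (E B u)"
  proof -
    have "star_inner (E A g) (E B u) = cnj (star_inner u (E B (E A g)))"
      using assms by (simp add: star_inner_cnj E_sym)
    also have "\<dots> = cnj (star_inner u (E B g))"
      using inner_E_subset[OF assms(1,2) \<open>B \<subseteq> A\<close> assms(3,4)] by simp
    also have "\<dots> = star_inner g (E B u)"
      using assms by (simp add: star_inner_cnj E_sym)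
    finally show ?thesis .
  qed
  have "star_inner (E A g) (E B (E A g)) = star_inner (E A g) (E B g)"
    using assms \<open>B \<subseteq> A\<close> by (intro inner_E_subset) auto
  also have "\<dots> = cnj (star_inner g (E B (E A g)))"
    using assms by (simp add: star_inner_cnj E_sym)
  also have "\<dots> = cnj (star_inner g (E B g))"
    using inner_E_subset[OF assms(1,2) \<open>B \<subseteq> A\<close> assms(4,4)] by simp
  also have "\<dots> = star_inner g (E B g)"
    using assms by (simp add: star_inner_cnj E_sym)
  finally show "star_inner (lin_comb (E A g) c u) (E B (lin_comb (E A g) c u)) =
           star_inner (lin_comb g c u) (E B (lin_comb g c u))"
    using assms by (simp add: inner_E_quadratic 1)
next
  assume "B \<inter> A = {}"
  have "star_inner (E A g) (E B u) = cnj (star_inner u (E B (E A g)))"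
    using assms by (simp add: star_inner_cnj E_sym)
  also have "\<dots> = 0" using assms \<open>B \<inter> A = {}\<close> by (subst inner_E_disjoint) auto
  finally have 1: "star_inner (E A g) (E B u) = 0" .
  have "star_inner (E A g) (E B (E A g)) = 0"
    using assms \<open>B \<inter> A = {}\<close> by (intro inner_E_disjoint) auto
  then show "star_inner (lin_comb (E A g) c u) (E B (lin_comb (E A g) c u)) =
           cnj c * c * star_inner u (E B u)"
    using assms by (simp add: inner_E_quadratic 1)
qed

end

section \<open>Equalities of integrals from equalities of measures\<close>

lemma integral_eq_on:
  fixes \<phi> :: "real \<Rightarrow> real"
  assumes [simp, measurable_cong]: "sets M = sets borel" "sets N = sets borel" and A [measurable]: "A \<in> sets borel"
    and eq: "\<And>B. B \<in> sets borel \<Longrightarrow> B \<subseteq> A \<Longrightarrow> emeasure M B = emeasure N B"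
    and [measurable]: "\<phi> \<in> borel_measurable borel"
  shows "(\<integral>x. indicator A x * \<phi> x \<partial>M) = (\<integral>x. indicator A x * \<phi> x \<partial>N)"
    and "integrable M (\<lambda>x. indicator A x * \<phi> x) \<longleftrightarrow> integrable N (\<lambda>x. indicator A x * \<phi> x)"
proof -
  have [simp]: "space M = UNIV" "space N = UNIV"
    using sets_eq_imp_space_eq[of M borel] sets_eq_imp_space_eq[of N borel] by auto
  have d: "density M (\<lambda>x. ennreal (indicator A x)) = density N (\<lambda>x. ennreal (indicator A x))"
  proof (rule measure_eqI)
    fix B assume "B \<in> sets (density M (\<lambda>x. ennreal (indicator A x)))"
    then have B [measurable]: "B \<in> sets borel" by simp
    have "emeasure (density M (\<lambda>x. ennreal (indicator A x))) B = emeasure M (A \<inter> B)"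
      by (simp add: emeasure_density ennreal_indicator flip: indicator_inter_arith)
    also have "\<dots> = emeasure N (A \<inter> B)" by (intro eq) auto
    also have "\<dots> = emeasure (density N (\<lambda>x. ennreal (indicator A x))) B"
      by (simp add: emeasure_density ennreal_indicator flip: indicator_inter_arith)
    finally show "emeasure (density M (\<lambda>x. ennreal (indicator A x))) B =
      emeasure (density N (\<lambda>x. ennreal (indicator A x))) B" .
  qed simp
  show "(\<integral>x. indicator A x * \<phi> x \<partial>M) = (\<integral>x. indicator A x * \<phi> x \<partial>N)"
    using arg_cong[OF d, of "\<lambda>M. integral\<^sup>L M \<phi>"] by (simp add: integral_real_density)
  show "integrable M (\<lambda>x. indicator A x * \<phi> x) \<longleftrightarrow> integrable N (\<lambda>x. indicator A x * \<phi> x)"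
    using arg_cong[OF d, of "\<lambda>M. integrable M \<phi>"] by (simp add: integrable_real_density)
qed

text \<open>Polarization yields identities between differences of spectral measures. Rearranged into
  sums, they need no signed measures and extend from sets to nonnegative functions by the standard
  induction.\<close>

lemma nn_integral_sum_measure:
  assumes [measurable_cong]: "sets N = sets M" "sets L = sets M"
    and eq: "\<And>B. B \<in> sets M \<Longrightarrow> emeasure M B = emeasure N B + emeasure L B"
    and f: "f \<in> borel_measurable M"
  shows "(\<integral>\<^sup>+x. f x \<partial>M) = (\<integral>\<^sup>+x. f x \<partial>N) + (\<integral>\<^sup>+x. f x \<partial>L)"
  using f
proof (induction rule: borel_measurable_induct)
  case (cong f g)
  moreover have "space N = space M" "space L = space M"
    using assms by (auto dest: sets_eq_imp_space_eq)
  ultimately show ?case by (simp cong: nn_integral_cong_simp)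
next
  case (set A)
  then show ?case using assms by simp
next
  case (mult u v)
  then show ?case by (simp add: nn_integral_cmult distrib_left cong: measurable_cong_sets)
next
  case (add u v)
  then show ?case by (simp add: nn_integral_add ac_simps)
next
  case (seq U)
  have [measurable]: "U i \<in> borel_measurable M" for i using seq by auto
  have "(\<integral>\<^sup>+x. Sup (range U) x \<partial>K) = (SUP i. \<integral>\<^sup>+x. U i x \<partial>K)" if [measurable_cong]: "sets K = sets M" for K
    unfolding SUP_apply using seq by (intro nn_integral_monotone_convergence_SUP) measurable
  then have "(\<integral>\<^sup>+x. Sup (range U) x \<partial>M) = (SUP i. (\<integral>\<^sup>+x. U i x \<partial>N) + (\<integral>\<^sup>+x. U i x \<partial>L))"
    using seq by simp
  also have "\<dots> = (SUP i. \<integral>\<^sup>+x. U i x \<partial>N) + (SUP i. \<integral>\<^sup>+x. U i x \<partial>L)"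
    using seq by (intro ennreal_SUP_add) (auto simp: incseq_def le_fun_def intro!: nn_integral_mono)
  finally show ?case
    using \<open>\<And>K. sets K = sets M \<Longrightarrow> (\<integral>\<^sup>+x. Sup (range U) x \<partial>K) = (SUP i. \<integral>\<^sup>+x. U i x \<partial>K)\<close> assms by simp
qed

text \<open>The four integrals are real, so the terms k = 1 and k = 3, which carry the factors -i
  and i, are purely imaginary.\<close>

lemma Re_spectral_form:
  "Re (spectral_form E \<phi> g f) =
    ((\<integral>s. \<phi> s \<partial>spectral_measure E (lin_comb g 1 f)) - (\<integral>s. \<phi> s \<partial>spectral_measure E (lin_comb g (-1) f))) / 4"
  by (simp add: spectral_form_def eval_nat_numeral lessThan_Suc)

section \<open>Localization and scaling of spectral integrals\<close>

context star_projections
begin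

lemma integrable_spectral_bounded:
  fixes \<phi> :: "real \<Rightarrow> real"
  assumes "f \<in> star_L2" "\<phi> \<in> borel_measurable borel" "AE s in \<mu> f. \<bar>\<phi> s\<bar> \<le> b"
  shows "integrable (\<mu> f) \<phi>"
proof -
  interpret finite_measure "\<mu> f" using assms by (intro finite_measure_spectral)
  show ?thesis using assms by (intro integrable_const_bound[of _ b]) auto
qed

lemma integrable_id_spectral:
  assumes "f \<in> star_L2" "integrable (\<mu> f) (\<lambda>s. s\<^sup>2)"
  shows "integrable (\<mu> f) (\<lambda>s. s)"
proof -
  interpret finite_measure "\<mu> f" using assms by (intro finite_measure_spectral)
  show ?thesis
  proof (rule Bochner_Integration.integrable_bound)
    show "integrable (\<mu> f) (\<lambda>s. s\<^sup>2 + 1)" using assms by auto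
    have "\<bar>s\<bar> \<le> s\<^sup>2 + 1" for s :: real
      using sum_squares_bound[of "\<bar>s\<bar>" 1] by simp
    then show "AE s in \<mu> f. norm s \<le> norm (s\<^sup>2 + 1)" by (simp add: order.trans[OF _ abs_ge_self])
  qed simp
qed

text \<open>Split the line into A and its complement and use \<open>inner_E_project\<close> on each
  piece. The condition on c says that it has modulus 1, so c u and u have the same spectral
  measure.\<close>

lemma integral_spectral_project:
  fixes \<phi> :: "real \<Rightarrow> real"
  assumes A [measurable]: "A \<in> sets borel" and u: "u \<in> star_L2" and g: "g \<in> star_L2"
    and c: "cnj c * c = 1" and \<phi> [measurable]: "\<phi> \<in> borel_measurable borel"
    and i1: "integrable (\<mu> (lin_comb g c u)) (\<lambda>s. indicator A s * \<phi> s)" and i2: "integrable (\<mu> u) \<phi>"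
  shows "(\<integral>s. \<phi> s \<partial>\<mu> (lin_comb (E A g) c u)) =
      (\<integral>s. indicator A s * \<phi> s \<partial>\<mu> (lin_comb g c u)) + (\<integral>s. indicator (- A) s * \<phi> s \<partial>\<mu> u)"
proof -
  let ?v = "lin_comb (E A g) c u" let ?w = "lin_comb g c u"
  have v: "?v \<in> star_L2" "?w \<in> star_L2" using A u g by (auto intro!: star_L2_lin_comb)
  have 1: "emeasure (\<mu> ?v) B = emeasure (\<mu> ?w) B" if "B \<in> sets borel" "B \<subseteq> A" for B
    using inner_E_project(1)[OF A that(1) u g that(2), of c] v that by (simp add: emeasure_spectral)
  have 2: "emeasure (\<mu> ?v) B = emeasure (\<mu> u) B" if "B \<in> sets borel" "B \<subseteq> - A" for B
    using inner_E_project(2)[OF A that(1) u g, of c] v that u c by (subst (1 2) emeasure_spectral) (auto simp: disjoint_eq_subset_Compl)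
  have i2': "integrable (\<mu> u) (\<lambda>s. indicator (- A) s * \<phi> s)"
    using integrable_real_mult_indicator[OF _ i2, of "- A"] by (simp add: mult.commute)
  have A': "- A \<in> sets borel" by simp
  note eq1 = integral_eq_on[OF sets_spectral sets_spectral A 1 \<phi>]
  note eq2 = integral_eq_on[OF sets_spectral sets_spectral A' 2 \<phi>]
  have iv: "integrable (\<mu> ?v) (\<lambda>s. indicator A s * \<phi> s)" "integrable (\<mu> ?v) (\<lambda>s. indicator (- A) s * \<phi> s)"
    using eq1(2) eq2(2) i1 i2' by simp_all
  have "(\<integral>s. \<phi> s \<partial>\<mu> ?v) = (\<integral>s. indicator A s * \<phi> s + indicator (- A) s * \<phi> s \<partial>\<mu> ?v)"
    by (intro Bochner_Integration.integral_cong) (auto split: split_indicator)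
  also have "\<dots> = (\<integral>s. indicator A s * \<phi> s \<partial>\<mu> ?v) + (\<integral>s. indicator (- A) s * \<phi> s \<partial>\<mu> ?v)"
    using iv by (rule Bochner_Integration.integral_add)
  also have "(\<integral>s. indicator A s * \<phi> s \<partial>\<mu> ?v) = (\<integral>s. indicator A s * \<phi> s \<partial>\<mu> ?w)"
    by (rule eq1(1))
  also have "(\<integral>s. indicator (- A) s * \<phi> s \<partial>\<mu> ?v) = (\<integral>s. indicator (- A) s * \<phi> s \<partial>\<mu> u)"
    by (rule eq2(1))
  finally show ?thesis .
qed

lemma AE_spectral_project:
  assumes A: "A \<in> sets borel" and g: "g \<in> star_L2"
  shows "AE s in \<mu> (E A g). s \<in> A"
proof (rule AE_I)
  have "star_inner (E A g) (E (- A) (E A g)) = 0"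
    using A g by (intro inner_E_disjoint) auto
  then show "emeasure (\<mu> (E A g)) (- A) = 0"
    using A g by (simp add: emeasure_spectral)
qed (use A in auto)

lemma bounded_indicator_mult:
  fixes s c :: real
  assumes "A \<subseteq> {-b..b}"
  shows "\<bar>indicator A s * (s + c)\<bar> \<le> \<bar>b\<bar> + \<bar>c\<bar>"
  using assms by (auto split: split_indicator simp: subset_iff abs_le_iff)

text \<open>Testing against \<open>E(A)g\<close> localizes the form to \<open>A\<close>: outside \<open>A\<close> the spectral measures of
  \<open>E(A)g \<plusminus> u\<close> both agree with that of \<open>u\<close> and cancel.\<close>

lemma spectral_integral_id_project:
  assumes uh: "(u, h) \<in> spectral_integral E (\<lambda>s. s)" and g: "g \<in> star_L2"
    and A [measurable]: "A \<in> sets borel" and Ab: "A \<subseteq> {-b..b}"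
  shows "4 * Re (star_inner (E A g) (lin_comb h (of_real c) u)) =
    (\<integral>s. indicator A s * (s + c) \<partial>\<mu> (lin_comb g 1 u)) - (\<integral>s. indicator A s * (s + c) \<partial>\<mu> (lin_comb g (-1) u))"
proof -
  have u: "u \<in> star_L2" and h: "h \<in> star_L2" and us: "integrable (\<mu> u) (\<lambda>s. s\<^sup>2)"
    and form: "\<And>g. g \<in> spectral_domain E (\<lambda>s. s) \<Longrightarrow> star_inner g h = spectral_form E (\<lambda>s. s) g u"
    using uh by (auto simp: spectral_integral_def spectral_domain_def)
  have us1: "integrable (\<mu> u) (\<lambda>s. s)" by (rule integrable_id_spectral[OF u us])
  have EAg: "E A g \<in> star_L2" using A g by simp
  \<comment> \<open>For arbitrary g, the projection E(A) g is an admissible test vector: its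
    spectral measure lives on the bounded set A.\<close>
  have "AE s in \<mu> (E A g). \<bar>s\<^sup>2\<bar> \<le> b\<^sup>2"
    using AE_spectral_project[OF A g]
  proof eventually_elim
    case (elim s)
    then have "\<bar>s\<bar> \<le> \<bar>b\<bar>" using Ab by (auto simp: subset_iff abs_le_iff)
    then show ?case by (simp add: abs_le_square_iff)
  qed
  then have "integrable (\<mu> (E A g)) (\<lambda>s. s\<^sup>2)"
    using EAg by (intro integrable_spectral_bounded) auto
  then have "E A g \<in> spectral_domain E (\<lambda>s. s)" using EAg by (simp add: spectral_domain_def)
  from form[OF this]
  have 1: "4 * Re (star_inner (E A g) h) =
     (\<integral>s. s \<partial>\<mu> (lin_comb (E A g) 1 u)) - (\<integral>s. s \<partial>\<mu> (lin_comb (E A g) (-1) u))"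
    by (simp add: Re_spectral_form)
  have int: "integrable (\<mu> (lin_comb g d u)) (\<lambda>s. indicator A s * s)" for d
    using bounded_indicator_mult[OF Ab, of _ 0] u g
    by (intro integrable_spectral_bounded[where b="\<bar>b\<bar>"] star_L2_lin_comb) auto
  have int1: "integrable (\<mu> (lin_comb g d u)) (\<lambda>s. indicator A s :: real)" for d
    using u g by (intro integrable_spectral_bounded[where b=1] star_L2_lin_comb) auto
  have 2: "(\<integral>s. s \<partial>\<mu> (lin_comb (E A g) d u)) =
     (\<integral>s. indicator A s * s \<partial>\<mu> (lin_comb g d u)) + (\<integral>s. indicator (- A) s * s \<partial>\<mu> u)"
    if "cnj d * d = 1" for d
    by (rule integral_spectral_project[OF A u g that _ int us1]) simp
  have 3: "4 * Re (star_inner (E A g) h) =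
     (\<integral>s. indicator A s * s \<partial>\<mu> (lin_comb g 1 u)) - (\<integral>s. indicator A s * s \<partial>\<mu> (lin_comb g (-1) u))"
    unfolding 1 using 2[of 1] 2[of "-1"] by simp
  have m: "(\<integral>s. indicator A s \<partial>\<mu> (lin_comb g d u)) = Re (star_inner (lin_comb g d u) (E A (lin_comb g d u)))" for d
    using u g star_L2_lin_comb[OF u g, of d] by (simp add: measure_spectral)
  \<comment> \<open>Polarizing the indicator of A brings the inner product with u into the same
    shape as the one with h.\<close>
  have "4 * Re (star_inner (E A g) u) = 4 * Re (star_inner g (E A u))"
    using u g by (simp add: E_sym)
  also have "\<dots> = (\<integral>s. indicator A s \<partial>\<mu> (lin_comb g 1 u)) - (\<integral>s. indicator A s \<partial>\<mu> (lin_comb g (-1) u))"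
    unfolding m inner_E_quadratic[OF A u g] by simp
  finally have 4: "4 * Re (star_inner (E A g) u) = \<dots>" .
  have 5: "(\<integral>s. indicator A s * (s + c) \<partial>\<mu> (lin_comb g d u)) =
      (\<integral>s. indicator A s * s \<partial>\<mu> (lin_comb g d u)) + c * (\<integral>s. indicator A s \<partial>\<mu> (lin_comb g d u))" for d
  proof -
    have "(\<integral>s. indicator A s * (s + c) \<partial>\<mu> (lin_comb g d u)) =
      (\<integral>s. indicator A s * s + c * indicator A s \<partial>\<mu> (lin_comb g d u))"
      by (simp add: algebra_simps)
    also have "\<dots> = (\<integral>s. indicator A s * s \<partial>\<mu> (lin_comb g d u)) + (\<integral>s. c * indicator A s \<partial>\<mu> (lin_comb g d u))"
      by (intro Bochner_Integration.integral_add int integrable_mult_right int1)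
    finally show ?thesis by simp
  qed
  have "4 * Re (star_inner (E A g) (lin_comb h (of_real c) u)) =
      4 * Re (star_inner (E A g) h) + c * (4 * Re (star_inner (E A g) u))"
    using EAg u h by (simp add: star_inner_lin_right)
  then show ?thesis unfolding 3 4 5 by (simp add: algebra_simps)
qed

lemma emeasure_spectral_scale:
  assumes "u \<in> star_L2" "B \<in> sets borel"
  shows "emeasure (\<mu> (\<lambda>j x. d * u j x)) B = ennreal ((cmod d)\<^sup>2) * emeasure (\<mu> u) B"
proof -
  have "(\<lambda>j x. d * u j x) \<in> star_L2"
    using assms by (simp add: star_L2_iff hL2_scale)
  moreover have "star_inner (\<lambda>j x. d * u j x) (E B (\<lambda>j x. d * u j x)) = cnj d * d * star_inner u (E B u)"
    using inner_E_quadratic[OF assms(2,1) star_L2_zero, of d] assms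
      inner_E_lin_right[OF assms(2) star_L2_zero star_L2_zero, of u 1]
    by simp
  moreover have "cnj d * d = of_real ((cmod d)\<^sup>2)"
    by (metis complex_norm_square mult.commute)
  ultimately show ?thesis
    using assms by (simp add: emeasure_spectral inner_E_nonneg flip: ennreal_mult)
qed

lemma integral_spectral_scale:
  fixes \<phi> :: "real \<Rightarrow> real"
  assumes "u \<in> star_L2" and [measurable]: "\<phi> \<in> borel_measurable borel"
  shows "(\<integral>s. \<phi> s \<partial>\<mu> (\<lambda>j x. d * u j x)) = (cmod d)\<^sup>2 * (\<integral>s. \<phi> s \<partial>\<mu> u)"
proof -
  have "\<mu> (\<lambda>j x. d * u j x) = density (\<mu> u) (\<lambda>_. ennreal ((cmod d)\<^sup>2))"
    using assms by (intro measure_eqI) (auto simp: emeasure_spectral_scale emeasure_density nn_integral_cmult_indicator)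
  then show ?thesis by (simp add: integral_real_density)
qed

text \<open>The vectors are (1 + i^k) u. Their weights |1 + i^k|^2 are 4, 2, 0, 2 and meet the
  factors 1, -i, -1, i; the sum is 4.\<close>

lemma spectral_form_self:
  assumes "u \<in> star_L2" and [measurable]: "\<phi> \<in> borel_measurable borel"
  shows "spectral_form E \<phi> u u = of_real (\<integral>s. \<phi> s \<partial>\<mu> u)"
proof -
  have "lin_comb u c u = (\<lambda>j x. (1 + c) * u j x)" for c by (simp add: algebra_simps)
  then have "spectral_form E \<phi> u u = (1/4) * (\<Sum>k<4. (- \<i>) ^ k * of_real ((cmod (1 + \<i> ^ k))\<^sup>2 * (\<integral>s. \<phi> s \<partial>\<mu> u)))"
    by (simp add: spectral_form_def integral_spectral_scale[OF assms])
  also have "\<dots> = of_real (\<integral>s. \<phi> s \<partial>\<mu> u)"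
    by (simp add: eval_nat_numeral lessThan_Suc cmod_def algebra_simps)
  finally show ?thesis .
qed

end

text \<open>\<open>R_graph\<close> says that (A + k^2) R_k f = f for the operator A given by the
  integral of the identity, and \<open>R_norm\<close> that R_k has norm at most sqrt D / k^2. These
  are the facts about the explicit resolvent from which the spectral argument proceeds.\<close>

locale star_resolvent = star_projections E for E :: "real set \<Rightarrow> ('n::finite) star_fun \<Rightarrow> 'n star_fun" +
  fixes R :: "real \<Rightarrow> 'n star_fun \<Rightarrow> 'n star_fun" and D :: real
  assumes D_nonneg: "0 \<le> D"
    and R_norm: "0 < k \<Longrightarrow> f \<in> star_L2 \<Longrightarrow> Re (star_inner (R k f) (R k f)) \<le> D / k ^ 4 * Re (star_inner f f)"
    and R_graph: "0 < k \<Longrightarrow> f \<in> star_L2 \<Longrightarrow>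
      (R k f, lin_comb f (- of_real (k\<^sup>2)) (R k f)) \<in> spectral_integral E (\<lambda>s. s)"
begin

lemma R_L2: "0 < k \<Longrightarrow> f \<in> star_L2 \<Longrightarrow> R k f \<in> star_L2"
  using R_graph[of k f] by (simp add: spectral_integral_def spectral_domain_def)

lemma R_project:
  assumes "0 < k" "f \<in> star_L2" "g \<in> star_L2" "A \<in> sets borel" "A \<subseteq> {-b..b}"
  shows "4 * Re (star_inner (E A g) f) =
    (\<integral>s. indicator A s * (s + k\<^sup>2) \<partial>\<mu> (lin_comb g 1 (R k f))) - (\<integral>s. indicator A s * (s + k\<^sup>2) \<partial>\<mu> (lin_comb g (-1) (R k f)))"
  using spectral_integral_id_project[OF R_graph[OF assms(1,2)] assms(3-5), of "k\<^sup>2"] by simp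

text \<open>If \<open>f = E(A)f\<close> with \<open>A\<close> close to \<open>-k\<^sup>2\<close>, then \<open>\<parallel>f\<parallel> = \<parallel>(H + k\<^sup>2) R\<^sub>k f\<parallel>\<close> is a small multiple of
  \<open>\<parallel>R\<^sub>k f\<parallel>\<close>, so \<open>f = 0\<close>.\<close>

lemma spectral_null_near:
  assumes k: "0 < k" and f: "f \<in> star_L2"
  defines "\<epsilon> \<equiv> 1 / (1 + D / k ^ 4)"
  shows "AE s in \<mu> f. s \<notin> {- k\<^sup>2 - \<epsilon> .. - k\<^sup>2 + \<epsilon>}"
proof (rule AE_I)
  let ?A = "{- k\<^sup>2 - \<epsilon> .. - k\<^sup>2 + \<epsilon>}"
  have D': "0 \<le> D / k ^ 4" using D_nonneg k by simp
  then have \<epsilon>: "0 < \<epsilon>" "\<epsilon> * (1 + D / k ^ 4) = 1" by (auto simp: \<epsilon>_def)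
  have A: "?A \<in> sets borel" by simp
  define g where "g = E ?A f"
  define u where "u = R k g"
  have g: "g \<in> star_L2" using f by (simp add: g_def)
  have u: "u \<in> star_L2" using R_L2[OF k g] by (simp add: u_def)
  have proj: "4 * Re (star_inner (E ?A g) g) =
    (\<integral>s. indicator ?A s * (s + k\<^sup>2) \<partial>\<mu> (lin_comb g 1 u)) - (\<integral>s. indicator ?A s * (s + k\<^sup>2) \<partial>\<mu> (lin_comb g (-1) u))"
    unfolding u_def using \<epsilon> by (intro R_project[where b="k\<^sup>2 + \<epsilon>"] k g A) auto
  have idem: "star_inner (E ?A g) g = star_inner g g"
    unfolding g_def using f A by (intro star_inner_cong E_idem) auto
  have "\<bar>\<integral>s. indicator ?A s * (s + k\<^sup>2) \<partial>\<mu> (lin_comb g d u)\<bar> \<le>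
       \<epsilon> * Re (star_inner (lin_comb g d u) (lin_comb g d u))" for d
  proof -
    have w: "lin_comb g d u \<in> star_L2" using g u by (rule star_L2_lin_comb[rotated])
    interpret finite_measure "\<mu> (lin_comb g d u)" by (rule finite_measure_spectral[OF w])
    have b: "\<bar>indicator ?A s * (s + k\<^sup>2)\<bar> \<le> \<epsilon>" for s
      using \<epsilon> by (auto split: split_indicator simp: abs_le_iff)
    have "\<bar>\<integral>s. indicator ?A s * (s + k\<^sup>2) \<partial>\<mu> (lin_comb g d u)\<bar> \<le> (\<integral>s. \<epsilon> \<partial>\<mu> (lin_comb g d u))"
      using b integrable_spectral_bounded[OF w, of "\<lambda>s. indicator ?A s * (s + k\<^sup>2)" \<epsilon>]
      by (intro order.trans[OF integral_abs_bound] integral_mono) auto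
    also have "\<dots> = \<epsilon> * Re (star_inner (lin_comb g d u) (lin_comb g d u))"
      using w inner_E_UNIV[OF w w] by (simp add: measure_spectral)
    finally show ?thesis .
  qed
  \<comment> \<open>By \<open>proj\<close> and \<open>idem\<close>, 4 <g, g> is the difference of
    the two integrals. By the parallelogram law their absolute values add up to at most 2 \<epsilon>
    (<g, g> + <u, u>), and \<epsilon> is chosen so that \<open>R_norm\<close> bounds this by 2 <g,
    g>.\<close>
  from this[of 1] this[of "-1"]
  have "\<bar>\<integral>s. indicator ?A s * (s + k\<^sup>2) \<partial>\<mu> (lin_comb g 1 u)\<bar> + \<bar>\<integral>s. indicator ?A s * (s + k\<^sup>2) \<partial>\<mu> (lin_comb g (-1) u)\<bar>
     \<le> \<epsilon> * (Re (star_inner (lin_comb g 1 u) (lin_comb g 1 u)) + Re (star_inner (lin_comb g (-1) u) (lin_comb g (-1) u)))"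
    by (simp only: distrib_left)
  also have "Re (star_inner (lin_comb g 1 u) (lin_comb g 1 u)) + Re (star_inner (lin_comb g (-1) u) (lin_comb g (-1) u))
     = 2 * (Re (star_inner g g) + Re (star_inner u u))"
    unfolding star_inner_lin_left[OF u g star_L2_lin_comb[OF u g]] star_inner_lin_right[OF u g g]
      star_inner_lin_right[OF u g u] by simp
  also have "\<epsilon> * \<dots> \<le> \<epsilon> * (2 * (Re (star_inner g g) + D / k ^ 4 * Re (star_inner g g)))"
    using \<epsilon>(1) R_norm[OF k g] unfolding u_def by (intro mult_left_mono) auto
  also have "\<dots> = 2 * (\<epsilon> * (1 + D / k ^ 4)) * Re (star_inner g g)"
    by (simp add: algebra_simps)
  also have "\<dots> = 2 * Re (star_inner g g)" using \<epsilon> by simp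
  finally have "Re (star_inner g g) \<le> 0" using proj unfolding idem by linarith
  then have "Re (star_inner g g) = 0" using star_inner_self_nonneg[of g] by simp
  then have "Re (star_inner f (E ?A f)) = 0"
    unfolding g_def using f A by (simp add: inner_E_self)
  then show "emeasure (\<mu> f) ?A = 0" using f A by (simp only: emeasure_spectral ennreal_0)
qed auto

text \<open>Countably many null intervals, centred at -r for rational r > 0, cover the negative
  axis. Their half-width 1/(1 + D/r^2) does not shrink as r grows, so a rational r slightly above -s
  has an interval that contains s.\<close>

lemma AE_spectral_nonneg:
  assumes f: "f \<in> star_L2"
  shows "AE s in \<mu> f. 0 \<le> s"
proof -
  have "AE s in \<mu> f. \<forall>r::rat. 0 < r \<longrightarrow> \<not> \<bar>s + of_rat r\<bar> \<le> 1 / (1 + D / (of_rat r)\<^sup>2)"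
  proof (subst AE_all_countable, intro allI)
    fix r :: rat
    show "AE s in \<mu> f. 0 < r \<longrightarrow> \<not> \<bar>s + of_rat r\<bar> \<le> 1 / (1 + D / (of_rat r)\<^sup>2)"
    proof (cases "0 < r")
      case True
      define k where "k = sqrt (of_rat r)"
      have k: "0 < k" "k\<^sup>2 = of_rat r" using True by (auto simp: k_def)
      then have "k ^ 4 = (of_rat r)\<^sup>2" by (simp add: power2_eq_square eval_nat_numeral)
      with spectral_null_near[OF k(1) f] k(2) show ?thesis
        by (auto simp: abs_le_iff elim!: eventually_mono)
    qed simp
  qed
  then show ?thesis
  proof eventually_elim
    case (elim s)
    show "0 \<le> s"
    proof (rule ccontr)
      assume "\<not> 0 \<le> s"
      then have s: "0 < - s" by simp
      let ?\<delta> = "1 / (1 + D / (- s)\<^sup>2)"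
      have "0 \<le> D / (- s)\<^sup>2" using D_nonneg by simp
      then have "0 < ?\<delta>" by (simp add: add_pos_nonneg)
      then obtain r where r: "- s < of_rat r" "of_rat r < - s + ?\<delta>"
        using of_rat_dense[of "- s" "- s + ?\<delta>"] by auto
      with s have "0 < real_of_rat r" by linarith
      then have r0: "0 < r" by simp
      have "D / (of_rat r)\<^sup>2 \<le> D / (- s)\<^sup>2"
        using D_nonneg r s r0 by (intro divide_left_mono power_mono mult_pos_pos zero_less_power) auto
      moreover have "0 \<le> D / (real_of_rat r)\<^sup>2" using D_nonneg by simp
      ultimately have "?\<delta> \<le> 1 / (1 + D / (of_rat r)\<^sup>2)"
        by (intro divide_left_mono mult_pos_pos add_pos_nonneg) auto
      then have "\<bar>s + of_rat r\<bar> \<le> 1 / (1 + D / (of_rat r)\<^sup>2)" using r by linarith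
      then show False using elim r0 by auto
    qed
  qed
qed

text \<open>The vector R_k f lies in the domain, so it can serve as its own test vector in the graph
  equation.\<close>

lemma resolvent_form_R:
  assumes k: "0 < k" and f: "f \<in> star_L2"
  shows "star_inner (R k f) f = of_real (\<integral>s. (s + k\<^sup>2) \<partial>\<mu> (R k f))"
    and "integrable (\<mu> (R k f)) (\<lambda>s. s + k\<^sup>2)"
proof -
  let ?u = "R k f"
  note g = R_graph[OF k f]
  have u: "?u \<in> star_L2" and dom: "?u \<in> spectral_domain E (\<lambda>s. s)"
    and ui: "integrable (\<mu> ?u) (\<lambda>s. s)"
    using g integrable_id_spectral by (auto simp: spectral_integral_def spectral_domain_def)
  have "star_inner ?u (lin_comb f (- of_real (k\<^sup>2)) ?u) = spectral_form E (\<lambda>s. s) ?u ?u"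
    using g dom by (auto simp: spectral_integral_def)
  then have "star_inner ?u f = of_real (\<integral>s. s \<partial>\<mu> ?u) + of_real (k\<^sup>2) * star_inner ?u ?u"
    unfolding star_inner_lin_right[OF u f u] by (simp add: spectral_form_self[OF u] algebra_simps)
  also have "star_inner ?u ?u = of_real (measure (\<mu> ?u) UNIV)"
    using u by (simp add: measure_spectral inner_E_UNIV) (simp add: star_inner_self)
  also have "of_real (\<integral>s. s \<partial>\<mu> ?u) + of_real (k\<^sup>2) * of_real (measure (\<mu> ?u) UNIV) =
      complex_of_real ((\<integral>s. s \<partial>\<mu> ?u) + (\<integral>s. k\<^sup>2 \<partial>\<mu> ?u))"
    by simp
  also have "(\<integral>s. s \<partial>\<mu> ?u) + (\<integral>s. k\<^sup>2 \<partial>\<mu> ?u) = (\<integral>s. (s + k\<^sup>2) \<partial>\<mu> ?u)"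
    using ui finite_measure.integrable_const[OF finite_measure_spectral[OF u]]
    by (intro Bochner_Integration.integral_add[symmetric]) auto
  finally show "star_inner ?u f = of_real (\<integral>s. (s + k\<^sup>2) \<partial>\<mu> ?u)" .
  show "integrable (\<mu> ?u) (\<lambda>s. s + k\<^sup>2)"
    by (intro Bochner_Integration.integrable_add ui finite_measure.integrable_const finite_measure_spectral u)
qed

lemma nn_integral_AE_bounded:
  assumes f: "f \<in> star_L2" and A: "A \<in> sets borel" "A \<subseteq> {-b..b}"
  shows "ennreal (\<integral>s. indicator A s * (s + k\<^sup>2) \<partial>\<mu> f) = (\<integral>\<^sup>+s. ennreal (s + k\<^sup>2) * indicator A s \<partial>\<mu> f)"
    and "0 \<le> (\<integral>s. indicator A s * (s + k\<^sup>2) \<partial>\<mu> f)"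
proof -
  have pos: "AE s in \<mu> f. 0 \<le> indicator A s * (s + k\<^sup>2)"
    using AE_spectral_nonneg[OF f] by eventually_elim (auto split: split_indicator)
  have "(\<integral>\<^sup>+s. ennreal (s + k\<^sup>2) * indicator A s \<partial>\<mu> f) = (\<integral>\<^sup>+s. ennreal (indicator A s * (s + k\<^sup>2)) \<partial>\<mu> f)"
    by (intro nn_integral_cong) (auto split: split_indicator)
  also have "\<dots> = ennreal (\<integral>s. indicator A s * (s + k\<^sup>2) \<partial>\<mu> f)"
    using pos bounded_indicator_mult[OF A(2)] A
    by (intro nn_integral_eq_integral integrable_spectral_bounded[OF f]) auto
  finally show "ennreal (\<integral>s. indicator A s * (s + k\<^sup>2) \<partial>\<mu> f) = (\<integral>\<^sup>+s. ennreal (s + k\<^sup>2) * indicator A s \<partial>\<mu> f)" ..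
  show "0 \<le> (\<integral>s. indicator A s * (s + k\<^sup>2) \<partial>\<mu> f)" using pos by (rule integral_nonneg_AE)
qed

text \<open>Put u = R_k f. Testing against u shows that the measures of f + u and f - u differ by 4
  (s + k^2) times that of u. Testing against f shows that integrating s + k^2 over A against this
  difference gives 4 times the measure of f. Combining the two produces the square of s + k^2.
  Bounded A keeps all integrals finite.\<close>

lemma emeasure_spectral_R_bounded:
  assumes k: "0 < k" and f: "f \<in> star_L2" and A [measurable]: "A \<in> sets borel" and Ab: "A \<subseteq> {-b..b}"
  shows "emeasure (\<mu> f) A = (\<integral>\<^sup>+s. ennreal (s + k\<^sup>2) * (ennreal (s + k\<^sup>2) * indicator A s) \<partial>\<mu> (R k f))"
proof -
  let ?u = "R k f"
  let ?p = "\<lambda>s. ennreal (s + k\<^sup>2)"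
  let ?M = "\<mu> (lin_comb f 1 ?u)" let ?N = "\<mu> (lin_comb f (-1) ?u)"
  have u: "?u \<in> star_L2" by (rule R_L2[OF k f])
  have M: "lin_comb f d ?u \<in> star_L2" for d by (rule star_L2_lin_comb[OF u f])
  have key: "emeasure ?M B = emeasure ?N B + (\<integral>\<^sup>+s. 4 * ?p s * indicator B s \<partial>\<mu> ?u)"
    if B [measurable]: "B \<in> sets borel" and "B \<subseteq> A" for B
  proof -
    have Bb: "B \<subseteq> {-b..b}" using that Ab by auto
    let ?I = "\<integral>s. indicator B s * (s + k\<^sup>2) \<partial>\<mu> ?u"
    \<comment> \<open>With u as test vector the polarization pair is 2 u and 0, so a single integral
      with weight 4 survives.\<close>
    have c: "lin_comb ?u 1 ?u = (\<lambda>j x. 2 * ?u j x)" "lin_comb ?u (-1) ?u = (\<lambda>j x. 0 * ?u j x)"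
      by auto
    have "4 * Re (star_inner (E B ?u) f) = 4 * ?I"
      using R_project[OF k f u B Bb] integral_spectral_scale[OF u, of "\<lambda>s. indicator B s * (s + k\<^sup>2)" 2]
        integral_spectral_scale[OF u, of "\<lambda>s. indicator B s * (s + k\<^sup>2)" 0]
      unfolding c by simp
    moreover have "star_inner (E B ?u) f = cnj (star_inner f (E B ?u))"
      using u f by (simp add: star_inner_cnj)
    ultimately have "Re (star_inner f (E B ?u)) = ?I" by simp
    then have "Re (star_inner (lin_comb f 1 ?u) (E B (lin_comb f 1 ?u))) =
      Re (star_inner (lin_comb f (-1) ?u) (E B (lin_comb f (-1) ?u))) + 4 * ?I"
      unfolding inner_E_quadratic[OF B u f] by simp
    then have "emeasure ?M B = emeasure ?N B + ennreal (4 * ?I)"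
      unfolding emeasure_spectral[OF M B]
      using inner_E_nonneg[OF B M, of "-1"] nn_integral_AE_bounded(2)[OF u B Bb, of k]
      by (simp flip: ennreal_plus)
    also have "ennreal (4 * ?I) = 4 * (\<integral>\<^sup>+s. ?p s * indicator B s \<partial>\<mu> ?u)"
      using nn_integral_AE_bounded[OF u B Bb, of k] by (simp add: ennreal_mult)
    also have "\<dots> = (\<integral>\<^sup>+s. 4 * ?p s * indicator B s \<partial>\<mu> ?u)"
      by (subst nn_integral_cmult[symmetric]) (auto simp: mult.assoc)
    finally show ?thesis .
  qed
  have "(\<integral>\<^sup>+s. ?p s \<partial>density ?M (indicator A)) =
     (\<integral>\<^sup>+s. ?p s \<partial>density ?N (indicator A)) + (\<integral>\<^sup>+s. ?p s \<partial>density (\<mu> ?u) (\<lambda>s. 4 * ?p s * indicator A s))"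
  proof (rule nn_integral_sum_measure)
    fix B assume "B \<in> sets (density ?M (indicator A))"
    then have B [measurable]: "B \<in> sets borel" by simp
    show "emeasure (density ?M (indicator A)) B = emeasure (density ?N (indicator A)) B +
      emeasure (density (\<mu> ?u) (\<lambda>s. 4 * ?p s * indicator A s)) B"
      using key[of "A \<inter> B"]
      by (simp add: emeasure_density mult.assoc flip: indicator_inter_arith)
  qed simp_all
  then have "(\<integral>\<^sup>+s. ?p s * indicator A s \<partial>?M) =
     (\<integral>\<^sup>+s. ?p s * indicator A s \<partial>?N) + (\<integral>\<^sup>+s. 4 * (?p s * (?p s * indicator A s)) \<partial>\<mu> ?u)"
    by (simp add: nn_integral_density ac_simps)
  moreover have "(\<integral>\<^sup>+s. ?p s * indicator A s \<partial>?M) = (\<integral>\<^sup>+s. ?p s * indicator A s \<partial>?N) + ennreal (4 * Re (star_inner (E A f) f))"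
  proof -
    have "0 \<le> Re (star_inner (E A f) f)" using f inner_E_nonneg[of A f] by (simp add: E_sym)
    moreover have "(\<integral>s. indicator A s * (s + k\<^sup>2) \<partial>?M) = (\<integral>s. indicator A s * (s + k\<^sup>2) \<partial>?N) + 4 * Re (star_inner (E A f) f)"
      using R_project[OF k f f A Ab] by simp
    ultimately show ?thesis
      unfolding nn_integral_AE_bounded(1)[OF M A Ab, symmetric]
      using nn_integral_AE_bounded(2)[OF M A Ab, of "-1" k] by (simp flip: ennreal_plus)
  qed
  \<comment> \<open>Finiteness permits cancelling the common term in \<open>ennreal\<close>.\<close>
  moreover have "(\<integral>\<^sup>+s. ?p s * indicator A s \<partial>?N) < top"
    using nn_integral_AE_bounded(1)[OF M A Ab, of "-1" k] by (metis ennreal_less_top)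
  ultimately have "ennreal (4 * Re (star_inner (E A f) f)) = (\<integral>\<^sup>+s. 4 * (?p s * (?p s * indicator A s)) \<partial>\<mu> ?u)"
    by (auto simp: ennreal_add_left_cancel)
  also have "\<dots> = 4 * (\<integral>\<^sup>+s. ?p s * (?p s * indicator A s) \<partial>\<mu> ?u)"
    by (simp add: nn_integral_cmult)
  also have "ennreal (4 * Re (star_inner (E A f) f)) = 4 * emeasure (\<mu> f) A"
    using f by (simp add: emeasure_spectral E_sym ennreal_mult inner_E_nonneg)
  finally show ?thesis by (simp add: ennreal_mult_cancel_left)
qed

text \<open>Bounded sets exhaust the line, and both measures are continuous from below.\<close>

lemma spectral_density_R:
  assumes k: "0 < k" and f: "f \<in> star_L2"
  shows "\<mu> f = density (\<mu> (R k f)) (\<lambda>s. ennreal (s + k\<^sup>2) * ennreal (s + k\<^sup>2))"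
proof (rule measure_eqI)
  fix B assume "B \<in> sets (\<mu> f)"
  then have B [measurable]: "B \<in> sets borel" by simp
  let ?\<nu> = "density (\<mu> (R k f)) (\<lambda>s. ennreal (s + k\<^sup>2) * ennreal (s + k\<^sup>2))"
  let ?B = "\<lambda>n::nat. B \<inter> {- real n .. real n}"
  have UN: "(\<Union>n. ?B n) = B"
  proof -
    have "x \<in> (\<Union>n::nat. {- real n .. real n})" for x
    proof -
      obtain n where "\<bar>x\<bar> \<le> real n" using real_arch_simple by blast
      then show ?thesis by (intro UN_I[of n]) (auto simp: abs_le_iff)
    qed
    then show ?thesis by auto
  qed
  have inc: "incseq ?B" by (auto simp: incseq_def)
  have "emeasure (\<mu> f) B = (SUP n. emeasure (\<mu> f) (?B n))"
    by (subst SUP_emeasure_incseq) (use inc UN in auto)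
  also have "\<dots> = (SUP n. emeasure ?\<nu> (?B n))"
    by (intro SUP_cong refl) (subst emeasure_spectral_R_bounded[OF k f], auto simp: emeasure_density mult.assoc)
  also have "\<dots> = emeasure ?\<nu> B"
    by (subst SUP_emeasure_incseq) (use inc UN in auto)
  finally show "emeasure (\<mu> f) B = emeasure ?\<nu> B" .
qed simp

text \<open>The density (s + k^2)^2 turns the integral of 1/(s + k^2) against the measure of f into
  that of s + k^2 against the measure of R_k f, which is <R_k f, f>. Dividing by s + k^2 is
  legitimate because the spectrum is nonnegative and k > 0.\<close>

lemma resolvent_form:
  assumes k: "0 < k" and f: "f \<in> star_L2"
  shows "(\<integral>\<^sup>+s. ennreal (1 / (s + k\<^sup>2)) \<partial>\<mu> f) = ennreal (Re (star_inner f (R k f)))"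
    and "star_inner f (R k f) = of_real (Re (star_inner f (R k f)))"
    and "0 \<le> Re (star_inner f (R k f))"
proof -
  let ?u = "R k f"
  have u: "?u \<in> star_L2" by (rule R_L2[OF k f])
  let ?p = "\<lambda>s. ennreal (s + k\<^sup>2)"
  have pos: "AE s in \<mu> ?u. 0 \<le> s + k\<^sup>2"
    using AE_spectral_nonneg[OF u] by eventually_elim simp
  have "star_inner f ?u = cnj (star_inner ?u f)" by (simp add: star_inner_cnj)
  then have eq: "star_inner f ?u = of_real (\<integral>s. (s + k\<^sup>2) \<partial>\<mu> ?u)"
    using resolvent_form_R[OF k f] by simp
  then show "star_inner f ?u = of_real (Re (star_inner f ?u))" by simp
  show "0 \<le> Re (star_inner f ?u)" using pos unfolding eq by (simp add: integral_nonneg_AE)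
  have "(\<integral>\<^sup>+s. ennreal (1 / (s + k\<^sup>2)) \<partial>\<mu> f) = (\<integral>\<^sup>+s. ?p s * ?p s * ennreal (1 / (s + k\<^sup>2)) \<partial>\<mu> ?u)"
    unfolding spectral_density_R[OF k f] by (simp add: nn_integral_density)
  also have "\<dots> = (\<integral>\<^sup>+s. ?p s \<partial>\<mu> ?u)"
  proof (intro nn_integral_cong_AE)
    show "AE s in \<mu> ?u. ?p s * ?p s * ennreal (1 / (s + k\<^sup>2)) = ?p s"
      using AE_spectral_nonneg[OF u]
    proof eventually_elim
      case (elim s)
      then have "0 < s + k\<^sup>2" using k by (simp add: add_nonneg_pos)
      then show ?case by (simp flip: ennreal_mult)
    qed
  qed
  also have "\<dots> = ennreal (\<integral>s. (s + k\<^sup>2) \<partial>\<mu> ?u)"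
    using pos resolvent_form_R(2)[OF k f] by (rule nn_integral_eq_integral[rotated])
  finally show "(\<integral>\<^sup>+s. ennreal (1 / (s + k\<^sup>2)) \<partial>\<mu> f) = ennreal (Re (star_inner f ?u))"
    unfolding eq by simp
qed

end

section \<open>Integrals over the half-line\<close>

lemma id_halfline_borel: "(\<lambda>x. x) \<in> measurable halfline borel"
  by (rule borel_measurable_halflineI) simp

text \<open>The sigma-algebra of \<open>halfline\<close> is a trace of \<open>borel\<close>.
  Composing with the inclusion allows kernels to be treated as Borel functions on the plane.\<close>

lemma measurable_borel_halfline:
  assumes M: "sets M = sets borel" and f: "f \<in> measurable (borel \<Otimes>\<^sub>M borel) N"
  shows "f \<in> measurable (M \<Otimes>\<^sub>M halfline) N" and "f \<in> measurable (halfline \<Otimes>\<^sub>M M) N"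
    and "f \<in> measurable (halfline \<Otimes>\<^sub>M halfline) N"
proof -
  have M': "(\<lambda>x. x) \<in> measurable M borel" using measurable_ident_sets[OF M] .
  have "(\<lambda>p. (fst p, snd p)) \<in> measurable (M \<Otimes>\<^sub>M halfline) (borel \<Otimes>\<^sub>M borel)"
       "(\<lambda>p. (fst p, snd p)) \<in> measurable (halfline \<Otimes>\<^sub>M M) (borel \<Otimes>\<^sub>M borel)"
       "(\<lambda>p. (fst p, snd p)) \<in> measurable (halfline \<Otimes>\<^sub>M halfline) (borel \<Otimes>\<^sub>M borel)"
    by (intro measurable_Pair measurable_compose[OF measurable_fst] measurable_compose[OF measurable_snd]
        M' id_halfline_borel)+
  from this[THEN measurable_compose, OF f]
  show "f \<in> measurable (M \<Otimes>\<^sub>M halfline) N" and "f \<in> measurable (halfline \<Otimes>\<^sub>M M) N"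
    and "f \<in> measurable (halfline \<Otimes>\<^sub>M halfline) N" by simp_all
qed

lemma integral_halfline:
  fixes f :: "real \<Rightarrow> 'a::{banach, second_countable_topology}"
  shows "(\<integral>x. f x \<partial>halfline) = (\<integral>x. indicator {0<..} x *\<^sub>R f x \<partial>lborel)"
  unfolding halfline_def by (subst integral_restrict_space) auto

lemma integrable_halfline:
  fixes f :: "real \<Rightarrow> 'a::{banach, second_countable_topology}"
  shows "integrable halfline f \<longleftrightarrow> integrable lborel (\<lambda>x. indicator {0<..} x *\<^sub>R f x)"
  unfolding halfline_def by (subst integrable_restrict_space) auto

lemma nn_integral_halfline:
  "(\<integral>\<^sup>+x. f x \<partial>halfline) = (\<integral>\<^sup>+x. f x * indicator {0<..} x \<partial>lborel)"
  unfolding halfline_def by (subst nn_integral_restrict_space) auto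

lemma AE_halfline_pos: "AE x in halfline. 0 < x"
  by (rule AE_I2) simp

lemma AE_halfline_neq: "AE x in halfline. x \<noteq> (c::real)"
proof -
  have "AE x in lborel. 0 < x \<longrightarrow> x \<noteq> c"
    using AE_lborel_singleton[of c] by eventually_elim simp
  then show ?thesis unfolding halfline_def by (subst AE_restrict_space_iff) auto
qed

lemma nn_integral_halfline_atLeast:
  "(\<integral>\<^sup>+x. f x \<partial>halfline) = (\<integral>\<^sup>+x. f x * indicator {0..} x \<partial>lborel)"
  unfolding nn_integral_halfline
proof (intro nn_integral_cong_AE)
  show "AE x in lborel. f x * indicator {0<..} x = f x * indicator {0..} (x::real)"
    using AE_lborel_singleton[of 0] by eventually_elim (auto split: split_indicator)
qed

lemma integrable_indicator_lessThan_halfline: "integrable halfline (\<lambda>\<tau>. indicator {..<t} \<tau> :: real)"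
proof -
  have "integrable lborel (\<lambda>\<tau>. indicator {0<..<t} \<tau> :: real)"
    by (intro integrable_real_indicator) (auto intro: emeasure_bounded_finite[unfolded infinity_ennreal_def])
  moreover have "(\<lambda>\<tau>. indicator {0<..} \<tau> *\<^sub>R (indicator {..<t} \<tau> :: real)) = indicator {0<..<t}"
    by (auto split: split_indicator)
  ultimately show ?thesis by (simp add: integrable_halfline)
qed

section \<open>Exponential, Poisson and damped sine integrals\<close>

lemma nn_integral_exp_halfline:
  assumes "0 < c"
  shows "(\<integral>\<^sup>+x. ennreal (exp (- (c * x))) \<partial>halfline) = ennreal (1 / c)"
proof -
  have "(\<integral>\<^sup>+x. ennreal (exp (- (c * x))) * indicator {0..} x \<partial>lborel) = ennreal (0 - (- exp (- (c * 0)) / c))"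
  proof (rule nn_integral_FTC_atLeast)
    show "DERIV (\<lambda>x. - exp (- (c * x)) / c) x :> exp (- (c * x))" for x
      using assms by (auto intro!: derivative_eq_intros)
    show "((\<lambda>x. - exp (- (c * x)) / c) \<longlongrightarrow> 0) at_top"
      using assms by real_asymp
  qed auto
  then show ?thesis by (simp add: nn_integral_halfline_atLeast)
qed

lemma integrable_exp_halfline:
  assumes "0 < c"
  shows "integrable halfline (\<lambda>x. exp (- (c * x)))"
  using nn_integral_exp_halfline[OF assms] by (intro integrableI_nonneg) auto

lemma integral_exp_halfline: "0 < c \<Longrightarrow> (\<integral>x. exp (- (c * x)) \<partial>halfline) = 1 / c"
  using nn_integral_exp_halfline[of c] by (subst integral_eq_nn_integral) auto

lemma nn_integral_cauchy_halfline:
  assumes "0 < t"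
  shows "(\<integral>\<^sup>+x. ennreal (t / (t\<^sup>2 + x\<^sup>2)) \<partial>halfline) = ennreal (pi / 2)"
proof -
  have "(\<integral>\<^sup>+x. ennreal (t / (t\<^sup>2 + x\<^sup>2)) * indicator {0..} x \<partial>lborel) = ennreal (pi / 2 - arctan (0 / t))"
  proof (rule nn_integral_FTC_atLeast)
    show "DERIV (\<lambda>x. arctan (x / t)) x :> t / (t\<^sup>2 + x\<^sup>2)" for x
      using assms by (auto intro!: derivative_eq_intros simp: field_simps power2_eq_square)
    show "((\<lambda>x. arctan (x / t)) \<longlongrightarrow> pi / 2) at_top"
      using assms by real_asymp
  qed (use assms in auto)
  then show ?thesis by (simp add: nn_integral_halfline_atLeast)
qed

text \<open>On the whole line translation removes x, and reflection folds the integral back. The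
  factor 2 for the two sides reappears in \<open>dominated_kernel\<close>.\<close>

lemma nn_integral_halfline_abs_le:
  fixes q :: "real \<Rightarrow> ennreal"
  assumes [measurable]: "q \<in> borel_measurable borel"
  shows "(\<integral>\<^sup>+y. q \<bar>x - y\<bar> \<partial>halfline) \<le> 2 * (\<integral>\<^sup>+y. q y \<partial>halfline)"
proof -
  have "(\<integral>\<^sup>+y. q \<bar>x - y\<bar> \<partial>halfline) \<le> (\<integral>\<^sup>+y. q \<bar>x - y\<bar> \<partial>lborel)"
    unfolding nn_integral_halfline by (intro nn_integral_mono) (auto split: split_indicator)
  also have "\<dots> = (\<integral>\<^sup>+y. q \<bar>y\<bar> \<partial>lborel)"
    by (subst nn_integral_real_affine[where c="-1" and t=x]) auto
  also have "\<dots> = (\<integral>\<^sup>+y. q y * indicator {0<..} y + q (- y) * indicator {0<..} (- y) \<partial>lborel)"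
    using AE_lborel_singleton[of 0] by (intro nn_integral_cong_AE) (auto split: split_indicator)
  also have "\<dots> = (\<integral>\<^sup>+y. q y * indicator {0<..} y \<partial>lborel) + (\<integral>\<^sup>+y. q (- y) * indicator {0<..} (- y) \<partial>lborel)"
    by (intro nn_integral_add) auto
  also have "(\<integral>\<^sup>+y. q (- y) * indicator {0<..} (- y) \<partial>lborel) = (\<integral>\<^sup>+y. q y * indicator {0<..} y \<partial>lborel)"
    by (subst nn_integral_real_affine[where c="-1" and t=0]) auto
  finally show ?thesis by (simp add: nn_integral_halfline mult_2)
qed

text \<open>Meant for integrands that change sign: integrability supplies the dominating function
  that carries the truncated integrals to the limit.\<close>

lemma halfline_FTC:
  fixes f F :: "real \<Rightarrow> real"
  assumes F: "\<And>x. 0 \<le> x \<Longrightarrow> (F has_real_derivative f x) (at x)" and f: "continuous_on {0..} f"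
    and int: "integrable halfline f" and lim: "(F \<longlongrightarrow> L) at_top"
  shows "(\<integral>x. f x \<partial>halfline) = L - F 0"
proof -
  have int': "integrable lborel (\<lambda>x. indicator {0<..} x * f x)"
    using int by (simp add: integrable_halfline)
  have "(\<lambda>n::nat. \<integral>x. indicator {0..real n} x *\<^sub>R f x \<partial>lborel) \<longlonglongrightarrow> (\<integral>x. indicator {0<..} x * f x \<partial>lborel)"
  proof (rule integral_dominated_convergence)
    show "integrable lborel (\<lambda>x. \<bar>indicator {0<..} x * f x\<bar>)" using int' by (rule integrable_abs)
    show "(\<lambda>x. indicator {0<..} x * f x) \<in> borel_measurable lborel" using int' by simp
    show "(\<lambda>x. indicator {0..real n} x *\<^sub>R f x) \<in> borel_measurable lborel" for n
      using continuous_on_subset[OF f] borel_measurable_continuous_on_indicator[of "{0..real n}" f] by auto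
    show "AE x in lborel. (\<lambda>n. indicator {0..real n} x *\<^sub>R f x) \<longlonglongrightarrow> indicator {0<..} x * f x"
      using AE_lborel_singleton[of 0]
    proof eventually_elim
      case (elim x)
      have "\<forall>\<^sub>F n::nat in sequentially. x \<le> real n"
        using filterlim_real_sequentially unfolding filterlim_at_top by blast
      then have "\<forall>\<^sub>F n::nat in sequentially. indicator {0..real n} x *\<^sub>R f x = indicator {0<..} x * f x"
        by eventually_elim (use elim in \<open>auto split: split_indicator\<close>)
      then show ?case by (rule tendsto_eventually)
    qed
    show "AE x in lborel. norm (indicator {0..real n} x *\<^sub>R f x) \<le> \<bar>indicator {0<..} x * f x\<bar>" for n
      using AE_lborel_singleton[of 0] by eventually_elim (auto split: split_indicator)
  qed
  also have "(\<lambda>n::nat. \<integral>x. indicator {0..real n} x *\<^sub>R f x \<partial>lborel) = (\<lambda>n. F (real n) - F 0)"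
  proof
    show "(\<integral>x. indicator {0..real n} x *\<^sub>R f x \<partial>lborel) = F (real n) - F 0" for n :: nat
      using F f by (intro integral_FTC_atLeastAtMost)
        (auto intro: continuous_on_subset has_field_derivative_at_within simp flip: has_real_derivative_iff_has_vector_derivative)
  qed
  finally have "(\<lambda>n. F (real n) - F 0) \<longlonglongrightarrow> (\<integral>x. f x \<partial>halfline)"
    by (simp add: integral_halfline)
  moreover have "(\<lambda>n. F (real n) - F 0) \<longlonglongrightarrow> L - F 0"
    by (intro tendsto_intros filterlim_compose[OF lim filterlim_real_sequentially])
  ultimately show ?thesis by (rule LIMSEQ_unique)
qed

lemma integrable_sin_exp_halfline:
  assumes "0 < z"
  shows "integrable halfline (\<lambda>k. sin (k * t) * exp (- (z * k)))"
proof (rule Bochner_Integration.integrable_bound[OF integrable_exp_halfline[OF assms]])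
  show "AE k in halfline. norm (sin (k * t) * exp (- (z * k))) \<le> norm (exp (- (z * k)))"
    by (intro AE_I2) (simp add: abs_mult mult_le_cancel_right1)
qed measurable

text \<open>Up to the factor pi this Laplace transform of the sine is the Poisson kernel at distance
  z, the link between resolvents and cylinder kernels.\<close>

lemma integral_sin_exp_halfline:
  assumes z: "0 < z"
  shows "(\<integral>k. sin (k * t) * exp (- (z * k)) \<partial>halfline) = t / (t\<^sup>2 + z\<^sup>2)"
proof -
  \<comment> \<open>The antiderivative is the imaginary part of exp ((i t - z) k)/(i t - z).\<close>
  let ?F = "\<lambda>k. - (exp (- (z * k)) * (z * sin (k * t) + t * cos (k * t))) / (t\<^sup>2 + z\<^sup>2)"
  have pos: "0 < t\<^sup>2 + z\<^sup>2" using z by (simp add: add_nonneg_pos)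
  have "(\<integral>k. sin (k * t) * exp (- (z * k)) \<partial>halfline) = 0 - ?F 0"
  proof (rule halfline_FTC[OF _ _ integrable_sin_exp_halfline[OF z]])
    show "(?F has_real_derivative sin (k * t) * exp (- (z * k))) (at k)" for k
    proof -
      have "((\<lambda>k. - (exp (- (z * k)) * (z * sin (k * t) + t * cos (k * t)))) has_real_derivative
          (t\<^sup>2 + z\<^sup>2) * (sin (k * t) * exp (- (z * k)))) (at k)"
        by (auto intro!: derivative_eq_intros simp: algebra_simps power2_eq_square)
      from DERIV_cdivide[OF this, of "t\<^sup>2 + z\<^sup>2"] show ?thesis using z by simp
    qed
    show "continuous_on {0..} (\<lambda>k. sin (k * t) * exp (- (z * k)))"
      by (intro continuous_intros)
    show "(?F \<longlongrightarrow> 0) at_top"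
    proof (rule Lim_null_comparison)
      show "\<forall>\<^sub>F k in at_top. norm (?F k) \<le> exp (- (z * k)) * ((\<bar>z\<bar> + \<bar>t\<bar>) / (t\<^sup>2 + z\<^sup>2))"
      proof (intro always_eventually allI)
        fix k
        have "\<bar>z * sin (k * t) + t * cos (k * t)\<bar> \<le> \<bar>z\<bar> * 1 + \<bar>t\<bar> * 1"
          by (intro order.trans[OF abs_triangle_ineq] add_mono) (auto simp: abs_mult mult_left_le)
        then show "norm (?F k) \<le> exp (- (z * k)) * ((\<bar>z\<bar> + \<bar>t\<bar>) / (t\<^sup>2 + z\<^sup>2))"
          using pos by (simp add: abs_mult divide_right_mono)
      qed
      show "((\<lambda>k. exp (- (z * k)) * ((\<bar>z\<bar> + \<bar>t\<bar>) / (t\<^sup>2 + z\<^sup>2))) \<longlongrightarrow> 0) at_top"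
        using z by real_asymp
    qed
  qed
  then show ?thesis by simp
qed

section \<open>The transform with weight 1 - cos (k t)\<close>

lemma one_minus_cos_le: "1 - cos x \<le> \<bar>x\<bar>" for x :: real
proof -
  have "1 - cos x = 2 * (sin (x / 2))\<^sup>2" using cos_double_sin[of "x / 2"] by simp
  also have "\<dots> = 2 * \<bar>sin (x / 2)\<bar> * \<bar>sin (x / 2)\<bar>" by (simp add: power2_eq_square)
  also have "\<dots> \<le> 2 * \<bar>x / 2\<bar> * 1"
    using abs_sin_x_le_abs_x[of "x / 2"] by (intro mult_mono abs_sin_le_one) auto
  finally show ?thesis by simp
qed

lemma integral_sin_scale_divide:
  assumes "0 \<le> T"
  shows "(\<integral>k. indicator {0<..<T} k * (sin (k * \<theta>) / k) \<partial>lborel) = sgn \<theta> * Si (T * \<bar>\<theta>\<bar>)"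
    and "integrable lborel (\<lambda>k. indicator {0<..<T} k * (sin (k * \<theta>) / k))"
proof -
  show "(\<integral>k. indicator {0<..<T} k * (sin (k * \<theta>) / k) \<partial>lborel) = sgn \<theta> * Si (T * \<bar>\<theta>\<bar>)"
    using LBINT_I0c_sin_scale_divide[OF assms, of \<theta>] assms
    unfolding interval_lebesgue_integral_def einterval_eq zero_ereal_def set_lebesgue_integral_def by simp
  have "integrable lborel (indicator {0..T} :: real \<Rightarrow> real)"
    by (rule integrable_real_indicator) (auto simp: emeasure_lborel_Icc_eq)
  then have "integrable lborel (\<lambda>k. indicator {0..T} k *\<^sub>R \<bar>\<theta>\<bar>)" by simp
  then show "integrable lborel (\<lambda>k. indicator {0<..<T} k * (sin (k * \<theta>) / k))"
  proof (rule Bochner_Integration.integrable_bound)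
    have "\<bar>sin (k * \<theta>) / k\<bar> \<le> \<bar>\<theta>\<bar>" if "0 < k" for k
      using abs_sin_x_le_abs_x[of "k * \<theta>"] that by (simp add: abs_mult field_simps)
    then show "AE k in lborel. norm (indicator {0<..<T} k * (sin (k * \<theta>) / k)) \<le> norm (indicator {0..T} k *\<^sub>R \<bar>\<theta>\<bar>)"
      by (intro AE_I2) (auto split: split_indicator)
  qed measurable
qed

text \<open>The product formula for sine and cosine leaves sin (k \<theta>)/k at the three
  frequencies z, z + t and z - t, the last of which may be negative.\<close>

lemma integral_one_minus_cos_sin:
  assumes "0 \<le> T" "0 < z" "0 < t"
  shows "(\<integral>k. indicator {0<..<T} k * ((1 - cos (k * t)) / k * sin (k * z)) \<partial>lborel) =
    Si (T * z) - Si (T * (z + t)) / 2 - sgn (z - t) * Si (T * \<bar>z - t\<bar>) / 2"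
proof -
  let ?g = "\<lambda>\<theta> k. indicator {0<..<T} k * (sin (k * \<theta>) / k)"
  have "indicator {0<..<T} k * ((1 - cos (k * t)) / k * sin (k * z)) = ?g z k - ?g (z + t) k / 2 - ?g (z - t) k / 2" for k
    by (auto split: split_indicator simp: algebra_simps sin_add sin_diff add_divide_distrib diff_divide_distrib)
  then have "(\<integral>k. indicator {0<..<T} k * ((1 - cos (k * t)) / k * sin (k * z)) \<partial>lborel) =
     (\<integral>k. ?g z k \<partial>lborel) - (\<integral>k. ?g (z + t) k \<partial>lborel) / 2 - (\<integral>k. ?g (z - t) k \<partial>lborel) / 2"
    using integral_sin_scale_divide(2)[OF assms(1)]
    by (simp only: Bochner_Integration.integral_diff Bochner_Integration.integrable_diff integrable_divide integral_divide_zero)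
  then show ?thesis unfolding integral_sin_scale_divide(1)[OF assms(1)] using assms by simp
qed

text \<open>Insert k/(k^2 + m^2) as the integral of sin (k z) exp (-m z) over z > 0 and integrate
  over k < n first. The inner integral is a combination of sine integrals that tends to pi/2 for z <
  t and to 0 for z > t, so in the limit exp (-m z) is integrated over z < t.\<close>

lemma nn_integral_one_minus_cos_pos:
  assumes m: "0 < m" and t: "0 < t"
  shows "(\<integral>\<^sup>+k. ennreal ((1 - cos (k * t)) / (k\<^sup>2 + m\<^sup>2)) \<partial>halfline) =
     ennreal (pi / 2) * (\<integral>\<^sup>+z. ennreal (exp (- (m * z))) * indicator {..<t} z \<partial>halfline)"
proof -
  define J where "J = (\<lambda>(n::nat) z. Si (real n * z) - Si (real n * (z + t)) / 2 - sgn (z - t) * Si (real n * \<bar>z - t\<bar>) / 2)"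
  have J_meas [measurable]: "J n \<in> borel_measurable borel" for n
    unfolding J_def sgn_real_def by measurable
  obtain B where B: "\<And>T. \<bar>Si T\<bar> \<le> B" using bounded_Si by auto
  have J_bound: "\<bar>J n z\<bar> \<le> 2 * B" for n z
  proof -
    have "\<bar>sgn (z - t) * Si (real n * \<bar>z - t\<bar>)\<bar> \<le> 1 * B"
      unfolding abs_mult by (intro mult_mono B) (auto simp: sgn_real_def)
    then show ?thesis
      using B[of "real n * z"] B[of "real n * (z + t)"] unfolding J_def by (auto simp: abs_le_iff)
  qed
  \<comment> \<open>For z < t the limit is pi/2 - pi/4 + pi/4, for z > t it is pi/2 - pi/4 -
    pi/4.\<close>
  have J_lim: "(\<lambda>n. J n z) \<longlonglongrightarrow> pi / 2 * indicator {..<t} z" if z: "0 < z" "z \<noteq> t" for z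
  proof -
    have S: "(\<lambda>n::nat. Si (real n * c)) \<longlonglongrightarrow> pi / 2" if "0 < c" for c
      using that by (intro filterlim_compose[OF Si_at_top]) real_asymp
    have "(\<lambda>n. J n z) \<longlonglongrightarrow> pi / 2 - pi / 2 / 2 - sgn (z - t) * (pi / 2) / 2"
      unfolding J_def using z t by (intro tendsto_intros S) auto
    also have "pi / 2 - pi / 2 / 2 - sgn (z - t) * (pi / 2) / 2 = pi / 2 * indicator {..<t} z"
      using z by (auto simp: sgn_real_def split: split_indicator)
    finally show ?thesis .
  qed
  have fub: "(\<integral>k. indicator {0<..<real n} k * ((1 - cos (k * t)) / (k\<^sup>2 + m\<^sup>2)) \<partial>lborel) =
      (\<integral>z. exp (- (m * z)) * J n z \<partial>halfline)" for n
  proof -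
    interpret pair_sigma_finite lborel halfline
      by (simp add: pair_sigma_finite_def sigma_finite_halfline lborel.sigma_finite_measure_axioms)
    let ?h = "\<lambda>k z. indicator {0<..<real n} k * ((1 - cos (k * t)) / k * sin (k * z)) * exp (- (m * z))"
    \<comment> \<open>The factor 1/k is harmless because (1 - cos (k t))/k \<le> t. The truncation k
      < n gives integrability in k, the factor exp (-m z) gives it in z.\<close>
    have int: "integrable (lborel \<Otimes>\<^sub>M halfline) (\<lambda>(k, z). ?h k z)"
    proof (rule Bochner_Integration.integrable_bound)
      show "integrable (lborel \<Otimes>\<^sub>M halfline) (\<lambda>(k, z). (indicator {0<..<real n} k * t) * exp (- (m * z)))"
      proof (rule Fubini_integrable)
        show "integrable lborel (\<lambda>x. \<integral>y. norm (case (x, y) of (k, z) \<Rightarrow> indicator {0<..<real n} k * t * exp (- (m * z))) \<partial>halfline)"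
          using m t by (simp add: abs_mult integral_exp_halfline integrable_real_indicator)
        show "AE x in lborel. integrable halfline (\<lambda>y. case (x, y) of (k, z) \<Rightarrow> indicator {0<..<real n} k * t * exp (- (m * z)))"
          using m integrable_exp_halfline[OF m] by (intro AE_I2) simp
      qed (rule measurable_borel_halfline(1)[OF sets_lborel], measurable)
      have "\<bar>?h k z\<bar> \<le> indicator {0<..<real n} k * t * exp (- (m * z))" for k z
      proof (cases "k \<in> {0<..<real n}")
        case True
        have "(1 - cos (k * t)) / k \<le> t" using one_minus_cos_le[of "k * t"] True t by (simp add: field_simps abs_mult)
        then have "\<bar>(1 - cos (k * t)) / k * sin (k * z)\<bar> \<le> t * 1"
          unfolding abs_mult using True t by (intro mult_mono) auto
        then have "\<bar>(1 - cos (k * t)) / k * sin (k * z)\<bar> * exp (- (m * z)) \<le> t * exp (- (m * z))"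
          by (intro mult_right_mono) auto
        then show ?thesis using True by (simp add: abs_mult)
      qed auto
      then show "AE x in lborel \<Otimes>\<^sub>M halfline. norm (case x of (k, z) \<Rightarrow> ?h k z)
         \<le> norm (case x of (k, z) \<Rightarrow> (indicator {0<..<real n} k * t) * exp (- (m * z)))"
        by (intro AE_I2) (auto simp: order.trans[OF _ abs_ge_self])
    qed (rule measurable_borel_halfline(1)[OF sets_lborel], measurable)
    have "(\<integral>k. indicator {0<..<real n} k * ((1 - cos (k * t)) / (k\<^sup>2 + m\<^sup>2)) \<partial>lborel) = (\<integral>k. (\<integral>z. ?h k z \<partial>halfline) \<partial>lborel)"
    proof (intro Bochner_Integration.integral_cong refl)
      fix k
      have "(\<integral>z. ?h k z \<partial>halfline) = indicator {0<..<real n} k * ((1 - cos (k * t)) / k) * (\<integral>z. sin (z * k) * exp (- (m * z)) \<partial>halfline)"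
        by (subst integral_mult_right_zero[symmetric]) (simp add: mult_ac)
      also have "\<dots> = indicator {0<..<real n} k * ((1 - cos (k * t)) / (k\<^sup>2 + m\<^sup>2))"
        using m by (simp add: integral_sin_exp_halfline split: split_indicator)
      finally show "indicator {0<..<real n} k * ((1 - cos (k * t)) / (k\<^sup>2 + m\<^sup>2)) = (\<integral>z. ?h k z \<partial>halfline)" ..
    qed
    also have "\<dots> = (\<integral>z. (\<integral>k. ?h k z \<partial>lborel) \<partial>halfline)"
      using Fubini_integral[OF int] by simp
    also have "\<dots> = (\<integral>z. exp (- (m * z)) * J n z \<partial>halfline)"
    proof (intro Bochner_Integration.integral_cong refl)
      fix z assume "z \<in> space halfline"
      then have "0 < z" by simp
      then show "(\<integral>k. ?h k z \<partial>lborel) = exp (- (m * z)) * J n z"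
        unfolding integral_mult_left_zero using integral_one_minus_cos_sin[of "real n" z t] t
        by (simp only: J_def mult.commute)
    qed
    finally show ?thesis .
  qed
  have nonneg: "0 \<le> (1 - cos (k * t)) / (k\<^sup>2 + m\<^sup>2)" for k by (simp add: add_nonneg_nonneg)
  have "(\<lambda>n. ennreal (\<integral>z. exp (- (m * z)) * J n z \<partial>halfline)) \<longlonglongrightarrow>
      ennreal (\<integral>z. exp (- (m * z)) * (pi / 2 * indicator {..<t} z) \<partial>halfline)"
  proof (intro tendsto_ennrealI integral_dominated_convergence)
    show "integrable halfline (\<lambda>z. exp (- (m * z)) * (2 * B))" using integrable_exp_halfline[OF m] by simp
    show "AE z in halfline. (\<lambda>n. exp (- (m * z)) * J n z) \<longlonglongrightarrow> exp (- (m * z)) * (pi / 2 * indicator {..<t} z)"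
      using AE_halfline_pos AE_halfline_neq[of t] by eventually_elim (intro tendsto_intros J_lim)
    show "AE z in halfline. norm (exp (- (m * z)) * J n z) \<le> exp (- (m * z)) * (2 * B)" for n
      using J_bound by (intro AE_I2) (simp add: abs_mult)
  qed measurable
  \<comment> \<open>The integrand is nonnegative, so the truncated integrals increase to the full
    one by monotone convergence.\<close>
  moreover have "(\<lambda>n::nat. \<integral>\<^sup>+k. ennreal (indicator {0<..<real n} k * ((1 - cos (k * t)) / (k\<^sup>2 + m\<^sup>2))) \<partial>lborel) \<longlonglongrightarrow>
     (\<integral>\<^sup>+k. ennreal ((1 - cos (k * t)) / (k\<^sup>2 + m\<^sup>2)) \<partial>halfline)"
    unfolding nn_integral_halfline
  proof (rule nn_integral_LIMSEQ)
    show "incseq (\<lambda>(n::nat) k. ennreal (indicator {0<..<real n} k * ((1 - cos (k * t)) / (k\<^sup>2 + m\<^sup>2))))"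
      using nonneg by (auto simp: incseq_def le_fun_def split: split_indicator)
    fix k
    have "\<forall>\<^sub>F n::nat in sequentially. k < real n"
      using filterlim_real_sequentially unfolding filterlim_at_top_dense by blast
    then have "\<forall>\<^sub>F n::nat in sequentially. ennreal (indicator {0<..<real n} k * ((1 - cos (k * t)) / (k\<^sup>2 + m\<^sup>2))) =
       ennreal ((1 - cos (k * t)) / (k\<^sup>2 + m\<^sup>2)) * indicator {0<..} k"
      by eventually_elim (auto split: split_indicator)
    then show "(\<lambda>n::nat. ennreal (indicator {0<..<real n} k * ((1 - cos (k * t)) / (k\<^sup>2 + m\<^sup>2)))) \<longlonglongrightarrow>
       ennreal ((1 - cos (k * t)) / (k\<^sup>2 + m\<^sup>2)) * indicator {0<..} k"
      by (rule tendsto_eventually)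
  qed measurable
  moreover have "(\<integral>\<^sup>+k. ennreal (indicator {0<..<real n} k * ((1 - cos (k * t)) / (k\<^sup>2 + m\<^sup>2))) \<partial>lborel) =
      ennreal (\<integral>z. exp (- (m * z)) * J n z \<partial>halfline)" for n :: nat
    unfolding fub[symmetric]
  proof (rule nn_integral_eq_integral)
    have "integrable lborel (\<lambda>k. indicator {0..real n} k *\<^sub>R (2 / m\<^sup>2))" by (simp add: integrable_real_indicator)
    then show "integrable lborel (\<lambda>k. indicator {0<..<real n} k * ((1 - cos (k * t)) / (k\<^sup>2 + m\<^sup>2)))"
    proof (rule Bochner_Integration.integrable_bound)
      have "\<bar>(1 - cos (k * t)) / (k\<^sup>2 + m\<^sup>2)\<bar> \<le> 2 / m\<^sup>2" for k
        using m cos_ge_minus_one[of "k * t"] by (simp, intro frac_le) auto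
      then show "AE k in lborel. norm (indicator {0<..<real n} k * ((1 - cos (k * t)) / (k\<^sup>2 + m\<^sup>2))) \<le> norm (indicator {0..real n} k *\<^sub>R (2 / m\<^sup>2))"
        by (intro AE_I2) (auto split: split_indicator)
    qed measurable
    show "AE k in lborel. 0 \<le> indicator {0<..<real n} k * ((1 - cos (k * t)) / (k\<^sup>2 + m\<^sup>2))"
      using nonneg by (intro AE_I2) (auto split: split_indicator)
  qed
  ultimately have "(\<integral>\<^sup>+k. ennreal ((1 - cos (k * t)) / (k\<^sup>2 + m\<^sup>2)) \<partial>halfline) =
     ennreal (\<integral>z. exp (- (m * z)) * (pi / 2 * indicator {..<t} z) \<partial>halfline)"
    by (simp add: LIMSEQ_unique)
  also have "\<dots> = (\<integral>\<^sup>+z. ennreal (exp (- (m * z)) * (pi / 2 * indicator {..<t} z)) \<partial>halfline)"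
  proof (rule nn_integral_eq_integral[symmetric])
    show "integrable halfline (\<lambda>z. exp (- (m * z)) * (pi / 2 * indicator {..<t} z))"
      by (rule Bochner_Integration.integrable_bound[OF integrable_mult_right[OF integrable_exp_halfline[OF m], of "pi / 2"]])
        (auto split: split_indicator)
  qed auto
  also have "\<dots> = (\<integral>\<^sup>+z. ennreal (pi / 2) * (ennreal (exp (- (m * z))) * indicator {..<t} z) \<partial>halfline)"
    by (intro nn_integral_cong) (auto split: split_indicator simp: mult.commute simp flip: ennreal_mult)
  also have "\<dots> = ennreal (pi / 2) * (\<integral>\<^sup>+z. ennreal (exp (- (m * z))) * indicator {..<t} z \<partial>halfline)"
    by (intro nn_integral_cmult) measurable
  finally show ?thesis .
qed

text \<open>The value m = 0 covers a possible atom of the spectral measure at 0 and also gives the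
  integrability of (1 - cos (k t))/k^2. It is reached through m = 1/(n + 1), with monotone
  convergence on both sides.\<close>

lemma nn_integral_one_minus_cos:
  assumes m: "0 \<le> m" and t: "0 < t"
  shows "(\<integral>\<^sup>+k. ennreal ((1 - cos (k * t)) / (k\<^sup>2 + m\<^sup>2)) \<partial>halfline) =
     ennreal (pi / 2) * (\<integral>\<^sup>+z. ennreal (exp (- (m * z))) * indicator {..<t} z \<partial>halfline)"
proof (cases "m = 0")
  case False
  then show ?thesis using nn_integral_one_minus_cos_pos[of m t] m t by simp
next
  case True
  let ?m = "\<lambda>n. 1 / real (Suc n)"
  have m_dec: "?m n \<le> ?m k" if "k \<le> n" for k n using that by (simp add: frac_le)
  have m_lim: "?m \<longlonglongrightarrow> 0" by real_asymp
  have "(\<lambda>n. \<integral>\<^sup>+k. ennreal ((1 - cos (k * t)) / (k\<^sup>2 + (?m n)\<^sup>2)) \<partial>halfline) \<longlonglongrightarrow>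
      (\<integral>\<^sup>+k. ennreal ((1 - cos (k * t)) / (k\<^sup>2 + 0\<^sup>2)) \<partial>halfline)"
  proof (rule nn_integral_LIMSEQ)
    show "incseq (\<lambda>n k. ennreal ((1 - cos (k * t)) / (k\<^sup>2 + (?m n)\<^sup>2)))"
    proof (intro incseq_SucI le_funI ennreal_leI divide_left_mono add_left_mono power_mono m_dec mult_pos_pos)
      show "0 < k\<^sup>2 + (?m n)\<^sup>2" for k n by (simp add: add_nonneg_pos)
      then show "0 < k\<^sup>2 + (?m n)\<^sup>2" for k n .
    qed auto
    fix k
    show "(\<lambda>n. ennreal ((1 - cos (k * t)) / (k\<^sup>2 + (?m n)\<^sup>2))) \<longlonglongrightarrow> ennreal ((1 - cos (k * t)) / (k\<^sup>2 + 0\<^sup>2))"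
    proof (cases "k = 0")
      case False
      then show ?thesis by (intro tendsto_ennrealI tendsto_intros m_lim) auto
    qed simp
  qed measurable
  moreover have "(\<lambda>n. \<integral>\<^sup>+k. ennreal ((1 - cos (k * t)) / (k\<^sup>2 + (?m n)\<^sup>2)) \<partial>halfline) \<longlonglongrightarrow>
      ennreal (pi / 2) * (\<integral>\<^sup>+z. ennreal (exp (- (0 * z))) * indicator {..<t} z \<partial>halfline)"
  proof -
    \<comment> \<open>The indicator is cut down to positive z because exp (-z/(n + 1)) increases
      with n only for z \<ge> 0.\<close>
    have "(\<lambda>n. \<integral>\<^sup>+z. ennreal (exp (- (?m n * z))) * indicator {0<..<t} z \<partial>halfline) \<longlonglongrightarrow>
      (\<integral>\<^sup>+z. ennreal (exp (- (0 * z))) * indicator {0<..<t} z \<partial>halfline)"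
    proof (rule nn_integral_LIMSEQ)
      show "incseq (\<lambda>n z. ennreal (exp (- (?m n * z))) * indicator {0<..<t} z)"
        by (auto simp: incseq_def le_fun_def split: split_indicator intro!: ennreal_leI divide_left_mono)
      fix z
      have "(\<lambda>n. ennreal (exp (- (?m n * z)))) \<longlonglongrightarrow> ennreal (exp (- (0 * z)))"
        by (intro tendsto_ennrealI tendsto_intros m_lim)
      then show "(\<lambda>n. ennreal (exp (- (?m n * z))) * indicator {0<..<t} z) \<longlonglongrightarrow> ennreal (exp (- (0 * z))) * indicator {0<..<t} z"
        by (cases "z \<in> {0<..<t}") auto
    qed measurable
    moreover have "(\<integral>\<^sup>+z. f z * indicator {0<..<t} z \<partial>halfline) = (\<integral>\<^sup>+z. f z * indicator {..<t} z \<partial>halfline)" for f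
      by (intro nn_integral_cong) (auto split: split_indicator)
    ultimately have "(\<lambda>n. \<integral>\<^sup>+z. ennreal (exp (- (?m n * z))) * indicator {..<t} z \<partial>halfline) \<longlonglongrightarrow>
      (\<integral>\<^sup>+z. ennreal (exp (- (0 * z))) * indicator {..<t} z \<partial>halfline)"
      by (simp only:)
    from ennreal_tendsto_cmult[OF _ this, of "ennreal (pi / 2)"] show ?thesis
      using t by (subst nn_integral_one_minus_cos_pos) auto
  qed
  ultimately show ?thesis unfolding True by (rule LIMSEQ_unique)
qed

section \<open>Integral operators dominated by a convolution\<close>

definition kop :: "(real \<Rightarrow> real \<Rightarrow> real) \<Rightarrow> (real \<Rightarrow> complex) \<Rightarrow> real \<Rightarrow> complex" where
  "kop K f x = (\<integral>y. of_real (K x y) * f y \<partial>halfline)"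

text \<open>Hypotheses of the Schur test for a kernel dominated by a convolution. The number c
  bounds the integral of q(|d|) over the whole line, hence all row and column integrals of K; Q
  bounds q itself and serves pointwise convergence.\<close>

locale dominated_kernel =
  fixes K :: "real \<Rightarrow> real \<Rightarrow> real" and q :: "real \<Rightarrow> real" and c Q :: real
  assumes K_borel: "case_prod K \<in> borel_measurable (borel \<Otimes>\<^sub>M borel)"
    and q_borel [measurable]: "q \<in> borel_measurable borel"
    and q_le: "\<And>d. 0 \<le> d \<Longrightarrow> q d \<le> Q"
    and K_le: "\<And>x y. 0 < x \<Longrightarrow> 0 < y \<Longrightarrow> \<bar>K x y\<bar> \<le> q \<bar>x - y\<bar>"
    and c_nonneg: "0 \<le> c"
    and q_int: "2 * (\<integral>\<^sup>+d. ennreal (q d) \<partial>halfline) \<le> ennreal c"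
begin

lemma K_meas: "case_prod K \<in> borel_measurable (halfline \<Otimes>\<^sub>M halfline)"
  by (rule measurable_borel_halfline(3)[OF refl K_borel])

lemma K_meas_right: "K x \<in> borel_measurable borel"
  using measurable_compose[OF measurable_Pair1'[of x borel] K_borel] by simp

lemma q_int_le: "(\<integral>\<^sup>+y. ennreal (q \<bar>x - y\<bar>) \<partial>halfline) \<le> ennreal c"
  using nn_integral_halfline_abs_le[of "\<lambda>d. ennreal (q d)" x] q_int by simp

lemma q_int_le': "(\<integral>\<^sup>+y. ennreal (q \<bar>y - x\<bar>) \<partial>halfline) \<le> ennreal c"
  using q_int_le[of x] by (simp add: abs_minus_commute)

lemma q_nonneg: "0 < x \<Longrightarrow> 0 < y \<Longrightarrow> 0 \<le> q \<bar>x - y\<bar>"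
  using K_le[of x y] by linarith

text \<open>\<open>has_integral_kernel\<close> demands convergence at every x > 0, not just almost
  everywhere. The inequality |f| \<le> 1 + |f|^2 bounds the integrand by q plus Q |f|^2, and both
  are integrable.\<close>

lemma kop_integrable:
  assumes f: "f \<in> hL2" and x: "0 < x"
  shows "integrable halfline (\<lambda>y. of_real (K x y) * f y)"
proof (rule Bochner_Integration.integrable_bound)
  have "(\<integral>\<^sup>+y. ennreal (norm (q \<bar>x - y\<bar>)) \<partial>halfline) = (\<integral>\<^sup>+y. ennreal (q \<bar>x - y\<bar>) \<partial>halfline)"
    using q_nonneg[OF x] by (intro nn_integral_cong) auto
  also have "\<dots> < \<infinity>" using q_int_le[of x] by (auto simp: le_less_trans)
  finally have "integrable halfline (\<lambda>y. q \<bar>x - y\<bar>)"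
    by (intro integrableI_bounded) auto
  then show "integrable halfline (\<lambda>y. q \<bar>x - y\<bar> + Q * (cmod (f y))\<^sup>2)"
    using hL2_integrable[OF f] by auto
  have [measurable]: "f \<in> borel_measurable halfline" "K x \<in> borel_measurable borel"
    using f K_meas_right by (auto dest: hL2_measurable)
  show "(\<lambda>y. of_real (K x y) * f y) \<in> borel_measurable halfline" by measurable
  show "AE y in halfline. norm (of_real (K x y) * f y) \<le> norm (q \<bar>x - y\<bar> + Q * (cmod (f y))\<^sup>2)"
    using AE_halfline_pos
  proof eventually_elim
    case (elim y)
    have a: "a \<le> 1 + a\<^sup>2" for a :: real using zero_le_power2[of "a - 1/2"] by (simp add: power2_eq_square algebra_simps)
    have "norm (of_real (K x y) * f y) \<le> q \<bar>x - y\<bar> * cmod (f y)"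
      using K_le[OF x elim] by (simp add: norm_mult mult_right_mono)
    also have "\<dots> \<le> q \<bar>x - y\<bar> * (1 + (cmod (f y))\<^sup>2)"
      using q_nonneg[OF x elim] a by (intro mult_left_mono) auto
    also have "\<dots> \<le> q \<bar>x - y\<bar> + Q * (cmod (f y))\<^sup>2"
      using q_le[of "\<bar>x - y\<bar>"] by (simp add: distrib_left mult_right_mono)
    finally show ?case unfolding real_norm_def by (rule order.trans[OF _ abs_ge_self])
  qed
qed

lemma kop_measurable:
  assumes f: "f \<in> hL2"
  shows "kop K f \<in> borel_measurable halfline"
proof -
  have [measurable]: "f \<in> borel_measurable halfline" "case_prod K \<in> borel_measurable (halfline \<Otimes>\<^sub>M halfline)"
    using f K_meas by (auto dest: hL2_measurable)
  have "(\<lambda>(x, y). of_real (K x y) * f y) = (\<lambda>p. complex_of_real (case_prod K p) * f (snd p))"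
    by (simp add: fun_eq_iff)
  then have "(\<lambda>(x, y). complex_of_real (K x y) * f y) \<in> borel_measurable (halfline \<Otimes>\<^sub>M halfline)"
    by simp
  then show ?thesis
    unfolding kop_def[abs_def] by (rule halfline.borel_measurable_lebesgue_integral)
qed

text \<open>Schur test: write q as the product of its square roots, apply the Cauchy-Schwarz
  inequality in y, and bound the remaining row and column integrals by c each.\<close>

lemma nn_integral_kop_le:
  assumes f: "f \<in> hL2"
  shows "(\<integral>\<^sup>+x. ennreal ((cmod (kop K f x))\<^sup>2) \<partial>halfline) \<le> ennreal (c\<^sup>2) * (\<integral>\<^sup>+x. ennreal ((cmod (f x))\<^sup>2) \<partial>halfline)"
proof -
  have [measurable]: "f \<in> borel_measurable halfline"
    using f by (auto dest: hL2_measurable)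
  have qm: "(\<lambda>p. ennreal (q \<bar>fst p - snd p\<bar>)) \<in> borel_measurable (halfline \<Otimes>\<^sub>M halfline)"
    by (rule measurable_borel_halfline(3)[OF refl]) measurable
  have "(\<integral>\<^sup>+x. ennreal ((cmod (kop K f x))\<^sup>2) \<partial>halfline)
     \<le> (\<integral>\<^sup>+x. ennreal c * (\<integral>\<^sup>+y. ennreal (q \<bar>x - y\<bar>) * ennreal ((cmod (f y))\<^sup>2) \<partial>halfline) \<partial>halfline)"
  proof (intro nn_integral_mono)
    fix x assume "x \<in> space halfline"
    then have x: "0 < x" by simp
    have "ennreal (cmod (kop K f x)) \<le> (\<integral>\<^sup>+y. ennreal (cmod (of_real (K x y) * f y)) \<partial>halfline)"
      unfolding kop_def by (rule integral_norm_bound_ennreal[OF kop_integrable[OF f x]])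
    also have "\<dots> \<le> (\<integral>\<^sup>+y. ennreal (sqrt (q \<bar>x - y\<bar>)) * ennreal (sqrt (q \<bar>x - y\<bar>) * cmod (f y)) \<partial>halfline)"
    proof (intro nn_integral_mono)
      fix y assume "y \<in> space halfline"
      then have y: "0 < y" by simp
      have "cmod (of_real (K x y) * f y) \<le> sqrt (q \<bar>x - y\<bar>) * (sqrt (q \<bar>x - y\<bar>) * cmod (f y))"
        using K_le[OF x y] q_nonneg[OF x y] by (simp add: norm_mult mult_right_mono flip: mult.assoc)
      then show "ennreal (cmod (of_real (K x y) * f y)) \<le> ennreal (sqrt (q \<bar>x - y\<bar>)) * ennreal (sqrt (q \<bar>x - y\<bar>) * cmod (f y))"
        using q_nonneg[OF x y] by (simp add: ennreal_leI flip: ennreal_mult)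
    qed
    finally have "(ennreal (cmod (kop K f x)))\<^sup>2 \<le> \<dots>\<^sup>2" by (intro power_mono) auto
    also have "\<dots> \<le> (\<integral>\<^sup>+y. (ennreal (sqrt (q \<bar>x - y\<bar>)))\<^sup>2 \<partial>halfline) *
        (\<integral>\<^sup>+y. (ennreal (sqrt (q \<bar>x - y\<bar>) * cmod (f y)))\<^sup>2 \<partial>halfline)"
      by (intro Cauchy_Schwarz_nn_integral) measurable
    also have "(\<integral>\<^sup>+y. (ennreal (sqrt (q \<bar>x - y\<bar>)))\<^sup>2 \<partial>halfline) = (\<integral>\<^sup>+y. ennreal (q \<bar>x - y\<bar>) \<partial>halfline)"
      using q_nonneg[OF x] by (intro nn_integral_cong) (simp add: ennreal_power)
    also have "(\<integral>\<^sup>+y. (ennreal (sqrt (q \<bar>x - y\<bar>) * cmod (f y)))\<^sup>2 \<partial>halfline) =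
       (\<integral>\<^sup>+y. ennreal (q \<bar>x - y\<bar>) * ennreal ((cmod (f y))\<^sup>2) \<partial>halfline)"
      using q_nonneg[OF x] by (intro nn_integral_cong) (simp add: ennreal_power power_mult_distrib flip: ennreal_mult)
    also have "(\<integral>\<^sup>+y. ennreal (q \<bar>x - y\<bar>) \<partial>halfline) * \<dots> \<le> ennreal c * \<dots>"
      by (intro mult_right_mono q_int_le) auto
    finally show "ennreal ((cmod (kop K f x))\<^sup>2) \<le> \<dots>"
      by (simp add: ennreal_power)
  qed
  also have "\<dots> = ennreal c * (\<integral>\<^sup>+x. (\<integral>\<^sup>+y. ennreal (q \<bar>x - y\<bar>) * ennreal ((cmod (f y))\<^sup>2) \<partial>halfline) \<partial>halfline)"
    using qm by (intro nn_integral_cmult halfline.borel_measurable_nn_integral) (simp add: case_prod_unfold)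
  also have "(\<integral>\<^sup>+x. (\<integral>\<^sup>+y. ennreal (q \<bar>x - y\<bar>) * ennreal ((cmod (f y))\<^sup>2) \<partial>halfline) \<partial>halfline)
    = (\<integral>\<^sup>+y. (\<integral>\<^sup>+x. ennreal (q \<bar>x - y\<bar>) * ennreal ((cmod (f y))\<^sup>2) \<partial>halfline) \<partial>halfline)"
    using qm by (intro halfline_pair.Fubini'[symmetric]) (simp add: case_prod_unfold)
  also have "\<dots> = (\<integral>\<^sup>+y. (\<integral>\<^sup>+x. ennreal (q \<bar>x - y\<bar>) \<partial>halfline) * ennreal ((cmod (f y))\<^sup>2) \<partial>halfline)"
    by (intro nn_integral_cong nn_integral_multc) measurable
  also have "\<dots> \<le> (\<integral>\<^sup>+y. ennreal c * ennreal ((cmod (f y))\<^sup>2) \<partial>halfline)"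
    by (intro nn_integral_mono mult_right_mono q_int_le') auto
  also have "\<dots> = ennreal c * (\<integral>\<^sup>+y. ennreal ((cmod (f y))\<^sup>2) \<partial>halfline)"
    by (intro nn_integral_cmult) measurable
  also have "ennreal c * \<dots> = ennreal (c\<^sup>2) * (\<integral>\<^sup>+x. ennreal ((cmod (f x))\<^sup>2) \<partial>halfline)"
    using c_nonneg by (simp add: power2_eq_square ennreal_mult mult.assoc)
  finally show ?thesis by (simp add: mult_left_mono)
qed

lemma
  assumes f: "f \<in> hL2"
  shows kop_hL2: "kop K f \<in> hL2"
    and kop_norm: "(\<integral>x. (cmod (kop K f x))\<^sup>2 \<partial>halfline) \<le> c\<^sup>2 * (\<integral>x. (cmod (f x))\<^sup>2 \<partial>halfline)"
proof -
  have [measurable]: "kop K f \<in> borel_measurable halfline" by (rule kop_measurable[OF f])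
  have "(\<integral>\<^sup>+x. ennreal ((cmod (f x))\<^sup>2) \<partial>halfline) = ennreal (\<integral>x. (cmod (f x))\<^sup>2 \<partial>halfline)"
    using hL2_integrable[OF f] by (intro nn_integral_eq_integral) auto
  with nn_integral_kop_le[OF f]
  have le: "(\<integral>\<^sup>+x. ennreal ((cmod (kop K f x))\<^sup>2) \<partial>halfline) \<le> ennreal (c\<^sup>2 * (\<integral>x. (cmod (f x))\<^sup>2 \<partial>halfline))"
    by (simp add: ennreal_mult)
  then have "(\<integral>\<^sup>+x. ennreal ((cmod (kop K f x))\<^sup>2) \<partial>halfline) < \<infinity>" by (auto simp: le_less_trans)
  then have int: "integrable halfline (\<lambda>x. (cmod (kop K f x))\<^sup>2)"
    by (intro integrableI_nonneg) auto
  then show "kop K f \<in> hL2" by (simp add: hL2_def)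
  have "(\<integral>\<^sup>+x. ennreal ((cmod (kop K f x))\<^sup>2) \<partial>halfline) = ennreal (\<integral>x. (cmod (kop K f x))\<^sup>2 \<partial>halfline)"
    using int by (intro nn_integral_eq_integral) auto
  with le show "(\<integral>x. (cmod (kop K f x))\<^sup>2 \<partial>halfline) \<le> c\<^sup>2 * (\<integral>x. (cmod (f x))\<^sup>2 \<partial>halfline)"
    by (simp add: ennreal_le_iff)
qed

text \<open>The inequality a b \<le> a^2 + b^2 gives a bound linear in c, so a family of kernels can
  be integrated whenever its constants c are integrable.\<close>

lemma nn_integral_form_le:
  assumes v: "v \<in> hL2" and w: "w \<in> hL2"
  shows "(\<integral>\<^sup>+p. ennreal (cmod (of_real (K (fst p) (snd p)) * (cnj (v (fst p)) * w (snd p)))) \<partial>(halfline \<Otimes>\<^sub>M halfline))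
     \<le> ennreal c * ((\<integral>\<^sup>+x. ennreal ((cmod (v x))\<^sup>2) \<partial>halfline) + (\<integral>\<^sup>+x. ennreal ((cmod (w x))\<^sup>2) \<partial>halfline))"
proof -
  have [measurable]: "v \<in> borel_measurable halfline" "w \<in> borel_measurable halfline"
    using v w by (auto dest: hL2_measurable)
  have qm [measurable]: "(\<lambda>p. ennreal (q \<bar>fst p - snd p\<bar>)) \<in> borel_measurable (halfline \<Otimes>\<^sub>M halfline)"
    by (rule measurable_borel_halfline(3)[OF refl]) measurable
  let ?V = "\<lambda>p. ennreal (q \<bar>fst p - snd p\<bar>) * ennreal ((cmod (v (fst p)))\<^sup>2)"
  let ?W = "\<lambda>p. ennreal (q \<bar>fst p - snd p\<bar>) * ennreal ((cmod (w (snd p)))\<^sup>2)"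
  have "(\<integral>\<^sup>+p. ennreal (cmod (of_real (K (fst p) (snd p)) * (cnj (v (fst p)) * w (snd p)))) \<partial>(halfline \<Otimes>\<^sub>M halfline))
     \<le> (\<integral>\<^sup>+p. ?V p + ?W p \<partial>(halfline \<Otimes>\<^sub>M halfline))"
  proof (intro nn_integral_mono)
    fix p assume "p \<in> space (halfline \<Otimes>\<^sub>M halfline)"
    then have p: "0 < fst p" "0 < snd p" by (auto simp: space_pair_measure)
    have ab: "a * b \<le> a\<^sup>2 + b\<^sup>2" if "0 \<le> a" "0 \<le> b" for a b :: real
      using sum_squares_bound[of a b] mult_nonneg_nonneg[OF that] unfolding mult.assoc by linarith
    have "cmod (of_real (K (fst p) (snd p)) * (cnj (v (fst p)) * w (snd p))) \<le>
       q \<bar>fst p - snd p\<bar> * ((cmod (v (fst p)))\<^sup>2 + (cmod (w (snd p)))\<^sup>2)"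
      using K_le[OF p] q_nonneg[OF p] ab by (simp add: norm_mult mult_mono)
    then have "ennreal (cmod (of_real (K (fst p) (snd p)) * (cnj (v (fst p)) * w (snd p)))) \<le>
       ennreal (q \<bar>fst p - snd p\<bar> * ((cmod (v (fst p)))\<^sup>2 + (cmod (w (snd p)))\<^sup>2))" by (rule ennreal_leI)
    also have "\<dots> = ?V p + ?W p"
      using q_nonneg[OF p] by (simp add: distrib_left ennreal_plus ennreal_mult)
    finally show "ennreal (cmod (of_real (K (fst p) (snd p)) * (cnj (v (fst p)) * w (snd p)))) \<le> ?V p + ?W p" .
  qed
  also have "\<dots> = (\<integral>\<^sup>+p. ?V p \<partial>(halfline \<Otimes>\<^sub>M halfline)) + (\<integral>\<^sup>+p. ?W p \<partial>(halfline \<Otimes>\<^sub>M halfline))"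
    by (intro nn_integral_add) measurable
  also have "(\<integral>\<^sup>+p. ?V p \<partial>(halfline \<Otimes>\<^sub>M halfline)) \<le> ennreal c * (\<integral>\<^sup>+x. ennreal ((cmod (v x))\<^sup>2) \<partial>halfline)"
  proof -
    have "(\<integral>\<^sup>+p. ?V p \<partial>(halfline \<Otimes>\<^sub>M halfline)) = (\<integral>\<^sup>+x. (\<integral>\<^sup>+y. ?V (x, y) \<partial>halfline) \<partial>halfline)"
      by (rule halfline.nn_integral_fst[symmetric]) measurable
    also have "\<dots> = (\<integral>\<^sup>+x. (\<integral>\<^sup>+y. ennreal (q \<bar>x - y\<bar>) \<partial>halfline) * ennreal ((cmod (v x))\<^sup>2) \<partial>halfline)"
      by (intro nn_integral_cong) (simp add: nn_integral_multc)
    also have "\<dots> \<le> (\<integral>\<^sup>+x. ennreal c * ennreal ((cmod (v x))\<^sup>2) \<partial>halfline)"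
      by (intro nn_integral_mono mult_right_mono q_int_le) auto
    finally show ?thesis by (simp add: nn_integral_cmult)
  qed
  also have "(\<integral>\<^sup>+p. ?W p \<partial>(halfline \<Otimes>\<^sub>M halfline)) \<le> ennreal c * (\<integral>\<^sup>+x. ennreal ((cmod (w x))\<^sup>2) \<partial>halfline)"
  proof -
    have "(\<integral>\<^sup>+p. ?W p \<partial>(halfline \<Otimes>\<^sub>M halfline)) = (\<integral>\<^sup>+y. (\<integral>\<^sup>+x. ?W (x, y) \<partial>halfline) \<partial>halfline)"
      by (rule halfline_pair.nn_integral_snd[symmetric]) measurable
    also have "\<dots> = (\<integral>\<^sup>+y. (\<integral>\<^sup>+x. ennreal (q \<bar>x - y\<bar>) \<partial>halfline) * ennreal ((cmod (w y))\<^sup>2) \<partial>halfline)"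
      by (intro nn_integral_cong) (simp add: nn_integral_multc)
    also have "\<dots> \<le> (\<integral>\<^sup>+y. ennreal c * ennreal ((cmod (w y))\<^sup>2) \<partial>halfline)"
      by (intro nn_integral_mono mult_right_mono q_int_le') auto
    finally show ?thesis by (simp add: nn_integral_cmult)
  qed
  finally show ?thesis by (simp add: distrib_left add_mono)
qed

lemma form_measurable:
  assumes "v \<in> hL2" "w \<in> hL2"
  shows "(\<lambda>p. of_real (K (fst p) (snd p)) * (cnj (v (fst p)) * w (snd p))) \<in> borel_measurable (halfline \<Otimes>\<^sub>M halfline)"
proof -
  have [measurable]: "v \<in> borel_measurable halfline" "w \<in> borel_measurable halfline"
    using assms by (auto dest: hL2_measurable)
  have [measurable]: "(\<lambda>p. K (fst p) (snd p)) \<in> borel_measurable (halfline \<Otimes>\<^sub>M halfline)"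
    using K_meas by (simp add: case_prod_unfold)
  show ?thesis by measurable
qed

lemma form_integrable:
  assumes v: "v \<in> hL2" and w: "w \<in> hL2"
  shows "integrable (halfline \<Otimes>\<^sub>M halfline) (\<lambda>p. of_real (K (fst p) (snd p)) * (cnj (v (fst p)) * w (snd p)))"
proof (rule integrableI_bounded[OF form_measurable[OF v w]])
  have "(\<integral>\<^sup>+x. ennreal ((cmod (f x))\<^sup>2) \<partial>halfline) < \<infinity>" if "f \<in> hL2" for f
    using hL2_integrable[OF that] by (simp add: nn_integral_eq_integral)
  from this[OF v] this[OF w]
  have "ennreal c * ((\<integral>\<^sup>+x. ennreal ((cmod (v x))\<^sup>2) \<partial>halfline) + (\<integral>\<^sup>+x. ennreal ((cmod (w x))\<^sup>2) \<partial>halfline)) < \<infinity>"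
    by (simp add: ennreal_mult_less_top)
  then show "(\<integral>\<^sup>+p. ennreal (norm (of_real (K (fst p) (snd p)) * (cnj (v (fst p)) * w (snd p)))) \<partial>(halfline \<Otimes>\<^sub>M halfline)) < \<infinity>"
    by (rule le_less_trans[OF nn_integral_form_le[OF v w]])
qed

text \<open>Both identities are Fubini's theorem for one absolutely integrable function on the
  quadrant. The second moves the kernel onto v, with x as the inner variable, as needed for weak
  derivatives.\<close>

lemma
  assumes v: "v \<in> hL2" and w: "w \<in> hL2"
  shows form_eq: "(\<integral>x. cnj (v x) * kop K w x \<partial>halfline) =
      (\<integral>p. of_real (K (fst p) (snd p)) * (cnj (v (fst p)) * w (snd p)) \<partial>(halfline \<Otimes>\<^sub>M halfline))"
    and form_eq_swap: "(\<integral>x. cnj (v x) * kop K w x \<partial>halfline) =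
      (\<integral>y. (\<integral>x. of_real (K x y) * cnj (v x) \<partial>halfline) * w y \<partial>halfline)"
proof -
  note int = form_integrable[OF v w]
  have "(\<integral>p. of_real (K (fst p) (snd p)) * (cnj (v (fst p)) * w (snd p)) \<partial>(halfline \<Otimes>\<^sub>M halfline)) =
     (\<integral>x. (\<integral>y. of_real (K x y) * (cnj (v x) * w y) \<partial>halfline) \<partial>halfline)"
    using halfline_pair.integral_fst'[OF int] by simp
  also have "\<dots> = (\<integral>x. cnj (v x) * kop K w x \<partial>halfline)"
    unfolding kop_def by (intro Bochner_Integration.integral_cong refl, subst integral_mult_right_zero[symmetric]) (simp add: mult_ac)
  finally show 1: "(\<integral>x. cnj (v x) * kop K w x \<partial>halfline) =
      (\<integral>p. of_real (K (fst p) (snd p)) * (cnj (v (fst p)) * w (snd p)) \<partial>(halfline \<Otimes>\<^sub>M halfline))" ..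
  have "(\<integral>p. of_real (K (fst p) (snd p)) * (cnj (v (fst p)) * w (snd p)) \<partial>(halfline \<Otimes>\<^sub>M halfline)) =
     (\<integral>y. (\<integral>x. of_real (K x y) * (cnj (v x) * w y) \<partial>halfline) \<partial>halfline)"
    using halfline_pair.integral_snd[of "\<lambda>x y. of_real (K x y) * (cnj (v x) * w y)"] int by (simp add: case_prod_unfold)
  also have "\<dots> = (\<integral>y. (\<integral>x. of_real (K x y) * cnj (v x) \<partial>halfline) * w y \<partial>halfline)"
    by (intro Bochner_Integration.integral_cong refl, subst integral_mult_left_zero[symmetric]) (simp add: mult_ac)
  finally show "(\<integral>x. cnj (v x) * kop K w x \<partial>halfline) =
      (\<integral>y. (\<integral>x. of_real (K x y) * cnj (v x) \<partial>halfline) * w y \<partial>halfline)" using 1 by simp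
qed

end

text \<open>The parameter joins x and y in a single Fubini argument, with c(\<theta>) times the
  squared norms as integrable bound. It is applied both to resolvents, with \<theta> = k, and to
  cylinder kernels, with \<theta> the time.\<close>

lemma dominated_family:
  fixes K :: "real \<Rightarrow> real \<Rightarrow> real \<Rightarrow> real"
  assumes K: "\<And>\<theta>. 0 < \<theta> \<Longrightarrow> dominated_kernel (K \<theta>) (q \<theta>) (c \<theta>) (Q \<theta>)"
    and K_borel: "(\<lambda>(\<theta>, x, y). K \<theta> x y) \<in> borel_measurable (borel \<Otimes>\<^sub>M (borel \<Otimes>\<^sub>M borel))"
    and c: "integrable halfline c" and v: "v \<in> hL2" and w: "w \<in> hL2"
  shows "integrable halfline (\<lambda>\<theta>. \<integral>x. cnj (v x) * kop (K \<theta>) w x \<partial>halfline)"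
    and "(\<integral>\<theta>. (\<integral>x. cnj (v x) * kop (K \<theta>) w x \<partial>halfline) \<partial>halfline) =
      (\<integral>p. of_real (\<integral>\<theta>. K \<theta> (fst p) (snd p) \<partial>halfline) * (cnj (v (fst p)) * w (snd p)) \<partial>(halfline \<Otimes>\<^sub>M halfline))"
proof -
  let ?M = "halfline \<Otimes>\<^sub>M halfline"
  interpret P: pair_sigma_finite halfline ?M
    by (simp add: pair_sigma_finite_def sigma_finite_halfline halfline_pair.sigma_finite_measure_axioms)
  have [measurable]: "v \<in> borel_measurable halfline" "w \<in> borel_measurable halfline"
    using v w by (auto dest: hL2_measurable)
  have "(\<lambda>p. (fst p, fst (snd p), snd (snd p))) \<in> measurable (halfline \<Otimes>\<^sub>M ?M) (borel \<Otimes>\<^sub>M (borel \<Otimes>\<^sub>M borel))"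
    by (intro measurable_Pair measurable_compose[OF _ id_halfline_borel]) measurable
  from measurable_compose[OF this K_borel]
  have [measurable]: "(\<lambda>p. K (fst p) (fst (snd p)) (snd (snd p))) \<in> borel_measurable (halfline \<Otimes>\<^sub>M ?M)"
    by (simp add: case_prod_unfold)
  let ?F = "\<lambda>\<theta> p. of_real (K \<theta> (fst p) (snd p)) * (cnj (v (fst p)) * w (snd p))"
  have Fm: "(\<lambda>p. ?F (fst p) (snd p)) \<in> borel_measurable (halfline \<Otimes>\<^sub>M ?M)" by measurable
  let ?V = "(\<integral>x. (cmod (v x))\<^sup>2 \<partial>halfline) + (\<integral>x. (cmod (w x))\<^sup>2 \<partial>halfline)"
  have V: "(\<integral>\<^sup>+x. ennreal ((cmod (v x))\<^sup>2) \<partial>halfline) + (\<integral>\<^sup>+x. ennreal ((cmod (w x))\<^sup>2) \<partial>halfline) = ennreal ?V"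
    using hL2_integrable[OF v] hL2_integrable[OF w] by (simp add: nn_integral_eq_integral)
  have int: "integrable (halfline \<Otimes>\<^sub>M ?M) (\<lambda>p. ?F (fst p) (snd p))"
  proof (rule integrableI_bounded[OF Fm])
    have "(\<integral>\<^sup>+p. ennreal (norm (?F (fst p) (snd p))) \<partial>(halfline \<Otimes>\<^sub>M ?M)) =
        (\<integral>\<^sup>+\<theta>. (\<integral>\<^sup>+p. ennreal (norm (?F \<theta> p)) \<partial>?M) \<partial>halfline)"
      using sigma_finite_measure.nn_integral_fst[OF halfline_pair.sigma_finite_measure_axioms, of "\<lambda>p. ennreal (norm (?F (fst p) (snd p)))" halfline] Fm by simp
    also have "\<dots> \<le> (\<integral>\<^sup>+\<theta>. ennreal (c \<theta>) * ennreal ?V \<partial>halfline)"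
      using dominated_kernel.nn_integral_form_le[OF K v w] unfolding V by (intro nn_integral_mono) auto
    also have "\<dots> = (\<integral>\<^sup>+\<theta>. ennreal (c \<theta>) \<partial>halfline) * ennreal ?V"
      using c by (intro nn_integral_multc) auto
    also have "(\<integral>\<^sup>+\<theta>. ennreal (c \<theta>) \<partial>halfline) = ennreal (\<integral>\<theta>. c \<theta> \<partial>halfline)"
      using dominated_kernel.c_nonneg[OF K] c by (intro nn_integral_eq_integral AE_I2) auto
    also have "ennreal (\<integral>\<theta>. c \<theta> \<partial>halfline) * ennreal ?V < \<infinity>"
      by (simp add: ennreal_mult_less_top)
    finally show "(\<integral>\<^sup>+p. ennreal (norm (?F (fst p) (snd p))) \<partial>(halfline \<Otimes>\<^sub>M ?M)) < \<infinity>" .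
  qed
  have eq: "(\<integral>p. ?F \<theta> p \<partial>?M) = (\<integral>x. cnj (v x) * kop (K \<theta>) w x \<partial>halfline)" if "0 < \<theta>" for \<theta>
    using dominated_kernel.form_eq[OF K[OF that] v w] by simp
  have "integrable halfline (\<lambda>\<theta>. \<integral>p. ?F \<theta> p \<partial>?M)"
    using P.integrable_fst[of ?F] int by (simp add: case_prod_unfold)
  then show "integrable halfline (\<lambda>\<theta>. \<integral>x. cnj (v x) * kop (K \<theta>) w x \<partial>halfline)"
    by (subst (asm) Bochner_Integration.integrable_cong[OF refl eq]) auto
  have "(\<integral>\<theta>. (\<integral>x. cnj (v x) * kop (K \<theta>) w x \<partial>halfline) \<partial>halfline) = (\<integral>\<theta>. (\<integral>p. ?F \<theta> p \<partial>?M) \<partial>halfline)"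
    using eq by (intro Bochner_Integration.integral_cong) auto
  also have "\<dots> = (\<integral>p. (\<integral>\<theta>. ?F \<theta> p \<partial>halfline) \<partial>?M)"
    using P.Fubini_integral[of ?F] int by (simp add: case_prod_unfold)
  also have "\<dots> = (\<integral>p. of_real (\<integral>\<theta>. K \<theta> (fst p) (snd p) \<partial>halfline) * (cnj (v (fst p)) * w (snd p)) \<partial>?M)"
    unfolding integral_mult_left_zero integral_complex_of_real ..
  finally show "(\<integral>\<theta>. (\<integral>x. cnj (v x) * kop (K \<theta>) w x \<partial>halfline) \<partial>halfline) = \<dots>" .
qed

definition skop :: "('n \<Rightarrow> 'n \<Rightarrow> real \<Rightarrow> real \<Rightarrow> real) \<Rightarrow> ('n::finite) star_fun \<Rightarrow> 'n star_fun" where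
  "skop K f = (\<lambda>j x. \<Sum>l\<in>UNIV. kop (K j l) (f l) x)"

text \<open>The Cauchy-Schwarz inequality over l costs one factor \<open>CARD('n)\<close>, the sum
  over j another.\<close>

lemma
  fixes K :: "'n::finite \<Rightarrow> 'n \<Rightarrow> real \<Rightarrow> real \<Rightarrow> real"
  assumes K: "\<And>j l. dominated_kernel (K j l) q c Q" and f: "f \<in> star_L2"
  shows skop_L2: "skop K f \<in> star_L2"
    and skop_norm: "Re (star_inner (skop K f) (skop K f)) \<le> (real CARD('n) * c)\<^sup>2 * Re (star_inner f f)"
proof -
  have f': "f l \<in> hL2" for l using f by (simp add: star_L2_iff)
  note kh = dominated_kernel.kop_hL2[OF K f']
  show "skop K f \<in> star_L2"
    unfolding star_L2_iff skop_def using kh by (auto intro!: hL2_sum)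
  have "(\<integral>x. (cmod (\<Sum>l\<in>UNIV. kop (K j l) (f l) x))\<^sup>2 \<partial>halfline) \<le> real CARD('n) * c\<^sup>2 * Re (star_inner f f)" for j
  proof -
    have "(\<integral>x. (cmod (\<Sum>l\<in>UNIV. kop (K j l) (f l) x))\<^sup>2 \<partial>halfline) \<le>
       (\<integral>x. real CARD('n) * (\<Sum>l\<in>UNIV. (cmod (kop (K j l) (f l) x))\<^sup>2) \<partial>halfline)"
    proof (rule integral_mono)
      show "integrable halfline (\<lambda>x. (cmod (\<Sum>l\<in>UNIV. kop (K j l) (f l) x))\<^sup>2)"
        using kh by (intro hL2_integrable hL2_sum) auto
      show "integrable halfline (\<lambda>x. real CARD('n) * (\<Sum>l\<in>UNIV. (cmod (kop (K j l) (f l) x))\<^sup>2))"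
        using hL2_integrable[OF kh] by auto
      fix x
      have "(cmod (\<Sum>l\<in>UNIV. kop (K j l) (f l) x))\<^sup>2 \<le> (\<Sum>l\<in>UNIV. cmod (kop (K j l) (f l) x))\<^sup>2"
        by (intro power_mono norm_sum) auto
      also have "\<dots> = (\<Sum>l\<in>UNIV. 1 * cmod (kop (K j l) (f l) x))\<^sup>2" by simp
      also have "\<dots> \<le> (\<Sum>l\<in>(UNIV::'n set). 1\<^sup>2) * (\<Sum>l\<in>UNIV. (cmod (kop (K j l) (f l) x))\<^sup>2)"
        by (rule Cauchy_Schwarz_ineq_sum)
      finally show "(cmod (\<Sum>l\<in>UNIV. kop (K j l) (f l) x))\<^sup>2 \<le> real CARD('n) * (\<Sum>l\<in>UNIV. (cmod (kop (K j l) (f l) x))\<^sup>2)"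
        by simp
    qed
    also have "\<dots> = real CARD('n) * (\<Sum>l\<in>UNIV. \<integral>x. (cmod (kop (K j l) (f l) x))\<^sup>2 \<partial>halfline)"
      using hL2_integrable[OF kh] by simp
    also have "\<dots> \<le> real CARD('n) * (\<Sum>l\<in>UNIV. c\<^sup>2 * (\<integral>x. (cmod (f l x))\<^sup>2 \<partial>halfline))"
      by (intro mult_left_mono sum_mono dominated_kernel.kop_norm[OF K f']) auto
    also have "\<dots> = real CARD('n) * c\<^sup>2 * Re (star_inner f f)"
      by (simp add: star_inner_self sum_distrib_left mult.assoc)
    finally show ?thesis .
  qed
  then have "(\<Sum>j\<in>(UNIV::'n set). \<integral>x. (cmod (\<Sum>l\<in>UNIV. kop (K j l) (f l) x))\<^sup>2 \<partial>halfline) \<le>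
     (\<Sum>j\<in>(UNIV::'n set). real CARD('n) * c\<^sup>2 * Re (star_inner f f))"
    by (intro sum_mono)
  then show "Re (star_inner (skop K f) (skop K f)) \<le> (real CARD('n) * c)\<^sup>2 * Re (star_inner f f)"
    unfolding star_inner_self[of "skop K f"] by (simp add: skop_def power_mult_distrib power2_eq_square mult_ac)
qed

section \<open>Weak derivatives of integral operators\<close>

lemma test_function_facts:
  assumes "test_function \<phi>"
  shows "(\<phi> has_real_derivative deriv \<phi> x) (at x)" "isCont \<phi> x" "isCont (deriv \<phi>) x"
    and "\<exists>a b. 0 < a \<and> (\<forall>x. x \<notin> {a..b} \<longrightarrow> \<phi> x = 0 \<and> deriv \<phi> x = 0)"
proof -
  have d: "(deriv ^^ k) \<phi> field_differentiable (at x)" for k x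
    using assms by (simp add: test_function_def)
  from d[of 0 x] show "(\<phi> has_real_derivative deriv \<phi> x) (at x)"
    by (simp add: field_differentiable_derivI)
  show "isCont \<phi> x" using field_differentiable_imp_continuous_at[OF d[of 0 x]] by simp
  show "isCont (deriv \<phi>) x" using field_differentiable_imp_continuous_at[OF d[of 1 x]] by simp
  obtain a b where ab: "0 < a" "\<And>x. x \<notin> {a..b} \<Longrightarrow> \<phi> x = 0"
    using assms by (auto simp: test_function_def)
  have "deriv \<phi> x = 0" if "x \<notin> {a..b}" for x
  proof -
    have "eventually (\<lambda>z. z \<in> - {a..b}) (nhds x)" using that by (intro eventually_nhds_in_open) auto
    then have "eventually (\<lambda>z. \<phi> z = 0) (nhds x)" by eventually_elim (use ab in auto)
    then have "deriv \<phi> x = deriv (\<lambda>z. 0) x" by (rule deriv_cong_ev) simp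
    then show ?thesis by simp
  qed
  with ab show "\<exists>a b. 0 < a \<and> (\<forall>x. x \<notin> {a..b} \<longrightarrow> \<phi> x = 0 \<and> deriv \<phi> x = 0)" by blast
qed

lemma integrable_halfline_compact:
  fixes \<psi> :: "real \<Rightarrow> real"
  assumes "\<And>x. isCont \<psi> x" "\<And>x. x \<notin> {a..b} \<Longrightarrow> \<psi> x = 0"
  shows "integrable halfline \<psi>"
proof -
  have c: "continuous_on UNIV \<psi>" using assms(1) by (simp add: continuous_on_eq_continuous_at)
  then have [measurable]: "\<psi> \<in> borel_measurable borel" by (rule borel_measurable_continuous_onI)
  have "integrable lborel (\<lambda>x. indicator {a..b} x *\<^sub>R \<psi> x)"
    using borel_integrable_atLeastAtMost'[of a b \<psi>] continuous_on_subset[OF c] by (simp add: set_integrable_def)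
  then have "integrable lborel (\<lambda>x. indicator {0<..} x *\<^sub>R \<psi> x)"
    by (rule Bochner_Integration.integrable_bound) (use assms(2) in \<open>auto split: split_indicator\<close>)
  then show ?thesis by (simp add: integrable_halfline)
qed

lemma hL2_compact:
  assumes "\<And>x. isCont \<psi> x" "\<And>x. x \<notin> {a..b} \<Longrightarrow> \<psi> x = 0"
  shows "(\<lambda>x. complex_of_real (\<psi> x)) \<in> hL2"
proof -
  have c: "continuous_on UNIV \<psi>" using assms(1) by (simp add: continuous_on_eq_continuous_at)
  then have [measurable]: "\<psi> \<in> borel_measurable borel" by (rule borel_measurable_continuous_onI)
  have "integrable halfline (\<lambda>x. (\<psi> x)\<^sup>2)"
    using assms by (intro integrable_halfline_compact[where a=a and b=b]) auto
  then show ?thesis by (simp add: hL2_def)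
qed

lemma test_function_hL2:
  assumes "test_function \<phi>"
  shows "(\<lambda>x. complex_of_real (\<phi> x)) \<in> hL2" "(\<lambda>x. complex_of_real (deriv \<phi> x)) \<in> hL2"
  using test_function_facts[OF assms] by (auto intro!: hL2_compact)

text \<open>After Fubini the test function meets the kernel at fixed y, so integration by parts in
  the single variable x is enough. The coefficient e is the jump of K across the diagonal, which
  acts as a multiple of the identity.\<close>

lemma weak_deriv_kop:
  assumes K: "dominated_kernel K q c Q" and K': "dominated_kernel K' q' c' Q'" and f: "f \<in> hL2"
    and eq: "\<And>\<phi> y. test_function \<phi> \<Longrightarrow> 0 < y \<Longrightarrow>
      (\<integral>x. K x y * deriv \<phi> x \<partial>halfline) = - (d * (\<integral>x. K' x y * \<phi> x \<partial>halfline)) - e * \<phi> y"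
  shows "weak_deriv (kop K f) (\<lambda>x. of_real d * kop K' f x + of_real e * f x)"
  unfolding weak_deriv_def
proof (intro allI impI)
  fix \<phi> assume t: "test_function \<phi>"
  interpret K: dominated_kernel K q c Q by (rule K)
  interpret K': dominated_kernel K' q' c' Q' by (rule K')
  note L2 = test_function_hL2[OF t]
  have i1: "integrable halfline (\<lambda>x. of_real (\<phi> x) * kop K' f x)"
    using hL2_mult_integrable[OF L2(1) K'.kop_hL2[OF f]] by simp
  have i2: "integrable halfline (\<lambda>x. of_real (\<phi> x) * f x)"
    using hL2_mult_integrable[OF L2(1) f] by simp
  have i3: "integrable halfline (\<lambda>y. of_real (\<integral>x. K' x y * \<phi> x \<partial>halfline) * f y)"
  proof -
    have "integrable halfline (\<lambda>y. \<integral>x. of_real (K' x y) * (cnj (of_real (\<phi> x)) * f y) \<partial>halfline)"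
      using halfline_pair.integrable_snd[of "\<lambda>x y. of_real (K' x y) * (cnj (of_real (\<phi> x)) * f y)"]
        K'.form_integrable[OF L2(1) f] by (simp add: case_prod_unfold)
    moreover have "(\<integral>x. of_real (K' x y) * (cnj (of_real (\<phi> x)) * f y) \<partial>halfline) = of_real (\<integral>x. K' x y * \<phi> x \<partial>halfline) * f y" for y
      by (simp flip: integral_complex_of_real integral_mult_left_zero add: mult.assoc)
    ultimately show ?thesis by simp
  qed
  have "(\<integral>x. of_real (deriv \<phi> x) * kop K f x \<partial>halfline) =
      (\<integral>y. of_real (\<integral>x. K x y * deriv \<phi> x \<partial>halfline) * f y \<partial>halfline)"
    using K.form_eq_swap[OF L2(2) f] by (simp flip: of_real_mult)
  also have "\<dots> = (\<integral>y. - (of_real d * (of_real (\<integral>x. K' x y * \<phi> x \<partial>halfline) * f y) + of_real e * (of_real (\<phi> y) * f y)) \<partial>halfline)"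
  proof (intro Bochner_Integration.integral_cong refl)
    fix y assume "y \<in> space halfline"
    then have "0 < y" by simp
    from eq[OF t this]
    show "of_real (\<integral>x. K x y * deriv \<phi> x \<partial>halfline) * f y =
      - (of_real d * (of_real (\<integral>x. K' x y * \<phi> x \<partial>halfline) * f y) + of_real e * (of_real (\<phi> y) * f y))"
      by (simp add: distrib_right left_diff_distrib)
  qed
  also have "\<dots> = - (of_real d * (\<integral>y. of_real (\<integral>x. K' x y * \<phi> x \<partial>halfline) * f y \<partial>halfline) + of_real e * (\<integral>y. of_real (\<phi> y) * f y \<partial>halfline))"
    using i2 i3 by simp
  also have "(\<integral>y. of_real (\<integral>x. K' x y * \<phi> x \<partial>halfline) * f y \<partial>halfline) = (\<integral>x. of_real (\<phi> x) * kop K' f x \<partial>halfline)"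
    using K'.form_eq_swap[OF L2(1) f] by (simp flip: of_real_mult)
  also have "of_real d * (\<integral>x. of_real (\<phi> x) * kop K' f x \<partial>halfline) + of_real e * (\<integral>y. of_real (\<phi> y) * f y \<partial>halfline) =
     (\<integral>x. of_real d * (of_real (\<phi> x) * kop K' f x) + of_real e * (of_real (\<phi> x) * f x) \<partial>halfline)"
    using i1 i2 by simp
  also have "\<dots> = (\<integral>x. of_real (\<phi> x) * (of_real d * kop K' f x + of_real e * f x) \<partial>halfline)"
    by (simp add: algebra_simps)
  finally show "(\<integral>x. of_real (deriv \<phi> x) * kop K f x \<partial>halfline) =
    - (\<integral>x. of_real (\<phi> x) * (of_real d * kop K' f x + of_real e * f x) \<partial>halfline)" .
qed

lemma weak_deriv_sum:
  assumes "\<And>l. l \<in> I \<Longrightarrow> weak_deriv (u l) (v l)" "\<And>l. l \<in> I \<Longrightarrow> u l \<in> hL2" "\<And>l. l \<in> I \<Longrightarrow> v l \<in> hL2"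
  shows "weak_deriv (\<lambda>x. \<Sum>l\<in>I. u l x) (\<lambda>x. \<Sum>l\<in>I. v l x)"
  unfolding weak_deriv_def
proof (intro allI impI)
  fix \<phi> assume t: "test_function \<phi>"
  note L2 = test_function_hL2[OF t]
  have i: "integrable halfline (\<lambda>x. of_real (deriv \<phi> x) * u l x)" "integrable halfline (\<lambda>x. of_real (\<phi> x) * v l x)" if "l \<in> I" for l
    using hL2_mult_integrable[OF L2(2) assms(2)[OF that]] hL2_mult_integrable[OF L2(1) assms(3)[OF that]] by simp_all
  have "(\<integral>x. of_real (deriv \<phi> x) * (\<Sum>l\<in>I. u l x) \<partial>halfline) = (\<Sum>l\<in>I. \<integral>x. of_real (deriv \<phi> x) * u l x \<partial>halfline)"
    using i by (simp add: sum_distrib_left)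
  also have "\<dots> = (\<Sum>l\<in>I. - (\<integral>x. of_real (\<phi> x) * v l x \<partial>halfline))"
    using assms(1) t by (intro sum.cong refl) (auto simp: weak_deriv_def)
  also have "\<dots> = - (\<integral>x. of_real (\<phi> x) * (\<Sum>l\<in>I. v l x) \<partial>halfline)"
    using i by (simp add: sum_distrib_left sum_negf)
  finally show "(\<integral>x. of_real (deriv \<phi> x) * (\<Sum>l\<in>I. u l x) \<partial>halfline) = - (\<integral>x. of_real (\<phi> x) * (\<Sum>l\<in>I. v l x) \<partial>halfline)" .
qed

section \<open>The resolvent of the star graph\<close>

lemma kronecker_cases: "kronecker j l = 0 \<or> kronecker j l = 1"
  by (simp add: kronecker_def)

text \<open>The first term is the Dirichlet Green function of -u'' + k^2 u on one edge. Adding c exp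
  (-k x) on every edge, with a common vertex value c, leaves the condition (sum of the b_l) - N k c
  = \<alpha> c, where b_l is the integral of exp (-k y) f_l(y). Hence the factor 1/(\<alpha> + N
  k).\<close>

definition resolvent_kernel :: "real \<Rightarrow> real \<Rightarrow> 'n::finite \<Rightarrow> 'n \<Rightarrow> real \<Rightarrow> real \<Rightarrow> real" where
  "resolvent_kernel \<alpha> k j l x y =
     kronecker j l * (exp (- (k * \<bar>x - y\<bar>)) - exp (- (k * (x + y)))) / (2 * k)
     + exp (- (k * (x + y))) / (\<alpha> + real CARD('n) * k)"

definition resolvent_kernel_deriv :: "real \<Rightarrow> real \<Rightarrow> 'n::finite \<Rightarrow> 'n \<Rightarrow> real \<Rightarrow> real \<Rightarrow> real" where
  "resolvent_kernel_deriv \<alpha> k j l x y =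
     kronecker j l * (exp (- (k * (x + y))) - sgn (x - y) * exp (- (k * \<bar>x - y\<bar>))) / 2
     - k * exp (- (k * (x + y))) / (\<alpha> + real CARD('n) * k)"

lemma dominated_kernel_exp:
  assumes "case_prod K \<in> borel_measurable (borel \<Otimes>\<^sub>M borel)" "0 < k" "0 \<le> C"
    and "\<And>x y. 0 \<le> x \<Longrightarrow> 0 < y \<Longrightarrow> \<bar>K x y\<bar> \<le> C * exp (- (k * \<bar>x - y\<bar>))"
  shows "dominated_kernel K (\<lambda>d. C * exp (- (k * d))) (2 * C / k) C"
proof
  show "2 * (\<integral>\<^sup>+d. ennreal (C * exp (- (k * d))) \<partial>halfline) \<le> ennreal (2 * C / k)"
  proof -
    have "(\<integral>\<^sup>+d. ennreal (C * exp (- (k * d))) \<partial>halfline) = ennreal (C / k)"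
      using assms(2,3) nn_integral_exp_halfline[of k]
      by (simp add: ennreal_mult nn_integral_cmult) (simp flip: ennreal_mult)
    then show ?thesis using ennreal_mult[of 2 "C / k"] assms(2,3) by simp
  qed
  show "C * exp (- (k * d)) \<le> C" if "0 \<le> d" for d
    using assms(2,3) that by (simp add: mult_left_le)
qed (use assms in auto)

text \<open>\<open>boundary_value\<close> needs continuity up to x = 0. For x in a bounded set, exp
  (-k |x - y|) is at most a constant times exp (-k y), which is square integrable in y; the
  diagonal, where K may jump, is a null set for each x.\<close>

lemma continuous_on_kop:
  assumes K: "case_prod K \<in> borel_measurable (borel \<Otimes>\<^sub>M borel)" and k: "0 < k" and C: "0 \<le> C"
    and b: "\<And>x y. 0 \<le> x \<Longrightarrow> 0 < y \<Longrightarrow> \<bar>K x y\<bar> \<le> C * exp (- (k * \<bar>x - y\<bar>))"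
    and cont: "\<And>x y. 0 \<le> x \<Longrightarrow> 0 < y \<Longrightarrow> x \<noteq> y \<Longrightarrow> isCont (\<lambda>x. K x y) x"
    and f: "f \<in> hL2"
  shows "continuous_on {0..} (kop K f)"
proof (rule continuous_on_sequentiallyI)
  fix X :: "nat \<Rightarrow> real" and x assume X: "\<forall>n. X n \<in> {0..}" and x: "x \<in> {0..}" and lim: "X \<longlonglongrightarrow> x"
  have [measurable]: "f \<in> borel_measurable halfline" using f by (auto dest: hL2_measurable)
  have Km [measurable]: "K z \<in> borel_measurable borel" for z
    using measurable_compose[OF measurable_Pair1'[of z borel] K] by simp
  obtain M where M: "\<And>n. \<bar>X n\<bar> \<le> M"
    using convergent_imp_Bseq[OF convergentI[OF lim]] by (auto simp: Bseq_def)
  have e: "(\<lambda>y. complex_of_real (exp (- (k * y)))) \<in> hL2"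
  proof -
    have "(exp (- (k * y)))\<^sup>2 = exp (- ((2 * k) * y))" for y by (simp add: power2_eq_square flip: exp_add)
    then show ?thesis using integrable_exp_halfline[of "2 * k"] k by (simp add: hL2_def)
  qed
  have "(\<lambda>n. kop K f (X n)) \<longlonglongrightarrow> kop K f x"
    unfolding kop_def
  proof (rule integral_dominated_convergence)
    show "integrable halfline (\<lambda>y. C * exp (k * M) * cmod (cnj (of_real (exp (- (k * y)))) * f y))"
      by (intro integrable_mult_right integrable_norm hL2_mult_integrable e f)
    show "AE y in halfline. (\<lambda>n. of_real (K (X n) y) * f y) \<longlonglongrightarrow> of_real (K x y) * f y"
      using AE_halfline_pos AE_halfline_neq[of x]
    proof eventually_elim
      case (elim y)
      with x have "isCont (\<lambda>x. K x y) x" by (intro cont) auto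
      then show ?case by (intro tendsto_intros isCont_tendsto_compose[OF _ lim])
    qed
    show "AE y in halfline. norm (of_real (K (X n) y) * f y) \<le> C * exp (k * M) * cmod (cnj (of_real (exp (- (k * y)))) * f y)" for n
      using AE_halfline_pos
    proof eventually_elim
      case (elim y)
      have X0: "0 \<le> X n" using X by auto
      have "\<bar>K (X n) y\<bar> \<le> C * exp (- (k * \<bar>X n - y\<bar>))" by (rule b[OF X0 elim])
      also have "\<dots> \<le> C * exp (k * M - k * y)"
      proof -
        have "y - M \<le> \<bar>X n - y\<bar>" using M[of n] X0 by auto
        then have "k * (y - M) \<le> k * \<bar>X n - y\<bar>" using k by (intro mult_left_mono) auto
        then show ?thesis using C by (intro mult_left_mono) (auto simp: algebra_simps)
      qed
      finally have "\<bar>K (X n) y\<bar> \<le> C * exp (k * M) * exp (- (k * y))" by (simp add: exp_diff exp_minus divide_simps)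
      then show ?case by (simp add: norm_mult mult_right_mono flip: mult.assoc)
    qed
  qed measurable
  then show "(\<lambda>n. kop K f (X n)) \<longlonglongrightarrow> kop K f x" .
qed

section \<open>Bounds, weak derivatives and vertex values of the resolvent\<close>

context
  fixes \<alpha> k :: real
  assumes \<alpha>: "0 < \<alpha>" and k: "0 < k"
begin

lemma exp_sum_le: "0 \<le> x \<Longrightarrow> 0 < y \<Longrightarrow> exp (- (k * (x + y))) \<le> exp (- (k * \<bar>x - y\<bar>))" for x y :: real
  using k by simp

lemma card_ge_1: "1 \<le> real CARD('n::finite)"
  by (simp add: Suc_leI)

lemma k_div_le: "k / (\<alpha> + real CARD('n::finite) * k) \<le> 1"
proof -
  have "1 * k \<le> real CARD('n) * k" using k by (intro mult_right_mono card_ge_1) auto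
  then have "k \<le> \<alpha> + real CARD('n) * k" using \<alpha> by linarith
  then show ?thesis using k by (simp add: divide_le_eq)
qed

text \<open>The Dirichlet part contributes 1/(2 k) and the vertex part at most 1/k, because
  \<open>k \<le> \<alpha> + N * k\<close>; together 3/(2 k).\<close>

lemma resolvent_kernel_le:
  fixes j l :: "'n::finite"
  assumes "0 \<le> x" "0 < y"
  shows "0 \<le> resolvent_kernel \<alpha> k j l x y" "resolvent_kernel \<alpha> k j l x y \<le> 3 / (2 * k) * exp (- (k * \<bar>x - y\<bar>))"
proof -
  let ?A = "exp (- (k * \<bar>x - y\<bar>))" and ?Z = "exp (- (k * (x + y)))"
  have AZ: "0 \<le> ?Z" "?Z \<le> ?A" using exp_sum_le[OF assms] by auto
  have p: "0 < \<alpha> + real CARD('n) * k" using \<alpha> k by (intro add_pos_pos mult_pos_pos) auto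
  show "0 \<le> resolvent_kernel \<alpha> k j l x y"
    using AZ k p kronecker_cases[of j l] unfolding resolvent_kernel_def by (auto intro!: add_nonneg_nonneg divide_nonneg_pos)
  have "kronecker j l * (?A - ?Z) / (2 * k) \<le> ?A / (2 * k)"
    using AZ k kronecker_cases[of j l] by (intro divide_right_mono) auto
  moreover have "?Z / (\<alpha> + real CARD('n) * k) \<le> ?A / k"
  proof -
    have "1 * k \<le> real CARD('n) * k" using k by (intro mult_right_mono card_ge_1) auto
    then have "k \<le> \<alpha> + real CARD('n) * k" using \<alpha> by linarith
    then show ?thesis using AZ k by (intro frac_le) auto
  qed
  ultimately have "resolvent_kernel \<alpha> k j l x y \<le> ?A / (2 * k) + ?A / k"
    unfolding resolvent_kernel_def by (rule add_mono)
  also have "\<dots> = 3 / (2 * k) * ?A" using k by (simp add: field_simps)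
  finally show "resolvent_kernel \<alpha> k j l x y \<le> 3 / (2 * k) * ?A" .
qed

lemma resolvent_kernel_abs_le:
  "0 \<le> x \<Longrightarrow> 0 < y \<Longrightarrow> \<bar>resolvent_kernel \<alpha> k j l x y\<bar> \<le> 3 / (2 * k) * exp (- (k * \<bar>x - y\<bar>))"
  using resolvent_kernel_le[of x y j l] by simp

lemma resolvent_kernel_deriv_abs_le:
  fixes j l :: "'n::finite"
  assumes "0 \<le> x" "0 < y"
  shows "\<bar>resolvent_kernel_deriv \<alpha> k j l x y\<bar> \<le> 2 * exp (- (k * \<bar>x - y\<bar>))"
proof -
  let ?A = "exp (- (k * \<bar>x - y\<bar>))" and ?Z = "exp (- (k * (x + y)))"
  have AZ: "0 \<le> ?Z" "?Z \<le> ?A" using exp_sum_le[OF assms] by auto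
  have p: "0 < \<alpha> + real CARD('n) * k" using \<alpha> k by (intro add_pos_pos mult_pos_pos) auto
  have s: "\<bar>sgn (x - y) * ?A\<bar> \<le> ?A" by (simp add: abs_mult sgn_real_def)
  have "\<bar>?Z - sgn (x - y) * ?A\<bar> \<le> 2 * ?A"
    using AZ s by linarith
  then have "\<bar>kronecker j l * (?Z - sgn (x - y) * ?A) / 2\<bar> \<le> ?A"
    using kronecker_cases[of j l] by auto
  moreover have "\<bar>k * ?Z / (\<alpha> + real CARD('n) * k)\<bar> \<le> ?A"
  proof -
    have "k * ?Z / (\<alpha> + real CARD('n) * k) = k / (\<alpha> + real CARD('n) * k) * ?Z" by simp
    also have "\<dots> \<le> 1 * ?A" using AZ k p by (intro mult_mono k_div_le) auto
    finally show ?thesis using AZ k p by simp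
  qed
  ultimately show ?thesis
    unfolding resolvent_kernel_deriv_def by (intro order.trans[OF abs_triangle_ineq4]) simp
qed

lemma resolvent_kernel_borel:
  "case_prod (resolvent_kernel \<alpha> k j l) \<in> borel_measurable (borel \<Otimes>\<^sub>M borel)"
  "case_prod (resolvent_kernel_deriv \<alpha> k j l) \<in> borel_measurable (borel \<Otimes>\<^sub>M borel)"
  unfolding resolvent_kernel_def[abs_def] resolvent_kernel_deriv_def[abs_def] case_prod_unfold sgn_real_def
  by measurable

lemma dominated_resolvent_kernel:
  "dominated_kernel (resolvent_kernel \<alpha> k j l) (\<lambda>d. 3 / (2 * k) * exp (- (k * d))) (3 / k\<^sup>2) (3 / (2 * k))"
  using dominated_kernel_exp[OF resolvent_kernel_borel(1) k _ resolvent_kernel_abs_le, of j l] k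
  by (simp add: power2_eq_square)

lemma dominated_resolvent_kernel_deriv:
  "dominated_kernel (resolvent_kernel_deriv \<alpha> k j l) (\<lambda>d. 2 * exp (- (k * d))) (4 / k) 2"
  using dominated_kernel_exp[OF resolvent_kernel_borel(2) k _ resolvent_kernel_deriv_abs_le, of j l] k
  by simp

text \<open>Integration by parts on both sides of the diagonal: \<open>s = 1\<close> is for the kernel \<open>exp (-k |x - y|)\<close> and
  \<open>s = -1\<close> for \<open>sgn (x - y) exp (-k |x - y|)\<close>, whose jump produces the boundary term.\<close>

lemma halfline_parts:
  fixes h :: "real \<Rightarrow> real"
  assumes t: "test_function \<phi>" and y: "0 < y"
    and 1: "\<And>x. 0 < x \<Longrightarrow> x < y \<Longrightarrow> h x = s * ((deriv \<phi> x + k * \<phi> x) * exp (- (k * (y - x))))"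
    and 2: "\<And>x. y < x \<Longrightarrow> h x = (deriv \<phi> x - k * \<phi> x) * exp (- (k * (x - y)))"
    and [measurable]: "h \<in> borel_measurable borel"
  shows "has_bochner_integral halfline h ((s - 1) * \<phi> y)"
proof -
  note tf = test_function_facts[OF t]
  obtain a b where ab: "0 < a" "\<And>x. x \<notin> {a..b} \<Longrightarrow> \<phi> x = 0" "\<And>x. x \<notin> {a..b} \<Longrightarrow> deriv \<phi> x = 0"
    using tf(4) by auto
  define M where "M = max y b + 1"
  have M: "y \<le> M" "b < M" by (auto simp: M_def)
  have [measurable]: "\<phi> \<in> borel_measurable borel" "deriv \<phi> \<in> borel_measurable borel"
    using tf(2,3) by (auto intro!: borel_measurable_continuous_onI simp: continuous_on_eq_continuous_at)
  let ?f1 = "\<lambda>x. (deriv \<phi> x + k * \<phi> x) * exp (- (k * (y - x)))"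
  let ?f2 = "\<lambda>x. (deriv \<phi> x - k * \<phi> x) * exp (- (k * (x - y)))"
  have 3: "has_bochner_integral lborel (\<lambda>x. ?f1 x * indicator {0..y} x) (\<phi> y * exp (- (k * (y - y))) - \<phi> 0 * exp (- (k * (y - 0))))"
    using y by (intro has_bochner_integral_FTC_Icc_real)
      (auto intro!: derivative_eq_intros tf continuous_intros simp: algebra_simps)
  have 4: "has_bochner_integral lborel (\<lambda>x. ?f2 x * indicator {y..M} x) (\<phi> M * exp (- (k * (M - y))) - \<phi> y * exp (- (k * (y - y))))"
    using M by (intro has_bochner_integral_FTC_Icc_real)
      (auto intro!: derivative_eq_intros tf continuous_intros simp: algebra_simps)
  have z: "\<phi> 0 = 0" "\<phi> M = 0" using ab M by auto
  have "has_bochner_integral lborel (\<lambda>x. s * (?f1 x * indicator {0..y} x) + ?f2 x * indicator {y..M} x)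
     (s * \<phi> y + (- \<phi> y))"
    using 3 4 by (intro has_bochner_integral_add has_bochner_integral_mult_right) (auto simp: z)
  moreover have "AE x in lborel. s * (?f1 x * indicator {0..y} x) + ?f2 x * indicator {y..M} x = indicator {0<..} x *\<^sub>R h x"
    using AE_lborel_singleton[of 0] AE_lborel_singleton[of y]
  proof eventually_elim
    case (elim x)
    consider "x < 0" | "0 < x" "x < y" | "y < x" "x \<le> M" | "M < x" using elim by linarith
    then show ?case
    proof cases
      case 1 then show ?thesis using y by auto
    next
      case 2 then show ?thesis using M assms(3)[of x] by auto
    next
      case 3 then show ?thesis using y assms(4)[of x] by auto
    next
      case 4 then show ?thesis using M y ab(2,3)[of x] assms(4)[of x] by auto
    qed
  qed
  ultimately have "has_bochner_integral lborel (\<lambda>x. indicator {0<..} x *\<^sub>R h x) (s * \<phi> y + (- \<phi> y))"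
    by (subst (asm) has_bochner_integral_cong_AE) auto
  then show ?thesis
    unfolding halfline_def by (subst has_bochner_integral_restrict_space) (auto simp: algebra_simps)
qed

lemma halfline_parts_exp_sum:
  assumes t: "test_function \<phi>" and y: "0 < y"
  shows "has_bochner_integral halfline (\<lambda>x. (deriv \<phi> x - k * \<phi> x) * exp (- (k * (x + y)))) 0"
proof -
  note tf = test_function_facts[OF t]
  obtain a b where ab: "0 < a" "\<And>x. x \<notin> {a..b} \<Longrightarrow> \<phi> x = 0" "\<And>x. x \<notin> {a..b} \<Longrightarrow> deriv \<phi> x = 0"
    using tf(4) by auto
  define M where "M = max 0 b + 1"
  have M: "0 \<le> M" "b < M" by (auto simp: M_def)
  let ?f = "\<lambda>x. (deriv \<phi> x - k * \<phi> x) * exp (- (k * (x + y)))"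
  have 3: "has_bochner_integral lborel (\<lambda>x. ?f x * indicator {0..M} x) (\<phi> M * exp (- (k * (M + y))) - \<phi> 0 * exp (- (k * (0 + y))))"
    using M by (intro has_bochner_integral_FTC_Icc_real)
      (auto intro!: derivative_eq_intros tf continuous_intros simp: algebra_simps)
  have z: "\<phi> 0 = 0" "\<phi> M = 0" using ab M by auto
  have "(\<lambda>x. ?f x * indicator {0..M} x) = (\<lambda>x. indicator {0<..} x *\<^sub>R ?f x)"
  proof
    fix x
    have "x \<le> 0 \<or> M < x \<Longrightarrow> x \<notin> {a..b}" using ab(1) M by auto
    then show "?f x * indicator {0..M} x = indicator {0<..} x *\<^sub>R ?f x"
      using ab(2,3)[of x] by (auto split: split_indicator)
  qed
  with 3 z have "has_bochner_integral lborel (\<lambda>x. indicator {0<..} x *\<^sub>R ?f x) 0" by simp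
  then show ?thesis
    unfolding halfline_def by (subst has_bochner_integral_restrict_space) auto
qed

lemma test_function_kernel_integrable:
  assumes t: "test_function \<phi>" and y: "0 < y" and K: "case_prod K \<in> borel_measurable (borel \<Otimes>\<^sub>M borel)"
    and b: "\<And>x. 0 < x \<Longrightarrow> \<bar>K x y\<bar> \<le> C * exp (- (k * \<bar>x - y\<bar>))" and C: "0 \<le> C"
  shows "integrable halfline (\<lambda>x. K x y * \<phi> x)" "integrable halfline (\<lambda>x. K x y * deriv \<phi> x)"
proof -
  note tf = test_function_facts[OF t]
  obtain a b where ab: "\<And>x. x \<notin> {a..b} \<Longrightarrow> \<phi> x = 0" "\<And>x. x \<notin> {a..b} \<Longrightarrow> deriv \<phi> x = 0"
    using tf(4) by blast
  have m: "(\<lambda>x. K x y) \<in> borel_measurable borel"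
    using measurable_compose[OF measurable_Pair2'[of y borel borel] K] by simp
  have b': "\<bar>K x y\<bar> \<le> C" if "0 < x" for x
    using b[OF that] mult_left_le[OF _ C, of "exp (- (k * \<bar>x - y\<bar>))"] k by simp
  have *: "integrable halfline (\<lambda>x. K x y * \<psi> x)" if i: "integrable halfline \<psi>" for \<psi> :: "real \<Rightarrow> real"
  proof (rule Bochner_Integration.integrable_bound[OF integrable_mult_right[OF i, of C]])
    show "(\<lambda>x. K x y * \<psi> x) \<in> borel_measurable halfline"
      using m borel_measurable_integrable[OF i] by measurable
    show "AE x in halfline. norm (K x y * \<psi> x) \<le> norm (C * \<psi> x)"
      using AE_halfline_pos by eventually_elim (use b' C in \<open>auto simp: abs_mult intro!: mult_right_mono\<close>)
  qed
  show "integrable halfline (\<lambda>x. K x y * \<phi> x)" "integrable halfline (\<lambda>x. K x y * deriv \<phi> x)"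
    using tf(2,3) ab by (auto intro!: * integrable_halfline_compact[where a=a and b=b])
qed

text \<open>For j = l the kernel is continuous across x = y while its x-derivative jumps by -1, so
  only the second identity has a boundary term. Together they express -K'' + k^2 K = \<delta>
  weakly.\<close>

lemma resolvent_kernel_parts:
  fixes j l :: "'n::finite"
  assumes t: "test_function \<phi>" and y: "0 < y"
  shows "(\<integral>x. resolvent_kernel \<alpha> k j l x y * deriv \<phi> x \<partial>halfline) =
      - (\<integral>x. resolvent_kernel_deriv \<alpha> k j l x y * \<phi> x \<partial>halfline)"
    and "(\<integral>x. resolvent_kernel_deriv \<alpha> k j l x y * deriv \<phi> x \<partial>halfline) =
      - (k\<^sup>2 * (\<integral>x. resolvent_kernel \<alpha> k j l x y * \<phi> x \<partial>halfline)) + kronecker j l * \<phi> y"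
proof -
  let ?R = "\<lambda>x. resolvent_kernel \<alpha> k j l x y" and ?R1 = "\<lambda>x. resolvent_kernel_deriv \<alpha> k j l x y"
  let ?A = "\<lambda>x. exp (- (k * \<bar>x - y\<bar>))" and ?S = "\<lambda>x. sgn (x - y) * exp (- (k * \<bar>x - y\<bar>))"
    and ?Z = "\<lambda>x. exp (- (k * (x + y)))"
  define p where "p = \<alpha> + real CARD('n) * k"
  have p: "0 < p" using \<alpha> k by (auto simp: p_def intro!: add_pos_pos mult_pos_pos)
  note tf = test_function_facts[OF t]
  have [measurable]: "\<phi> \<in> borel_measurable borel" "deriv \<phi> \<in> borel_measurable borel"
    using tf(2,3) by (auto intro!: borel_measurable_continuous_onI simp: continuous_on_eq_continuous_at)
  have 1: "has_bochner_integral halfline (\<lambda>x. deriv \<phi> x * ?A x - k * (\<phi> x * ?S x)) ((1 - 1) * \<phi> y)"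
    by (intro halfline_parts t y) (auto simp: algebra_simps sgn_real_def)
  have 2: "has_bochner_integral halfline (\<lambda>x. deriv \<phi> x * ?S x - k * (\<phi> x * ?A x)) ((- 1 - 1) * \<phi> y)"
    by (intro halfline_parts t y) (auto simp: algebra_simps sgn_real_def)
  note 3 = halfline_parts_exp_sum[OF t y]
  have i: "integrable halfline (\<lambda>x. ?R x * \<phi> x)" "integrable halfline (\<lambda>x. ?R x * deriv \<phi> x)"
     "integrable halfline (\<lambda>x. ?R1 x * \<phi> x)" "integrable halfline (\<lambda>x. ?R1 x * deriv \<phi> x)"
    using resolvent_kernel_abs_le[OF less_imp_le y] resolvent_kernel_deriv_abs_le[OF less_imp_le y] k
    by (auto intro!: test_function_kernel_integrable[OF t y resolvent_kernel_borel(1), where C="3 / (2 * k)"]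
        test_function_kernel_integrable[OF t y resolvent_kernel_borel(2), where C=2])
  have "has_bochner_integral halfline (\<lambda>x. kronecker j l / (2 * k) *
      ((deriv \<phi> x * ?A x - k * (\<phi> x * ?S x)) - (deriv \<phi> x - k * \<phi> x) * ?Z x)
      + 1 / p * ((deriv \<phi> x - k * \<phi> x) * ?Z x)) (kronecker j l / (2 * k) * ((1 - 1) * \<phi> y - 0) + 1 / p * 0)"
    by (intro has_bochner_integral_add has_bochner_integral_mult_right has_bochner_integral_diff 1 3)
  moreover have "kronecker j l / (2 * k) *
      ((deriv \<phi> x * ?A x - k * (\<phi> x * ?S x)) - (deriv \<phi> x - k * \<phi> x) * ?Z x)
      + 1 / p * ((deriv \<phi> x - k * \<phi> x) * ?Z x) = ?R x * deriv \<phi> x + ?R1 x * \<phi> x" for x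
    using k p unfolding resolvent_kernel_def resolvent_kernel_deriv_def p_def[symmetric] by (simp add: field_simps)
  ultimately have "has_bochner_integral halfline (\<lambda>x. ?R x * deriv \<phi> x + ?R1 x * \<phi> x) 0" by simp
  from has_bochner_integral_integral_eq[OF this] i
  show "(\<integral>x. ?R x * deriv \<phi> x \<partial>halfline) = - (\<integral>x. ?R1 x * \<phi> x \<partial>halfline)" by simp
  have "has_bochner_integral halfline (\<lambda>x. kronecker j l / 2 *
      ((deriv \<phi> x - k * \<phi> x) * ?Z x - (deriv \<phi> x * ?S x - k * (\<phi> x * ?A x)))
      - k / p * ((deriv \<phi> x - k * \<phi> x) * ?Z x)) (kronecker j l / 2 * (0 - (- 1 - 1) * \<phi> y) - k / p * 0)"
    by (intro has_bochner_integral_diff has_bochner_integral_mult_right 2 3)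
  moreover have "kronecker j l / 2 *
      ((deriv \<phi> x - k * \<phi> x) * ?Z x - (deriv \<phi> x * ?S x - k * (\<phi> x * ?A x)))
      - k / p * ((deriv \<phi> x - k * \<phi> x) * ?Z x) = ?R1 x * deriv \<phi> x + k\<^sup>2 * (?R x * \<phi> x)" for x
    using k p unfolding resolvent_kernel_def resolvent_kernel_deriv_def p_def[symmetric]
    by (simp add: field_simps power2_eq_square)
  ultimately have "has_bochner_integral halfline (\<lambda>x. ?R1 x * deriv \<phi> x + k\<^sup>2 * (?R x * \<phi> x)) (kronecker j l * \<phi> y)" by simp
  from has_bochner_integral_integral_eq[OF this] i
  show "(\<integral>x. ?R1 x * deriv \<phi> x \<partial>halfline) = - (k\<^sup>2 * (\<integral>x. ?R x * \<phi> x \<partial>halfline)) + kronecker j l * \<phi> y" by simp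
qed

text \<open>The integral formula itself, evaluated at all x \<ge> 0, is the continuous
  representative.\<close>

lemma boundary_value_skop:
  fixes K :: "'n::finite \<Rightarrow> 'n \<Rightarrow> real \<Rightarrow> real \<Rightarrow> real"
  assumes "\<And>j l. case_prod (K j l) \<in> borel_measurable (borel \<Otimes>\<^sub>M borel)" "0 \<le> C"
    and "\<And>j l x y. 0 \<le> x \<Longrightarrow> 0 < y \<Longrightarrow> \<bar>K j l x y\<bar> \<le> C * exp (- (k * \<bar>x - y\<bar>))"
    and "\<And>j l x y. 0 \<le> x \<Longrightarrow> 0 < y \<Longrightarrow> x \<noteq> y \<Longrightarrow> isCont (\<lambda>x. K j l x y) x"
    and "f \<in> star_L2"
  shows "boundary_value (skop K f j) (skop K f j 0)"
  unfolding boundary_value_def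
proof (intro exI conjI)
  show "continuous_on {0..} (skop K f j)"
    unfolding skop_def using assms k
    by (intro continuous_on_sum continuous_on_kop[where C=C and k=k]) (auto simp: star_L2_iff)
qed auto

theorem resolvent_in_star_H:
  fixes f :: "('n::finite) star_fun"
  assumes f: "f \<in> star_L2"
  shows "(skop (resolvent_kernel \<alpha> k) f, lin_comb f (- of_real (k\<^sup>2)) (skop (resolvent_kernel \<alpha> k) f)) \<in> star_H \<alpha>"
proof -
  let ?R = "resolvent_kernel \<alpha> k :: 'n \<Rightarrow> _" and ?R1 = "resolvent_kernel_deriv \<alpha> k :: 'n \<Rightarrow> _"
  let ?u = "skop ?R f" and ?u1 = "skop ?R1 f"
  let ?u2 = "\<lambda>j x. of_real (k\<^sup>2) * ?u j x - f j x"
  have f': "f l \<in> hL2" for l using f by (simp add: star_L2_iff)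
  have u: "?u \<in> star_L2" by (rule skop_L2[OF dominated_resolvent_kernel f])
  have u1: "?u1 \<in> star_L2" by (rule skop_L2[OF dominated_resolvent_kernel_deriv f])
  have h: "lin_comb f (- of_real (k\<^sup>2)) ?u \<in> star_L2" by (rule star_L2_lin_comb[OF u f])
  have u2: "?u2 \<in> star_L2"
    using star_L2_lin_comb[OF h star_L2_zero, of "-1"] by simp
  note kR = dominated_kernel.kop_hL2[OF dominated_resolvent_kernel f']
  note kR1 = dominated_kernel.kop_hL2[OF dominated_resolvent_kernel_deriv f']
  have "weak_deriv (kop (?R j l) (f l)) (\<lambda>x. of_real 1 * kop (?R1 j l) (f l) x + of_real 0 * f l x)" for j l
    using resolvent_kernel_parts(1)
    by (intro weak_deriv_kop[OF dominated_resolvent_kernel dominated_resolvent_kernel_deriv f']) simp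
  then have w1: "weak_deriv (?u j) (?u1 j)" for j
    unfolding skop_def using kR kR1 by (intro weak_deriv_sum) auto
  have "weak_deriv (kop (?R1 j l) (f l)) (\<lambda>x. of_real (k\<^sup>2) * kop (?R j l) (f l) x + of_real (- kronecker j l) * f l x)" for j l
    using resolvent_kernel_parts(2)
    by (intro weak_deriv_kop[OF dominated_resolvent_kernel_deriv dominated_resolvent_kernel f']) simp
  then have "weak_deriv (\<lambda>x. \<Sum>l\<in>UNIV. kop (?R1 j l) (f l) x)
      (\<lambda>x. \<Sum>l\<in>UNIV. of_real (k\<^sup>2) * kop (?R j l) (f l) x + of_real (- kronecker j l) * f l x)" for j
    using kR kR1 f' by (intro weak_deriv_sum hL2_lin_comb hL2_scale) auto
  moreover have "(\<Sum>l\<in>UNIV. of_real (k\<^sup>2) * kop (?R j l) (f l) x + of_real (- kronecker j l) * f l x) = ?u2 j x" for j x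
  proof -
    have "(\<Sum>l\<in>UNIV. complex_of_real (kronecker j l) * f l x) = (\<Sum>l\<in>UNIV. if j = l then f l x else 0)"
      by (intro sum.cong) (auto simp: kronecker_def)
    then show ?thesis by (simp add: skop_def sum.distrib sum_distrib_left sum_subtractf)
  qed
  ultimately have w2: "weak_deriv (?u1 j) (?u2 j)" for j unfolding skop_def by simp
  define b where "b = (\<lambda>l. \<integral>y. of_real (exp (- (k * y))) * f l y \<partial>halfline)"
  define p where "p = \<alpha> + real CARD('n) * k"
  have p: "0 < p" using \<alpha> k by (auto simp: p_def intro!: add_pos_pos mult_pos_pos)
  have R0: "kop (?R j l) (f l) 0 = b l / of_real p" for j l
  proof -
    have "kop (?R j l) (f l) 0 = (\<integral>y. of_real (1 / p) * (of_real (exp (- (k * y))) * f l y) \<partial>halfline)"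
      unfolding kop_def by (intro Bochner_Integration.integral_cong refl) (auto simp: resolvent_kernel_def p_def)
    then show ?thesis unfolding integral_mult_right_zero b_def by simp
  qed
  \<comment> \<open>At x = 0 the Dirichlet part has the derivative exp (-k y), present only for l =
    j, and the vertex part contributes -k/p times exp (-k y).\<close>
  have R10: "kop (?R1 j l) (f l) 0 = of_real (kronecker j l - k / p) * b l" for j l
  proof -
    have "kop (?R1 j l) (f l) 0 = (\<integral>y. of_real (kronecker j l - k / p) * (of_real (exp (- (k * y))) * f l y) \<partial>halfline)"
      unfolding kop_def by (intro Bochner_Integration.integral_cong refl)
        (auto simp: resolvent_kernel_deriv_def p_def left_diff_distrib)
    then show ?thesis unfolding integral_mult_right_zero b_def .
  qed
  \<comment> \<open>The Dirichlet part vanishes at x = 0, so the boundary value is the same on every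
    edge.\<close>
  define c where "c = (\<Sum>l\<in>UNIV. b l) / of_real p"
  have bv: "boundary_value (?u j) c" for j
  proof -
    have "boundary_value (?u j) (?u j 0)"
      using k by (intro boundary_value_skop[where C="3 / (2 * k)"] resolvent_kernel_borel resolvent_kernel_abs_le f)
        (use p in \<open>auto simp: resolvent_kernel_def[abs_def] p_def intro!: continuous_intros\<close>)
    then show ?thesis by (simp add: skop_def R0 c_def sum_divide_distrib)
  qed
  have u10: "?u1 j 0 = b j - of_real k * c" for j
  proof -
    have "?u1 j 0 = (\<Sum>l\<in>UNIV. (if j = l then b l else 0) - of_real (k / p) * b l)"
      unfolding skop_def R10 by (intro sum.cong refl) (auto simp: kronecker_def algebra_simps)
    then show ?thesis by (simp add: sum_subtractf c_def sum_distrib_left sum_divide_distrib)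
  qed
  have bv1: "boundary_value (?u1 j) (b j - of_real k * c)" for j
  proof -
    have "boundary_value (?u1 j) (?u1 j 0)"
    proof (intro boundary_value_skop[where C=2] resolvent_kernel_borel resolvent_kernel_deriv_abs_le f)
      fix j l :: 'n and x y :: real assume "x \<noteq> y"
      then show "isCont (\<lambda>x. ?R1 j l x y) x"
        unfolding resolvent_kernel_deriv_def p_def[symmetric] using p by (intro continuous_intros) auto
    qed auto
    then show ?thesis by (simp add: u10)
  qed
  \<comment> \<open>Vertex condition: the b_j add up to p c, and p c - N k c = \<alpha> c by the
    definition of p.\<close>
  have "(\<Sum>j\<in>UNIV. b j - of_real k * c) = of_real p * c - of_real (real CARD('n)) * (of_real k * c)"
    using p by (simp add: sum_subtractf c_def)
  also have "\<dots> = of_real \<alpha> * c" by (simp add: p_def algebra_simps)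
  finally have s: "(\<Sum>j\<in>UNIV. b j - of_real k * c) = of_real \<alpha> * c" .
  have eq: "star_eq (lin_comb f (- of_real (k\<^sup>2)) ?u) (\<lambda>j x. - ?u2 j x)"
    by (simp add: star_eq_def)
  show ?thesis
    unfolding star_H_def using u h u1 u2 w1 w2 bv bv1 s eq
    by (intro CollectI case_prodI conjI bexI[of _ ?u1] bexI[of _ ?u2] exI[of _ c] exI[of _ "\<lambda>j. b j - of_real k * c"]) blast+
qed

end

section \<open>The cylinder kernel\<close>

definition poisson :: "real \<Rightarrow> real \<Rightarrow> real" where
  "poisson t d = (t / pi) / (t\<^sup>2 + d\<^sup>2)"

text \<open>A mean of Poisson kernels over shifts s with the exponential density of rate a.
  \<open>exp_Ei_eq\<close> identifies it with the exponential integral term.\<close>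

definition robin_tail :: "real \<Rightarrow> real \<Rightarrow> real \<Rightarrow> real" where
  "robin_tail a t z = (\<integral>s. a * exp (- (a * s)) * poisson t (z + s) \<partial>halfline)"

text \<open>The claimed kernel with \<open>Ei\<close> replaced by a real average: in this form it
  can be estimated and obtained from the resolvent kernel.\<close>

definition cylinder :: "real \<Rightarrow> real \<Rightarrow> 'n::finite \<Rightarrow> 'n \<Rightarrow> real \<Rightarrow> real \<Rightarrow> real" where
  "cylinder \<alpha> t j l x y = kronecker j l * poisson t \<bar>x - y\<bar>
     + (2 / real CARD('n) - kronecker j l) * poisson t (x + y)
     - 2 / real CARD('n) * robin_tail (\<alpha> / real CARD('n)) t (x + y)"

section \<open>Estimates for the cylinder kernel\<close>

lemma poisson_borel [measurable]: "(\<lambda>x. poisson (f x) (g x)) \<in> borel_measurable M"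
  if [measurable]: "f \<in> borel_measurable M" "g \<in> borel_measurable M"
  unfolding poisson_def by measurable

lemma poisson_nonneg: "0 < t \<Longrightarrow> 0 \<le> poisson t d"
  unfolding poisson_def by (intro divide_nonneg_nonneg) auto

lemma poisson_antimono: "0 < t \<Longrightarrow> 0 \<le> d \<Longrightarrow> d \<le> d' \<Longrightarrow> poisson t d' \<le> poisson t d"
  unfolding poisson_def by (intro divide_left_mono add_mono power_mono mult_pos_pos add_pos_nonneg) auto

text \<open>The numerator at most doubles and the denominator shrinks at most to a quarter, hence 8.
  This provides one majorant for all times near t.\<close>

lemma poisson_comparable:
  assumes "0 < t" "t / 2 \<le> r" "r \<le> 2 * t"
  shows "poisson r d \<le> 8 * poisson t d"
proof -
  have "poisson r d \<le> (2 * t / pi) / ((t / 2)\<^sup>2 + (d / 2)\<^sup>2)"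
  proof -
    have "(t / 2)\<^sup>2 \<le> r\<^sup>2" using assms by (intro power_mono) auto
    moreover have "(d / 2)\<^sup>2 \<le> d\<^sup>2" by (simp add: power_divide)
    ultimately show ?thesis
      unfolding poisson_def using assms
      by (intro frac_le divide_right_mono add_mono add_pos_nonneg) auto
  qed
  also have "\<dots> = 8 * poisson t d"
    using assms by (simp add: poisson_def power_divide field_simps)
  finally show ?thesis .
qed

lemma nn_integral_poisson:
  assumes t: "0 < t"
  shows "(\<integral>\<^sup>+d. ennreal (poisson t d) \<partial>halfline) = ennreal (1 / 2)"
proof -
  have "ennreal (poisson t d) = ennreal (1 / pi) * ennreal (t / (t\<^sup>2 + d\<^sup>2))" for d
    using t by (subst ennreal_mult[symmetric]) (auto simp: poisson_def)
  then show ?thesis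
    using nn_integral_cauchy_halfline[OF t] by (simp add: nn_integral_cmult flip: ennreal_mult)
qed

text \<open>The weight a exp (-a s) is a probability density and the Poisson kernel decreases with
  distance, so an average over positive shifts cannot exceed the unshifted value.\<close>

lemma robin_tail_bounds:
  assumes a: "0 < a" and t: "0 < t" and z: "0 \<le> z"
  shows "integrable halfline (\<lambda>s. a * exp (- (a * s)) * poisson t (z + s))"
    and "0 \<le> robin_tail a t z" "robin_tail a t z \<le> poisson t z"
proof -
  have e: "integrable halfline (\<lambda>s. a * exp (- (a * s)) * poisson t z)"
    using integrable_exp_halfline[OF a] by simp
  have le: "a * exp (- (a * s)) * poisson t (z + s) \<le> a * exp (- (a * s)) * poisson t z" if "0 < s" for s
    using a that z by (intro mult_left_mono poisson_antimono t) auto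
  show i: "integrable halfline (\<lambda>s. a * exp (- (a * s)) * poisson t (z + s))"
  proof (rule Bochner_Integration.integrable_bound[OF e])
    show "AE s in halfline. norm (a * exp (- (a * s)) * poisson t (z + s)) \<le> norm (a * exp (- (a * s)) * poisson t z)"
      using AE_halfline_pos
      by eventually_elim (use le a poisson_nonneg[OF t] in \<open>simp add: abs_mult\<close>)
  qed measurable
  show "0 \<le> robin_tail a t z"
    unfolding robin_tail_def using a poisson_nonneg[OF t] by (intro integral_nonneg_AE AE_I2) auto
  have "robin_tail a t z \<le> (\<integral>s. a * exp (- (a * s)) * poisson t z \<partial>halfline)"
    unfolding robin_tail_def using le by (intro integral_mono i e) auto
  also have "\<dots> = poisson t z"
    using a integral_exp_halfline[OF a] by (simp add: mult.assoc)
  finally show "robin_tail a t z \<le> poisson t z" .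
qed

lemma robin_tail_borel: "(\<lambda>p. robin_tail a (fst p) (snd p)) \<in> borel_measurable (borel \<Otimes>\<^sub>M borel)"
proof -
  have "(\<lambda>(p, s). a * exp (- (a * s)) * poisson (fst p) (snd p + s)) \<in> borel_measurable ((borel \<Otimes>\<^sub>M borel) \<Otimes>\<^sub>M halfline)"
  proof -
    have [measurable]: "snd \<in> borel_measurable ((borel \<Otimes>\<^sub>M borel) \<Otimes>\<^sub>M halfline)"
      by (rule measurable_compose[OF measurable_snd id_halfline_borel])
    show ?thesis unfolding case_prod_unfold by measurable
  qed
  then show ?thesis
    unfolding robin_tail_def by (rule halfline.borel_measurable_lebesgue_integral)
qed

lemma cylinder_borel: "(\<lambda>(t, x, y). cylinder \<alpha> t j l x y) \<in> borel_measurable (borel \<Otimes>\<^sub>M (borel \<Otimes>\<^sub>M borel))"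
proof -
  have [measurable]: "(\<lambda>p. robin_tail a (f p) (g p)) \<in> borel_measurable M"
    if "f \<in> borel_measurable M" "g \<in> borel_measurable M" for f g a and M :: "(real \<times> real \<times> real) measure"
    using measurable_compose[OF measurable_Pair[OF that] robin_tail_borel] by simp
  show ?thesis unfolding cylinder_def case_prod_unfold by measurable
qed

lemma cylinder_borel_pair: "case_prod (cylinder \<alpha> t j l) \<in> borel_measurable (borel \<Otimes>\<^sub>M borel)"
  using measurable_compose[OF measurable_Pair1'[of t borel "borel \<Otimes>\<^sub>M borel"] cylinder_borel[of \<alpha> j l]]
  by (simp add: case_prod_unfold)

text \<open>The three terms contribute 1 + 2 + 2, each compared with the Poisson kernel at |x - y|
  \<le> x + y.\<close>

lemma cylinder_abs_le:
  fixes j l :: "'n::finite"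
  assumes \<alpha>: "0 < \<alpha>" and t: "0 < t" and x: "0 \<le> x" and y: "0 < y"
  shows "\<bar>cylinder \<alpha> t j l x y\<bar> \<le> 5 * poisson t \<bar>x - y\<bar>"
proof -
  let ?N = "real CARD('n)" and ?P = "poisson t \<bar>x - y\<bar>"
  let ?T = "robin_tail (\<alpha> / ?N) t (x + y)"
  have N: "1 \<le> ?N" by (simp add: Suc_leI)
  have P0: "0 \<le> ?P" by (rule poisson_nonneg[OF t])
  have Z: "0 \<le> poisson t (x + y)" "poisson t (x + y) \<le> ?P"
    using x y by (auto intro!: poisson_nonneg poisson_antimono t)
  have T: "0 \<le> ?T" "?T \<le> ?P"
    using robin_tail_bounds(2,3)[of "\<alpha> / ?N" t "x + y"] \<alpha> t x y N Z by auto
  have 1: "\<bar>kronecker j l * ?P\<bar> \<le> ?P" using kronecker_cases[of j l] P0 by auto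
  have N2: "0 \<le> 2 / ?N" "2 / ?N \<le> 2" using N by (auto simp: divide_le_eq)
  then have "\<bar>2 / ?N - kronecker j l\<bar> \<le> 2"
    using kronecker_cases[of j l] by (elim disjE; simp only: abs_le_iff; linarith)
  then have 2: "\<bar>(2 / ?N - kronecker j l) * poisson t (x + y)\<bar> \<le> 2 * ?P"
    unfolding abs_mult using Z by (intro mult_mono) auto
  have 3: "\<bar>2 / ?N * ?T\<bar> \<le> 2 * ?P"
    unfolding abs_mult using T N2 by (intro mult_mono) auto
  show ?thesis unfolding cylinder_def using 1 2 3 by linarith
qed

lemma dominated_kernel_poisson:
  assumes t: "0 < t" and "case_prod K \<in> borel_measurable (borel \<Otimes>\<^sub>M borel)" "0 \<le> C"
    and "\<And>x y. 0 < x \<Longrightarrow> 0 < y \<Longrightarrow> \<bar>K x y\<bar> \<le> C * poisson t \<bar>x - y\<bar>"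
  shows "dominated_kernel K (\<lambda>d. C * poisson t d) C (C * poisson t 0)"
proof
  show "2 * (\<integral>\<^sup>+d. ennreal (C * poisson t d) \<partial>halfline) \<le> ennreal C"
  proof -
    have "(\<integral>\<^sup>+d. ennreal (C * poisson t d) \<partial>halfline) = ennreal C * (\<integral>\<^sup>+d. ennreal (poisson t d) \<partial>halfline)"
      using t assms(3) by (simp add: ennreal_mult poisson_nonneg nn_integral_cmult)
    also have "\<dots> = ennreal (C / 2)"
      unfolding nn_integral_poisson[OF t] using assms(3) by (subst ennreal_mult[symmetric]) auto
    finally have "(\<integral>\<^sup>+d. ennreal (C * poisson t d) \<partial>halfline) = ennreal (C / 2)" .
    then show ?thesis using ennreal_mult[of 2 "C / 2"] assms(3) by (simp only: ennreal_numeral) simp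
  qed
  show "C * poisson t d \<le> C * poisson t 0" if "0 \<le> d" for d
    using poisson_antimono[OF t, of 0 d] that assms(3) by (intro mult_left_mono) auto
qed (use assms in auto)

text \<open>The Poisson kernel has mass 1/2 on the half-line for every t, so the operator constant 5
  is uniform in t. The family can therefore be integrated down to time 0.\<close>

lemma dominated_cylinder:
  assumes "0 < \<alpha>" "0 < t"
  shows "dominated_kernel (cylinder \<alpha> t j l) (\<lambda>d. 5 * poisson t d) 5 (5 * poisson t 0)"
  by (intro dominated_kernel_poisson cylinder_borel_pair cylinder_abs_le assms) auto

text \<open>Write a/(a + k) as the integral of a exp (-(a + k) s) and exchange. The k-integral is
  then the damped sine integral with z + s in place of z.\<close>

lemma integral_sin_exp_div:
  assumes a: "0 < a" and z: "0 < z"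
  shows "(\<integral>k. sin (k * t) * exp (- (z * k)) * (a / (a + k)) \<partial>halfline) = pi * robin_tail a t z"
    and "integrable halfline (\<lambda>k. sin (k * t) * exp (- (z * k)) * (a / (a + k)))"
proof -
  let ?h = "\<lambda>k s. sin (k * t) * exp (- (z * k)) * (a * exp (- ((a + k) * s)))"
  show "integrable halfline (\<lambda>k. sin (k * t) * exp (- (z * k)) * (a / (a + k)))"
  proof (rule Bochner_Integration.integrable_bound[OF integrable_sin_exp_halfline[OF z, of t]])
    show "AE k in halfline. norm (sin (k * t) * exp (- (z * k)) * (a / (a + k))) \<le> norm (sin (k * t) * exp (- (z * k)))"
      using AE_halfline_pos unfolding norm_mult[of _ "a / (a + _)"] by eventually_elim (intro mult_left_le, use a in auto)
  qed measurable
  have int: "integrable (halfline \<Otimes>\<^sub>M halfline) (\<lambda>(k, s). ?h k s)"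
  proof (rule Bochner_Integration.integrable_bound)
    show "integrable (halfline \<Otimes>\<^sub>M halfline) (\<lambda>(k, s). exp (- (z * k)) * (a * exp (- (a * s))))"
    proof (rule halfline_pair.Fubini_integrable)
      show "integrable halfline (\<lambda>x. \<integral>y. norm (case (x, y) of (k, s) \<Rightarrow> exp (- (z * k)) * (a * exp (- (a * s)))) \<partial>halfline)"
        using a integrable_exp_halfline[OF z] by (simp add: abs_mult)
      show "AE x in halfline. integrable halfline (\<lambda>y. case (x, y) of (k, s) \<Rightarrow> exp (- (z * k)) * (a * exp (- (a * s))))"
        using integrable_exp_halfline[OF a] by (intro AE_I2) simp
    qed (rule measurable_borel_halfline(3)[OF refl], measurable)
    show "AE p in halfline \<Otimes>\<^sub>M halfline. norm (case p of (k, s) \<Rightarrow> ?h k s) \<le> norm (case p of (k, s) \<Rightarrow> exp (- (z * k)) * (a * exp (- (a * s))))"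
    proof (rule AE_I2)
      fix p assume "p \<in> space (halfline \<Otimes>\<^sub>M halfline)"
      then obtain k s where p: "p = (k, s)" "0 < k" "0 < s" by (auto simp: space_pair_measure)
      have "\<bar>sin (k * t)\<bar> * exp (- (z * k)) * (a * exp (- ((a + k) * s))) \<le> 1 * exp (- (z * k)) * (a * exp (- (a * s)))"
        using p a by (intro mult_mono) (auto simp: distrib_right)
      then show "norm (case p of (k, s) \<Rightarrow> ?h k s) \<le> norm (case p of (k, s) \<Rightarrow> exp (- (z * k)) * (a * exp (- (a * s))))"
        using p a by (simp add: abs_mult)
    qed
  qed (rule measurable_borel_halfline(3)[OF refl], measurable)
  have "(\<integral>k. sin (k * t) * exp (- (z * k)) * (a / (a + k)) \<partial>halfline) = (\<integral>k. (\<integral>s. ?h k s \<partial>halfline) \<partial>halfline)"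
  proof (intro Bochner_Integration.integral_cong refl)
    fix k assume "k \<in> space halfline"
    then have "0 < a + k" using a by simp
    then show "sin (k * t) * exp (- (z * k)) * (a / (a + k)) = (\<integral>s. ?h k s \<partial>halfline)"
      by (simp add: integral_exp_halfline)
  qed
  also have "\<dots> = (\<integral>s. (\<integral>k. ?h k s \<partial>halfline) \<partial>halfline)"
    using halfline_pair.Fubini_integral[of ?h] int by simp
  also have "\<dots> = (\<integral>s. pi * (a * exp (- (a * s)) * poisson t (z + s)) \<partial>halfline)"
  proof (intro Bochner_Integration.integral_cong refl)
    fix s assume "s \<in> space halfline"
    then have "0 < z + s" using z by simp
    have "?h k s = a * exp (- (a * s)) * (sin (k * t) * exp (- ((z + s) * k)))" for k
      by (simp add: algebra_simps flip: exp_add)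
    then have "(\<integral>k. ?h k s \<partial>halfline) = a * exp (- (a * s)) * (\<integral>k. sin (k * t) * exp (- ((z + s) * k)) \<partial>halfline)"
      by (simp only: integral_mult_right_zero)
    then show "(\<integral>k. ?h k s \<partial>halfline) = pi * (a * exp (- (a * s)) * poisson t (z + s))"
      using \<open>0 < z + s\<close> by (simp add: integral_sin_exp_halfline poisson_def)
  qed
  finally show "(\<integral>k. sin (k * t) * exp (- (z * k)) * (a / (a + k)) \<partial>halfline) = pi * robin_tail a t z"
    by (simp add: robin_tail_def)
qed

text \<open>Off the diagonal the factor exp (-k |x - y|) gives absolute convergence, and the factor
  k cancels the 1/(2 k) of the Dirichlet part. What remains are damped sine integrals at |x - y| and
  x + y, and one with the extra factor a/(a + k).\<close>

lemma cylinder_eq_sine_transform: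
  fixes j l :: "'n::finite"
  assumes \<alpha>: "0 < \<alpha>" and x: "0 < x" and y: "0 < y" and xy: "x \<noteq> y"
  shows "(\<integral>k. sin (k * t) * (k * resolvent_kernel \<alpha> k j l x y) \<partial>halfline) = pi / 2 * cylinder \<alpha> t j l x y"
proof -
  let ?N = "real CARD('n)" and ?d = "\<bar>x - y\<bar>" and ?z = "x + y"
  let ?a = "\<alpha> / ?N"
  let ?S = "\<lambda>c k. sin (k * t) * exp (- (c * k))"
  have N: "0 < ?N" by simp
  have a: "0 < ?a" using \<alpha> N by simp
  have d: "0 < ?d" and z: "0 < ?z" using x y xy by auto
  have S: "(\<integral>k. ?S c k \<partial>halfline) = pi * poisson t c" if "0 < c" for c
    using integral_sin_exp_halfline[OF that] by (simp add: poisson_def)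
  note i = integrable_sin_exp_halfline[OF d, of t] integrable_sin_exp_halfline[OF z, of t] integral_sin_exp_div(2)[OF a z, of t]
  have "(\<integral>k. sin (k * t) * (k * resolvent_kernel \<alpha> k j l x y) \<partial>halfline) =
    (\<integral>k. kronecker j l / 2 * (?S ?d k - ?S ?z k) + 1 / ?N * (?S ?z k - ?S ?z k * (?a / (?a + k))) \<partial>halfline)"
  proof (intro Bochner_Integration.integral_cong refl)
    fix k assume "k \<in> space halfline"
    then have k: "0 < k" by simp
    have p: "0 < \<alpha> + ?N * k" "0 < ?a + k" using \<alpha> k N a by (auto intro!: add_pos_pos)
    have q: "k / (\<alpha> + ?N * k) = 1 / ?N * (1 - ?a / (?a + k))"
      using p N by (simp add: field_simps)
    have e: "k * resolvent_kernel \<alpha> k j l x y = kronecker j l / 2 * (exp (- (?d * k)) - exp (- (?z * k)))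
       + k / (\<alpha> + ?N * k) * exp (- (?z * k))"
      using k by (simp add: resolvent_kernel_def distrib_left mult.commute)
    show "sin (k * t) * (k * resolvent_kernel \<alpha> k j l x y) =
      kronecker j l / 2 * (?S ?d k - ?S ?z k) + 1 / ?N * (?S ?z k - ?S ?z k * (?a / (?a + k)))"
      unfolding e q by (simp only: distrib_left right_diff_distrib mult_1_right mult_ac)
  qed
  also have "\<dots> = kronecker j l / 2 * ((\<integral>k. ?S ?d k \<partial>halfline) - (\<integral>k. ?S ?z k \<partial>halfline)) +
      1 / ?N * ((\<integral>k. ?S ?z k \<partial>halfline) - (\<integral>k. ?S ?z k * (?a / (?a + k)) \<partial>halfline))"
    using i by (simp only: Bochner_Integration.integral_add Bochner_Integration.integral_diff
      Bochner_Integration.integrable_diff integrable_mult_right integral_mult_right_zero)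
  also have "\<dots> = pi / 2 * cylinder \<alpha> t j l x y"
    unfolding S[OF d] S[OF z] integral_sin_exp_div(1)[OF a z] cylinder_def by (simp add: field_simps)
  finally show ?thesis .
qed

section \<open>Integration and continuity in the time variable\<close>

lemma integral_sin_interval:
  assumes t: "0 < t" and k: "0 < k"
  shows "(\<integral>\<tau>. indicator {..<t} \<tau> * sin (k * \<tau>) \<partial>halfline) = (1 - cos (k * t)) / k"
proof -
  have "(\<integral>\<tau>. sin (k * \<tau>) * indicator {0..t} \<tau> \<partial>lborel) = (- cos (k * t) / k) - (- cos (k * 0) / k)"
    using t k by (intro integral_FTC_Icc_real) (auto intro!: derivative_eq_intros continuous_intros)
  moreover have "(\<integral>\<tau>. indicator {..<t} \<tau> * sin (k * \<tau>) \<partial>halfline) = (\<integral>\<tau>. sin (k * \<tau>) * indicator {0..t} \<tau> \<partial>lborel)"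
    unfolding integral_halfline
  proof (intro Bochner_Integration.integral_cong_AE)
    show "AE \<tau> in lborel. indicator {0<..} \<tau> *\<^sub>R (indicator {..<t} \<tau> * sin (k * \<tau>)) = sin (k * \<tau>) * indicator {0..t} \<tau>"
      using AE_lborel_singleton[of 0] AE_lborel_singleton[of t] by eventually_elim (auto split: split_indicator)
  qed measurable
  ultimately show ?thesis by (simp add: diff_divide_distrib)
qed

lemma resolvent_kernel_k_le:
  assumes "0 < \<alpha>" "0 < k" "0 < x" "0 < y"
  shows "\<bar>k * resolvent_kernel \<alpha> k j l x y\<bar> \<le> 3 / 2 * exp (- (\<bar>x - y\<bar> * k))"
proof -
  have "k * \<bar>resolvent_kernel \<alpha> k j l x y\<bar> \<le> k * (3 / (2 * k) * exp (- (k * \<bar>x - y\<bar>)))"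
    using assms by (intro mult_left_mono resolvent_kernel_abs_le) auto
  then show ?thesis using assms by (simp add: abs_mult mult.commute)
qed

lemma resolvent_kernel_borel_k: "(\<lambda>k. resolvent_kernel \<alpha> k j l x y) \<in> borel_measurable borel"
  unfolding resolvent_kernel_def by measurable

text \<open>Integrate the sine transform over \<tau> < t: k sin (k \<tau>) becomes 1 - cos (k t).
  The exponential decay in k off the diagonal justifies the exchange.\<close>

lemma integral_cylinder_eq:
  fixes j l :: "'n::finite"
  assumes \<alpha>: "0 < \<alpha>" and t: "0 < t" and x: "0 < x" and y: "0 < y" and xy: "x \<noteq> y"
  shows "(\<integral>k. (1 - cos (k * t)) * resolvent_kernel \<alpha> k j l x y \<partial>halfline) =
     pi / 2 * (\<integral>\<tau>. indicator {..<t} \<tau> * cylinder \<alpha> \<tau> j l x y \<partial>halfline)"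
proof -
  let ?r = "\<lambda>k. k * resolvent_kernel \<alpha> k j l x y"
  let ?h = "\<lambda>\<tau> k. indicator {..<t} \<tau> * (sin (k * \<tau>) * ?r k)"
  have d: "0 < \<bar>x - y\<bar>" using xy by simp
  have [measurable]: "(\<lambda>k. resolvent_kernel \<alpha> k j l x y) \<in> borel_measurable borel" by (rule resolvent_kernel_borel_k)
  note ind = integrable_indicator_lessThan_halfline[of t]
  have int: "integrable (halfline \<Otimes>\<^sub>M halfline) (\<lambda>(\<tau>, k). ?h \<tau> k)"
  proof (rule Bochner_Integration.integrable_bound)
    show "integrable (halfline \<Otimes>\<^sub>M halfline) (\<lambda>(\<tau>, k). indicator {..<t} \<tau> * (3 / 2 * exp (- (\<bar>x - y\<bar> * k))))"
    proof (rule halfline_pair.Fubini_integrable)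
      show "integrable halfline (\<lambda>\<tau>. \<integral>k. norm (case (\<tau>, k) of (\<tau>, k) \<Rightarrow> indicator {..<t} \<tau> * (3 / 2 * exp (- (\<bar>x - y\<bar> * k)))) \<partial>halfline)"
        using ind by (simp add: abs_mult)
      show "AE \<tau> in halfline. integrable halfline (\<lambda>k. case (\<tau>, k) of (\<tau>, k) \<Rightarrow> indicator {..<t} \<tau> * (3 / 2 * exp (- (\<bar>x - y\<bar> * k))))"
        using integrable_exp_halfline[OF d] by (intro AE_I2) simp
    qed (rule measurable_borel_halfline(3)[OF refl], measurable)
    show "AE p in halfline \<Otimes>\<^sub>M halfline. norm (case p of (\<tau>, k) \<Rightarrow> ?h \<tau> k) \<le>
        norm (case p of (\<tau>, k) \<Rightarrow> indicator {..<t} \<tau> * (3 / 2 * exp (- (\<bar>x - y\<bar> * k))))"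
    proof (rule AE_I2)
      fix p assume "p \<in> space (halfline \<Otimes>\<^sub>M halfline)"
      then obtain \<tau> k where p: "p = (\<tau>, k)" "0 < k" by (auto simp: space_pair_measure)
      have "\<bar>sin (k * \<tau>)\<bar> * \<bar>?r k\<bar> \<le> 1 * (3 / 2 * exp (- (\<bar>x - y\<bar> * k)))"
        using resolvent_kernel_k_le[OF \<alpha> p(2) x y, of j l] by (intro mult_mono) auto
      then show "norm (case p of (\<tau>, k) \<Rightarrow> ?h \<tau> k) \<le>
        norm (case p of (\<tau>, k) \<Rightarrow> indicator {..<t} \<tau> * (3 / 2 * exp (- (\<bar>x - y\<bar> * k))))"
        using p by (auto simp: abs_mult split: split_indicator)
    qed
  qed (rule measurable_borel_halfline(3)[OF refl], measurable)
  have "(\<integral>k. (1 - cos (k * t)) * resolvent_kernel \<alpha> k j l x y \<partial>halfline) = (\<integral>k. (\<integral>\<tau>. ?h \<tau> k \<partial>halfline) \<partial>halfline)"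
  proof (intro Bochner_Integration.integral_cong refl)
    fix k assume "k \<in> space halfline"
    then have k: "0 < k" by simp
    have "(\<integral>\<tau>. ?h \<tau> k \<partial>halfline) = (\<integral>\<tau>. indicator {..<t} \<tau> * sin (k * \<tau>) \<partial>halfline) * ?r k"
      by (simp only: integral_mult_left_zero flip: mult.assoc)
    then show "(1 - cos (k * t)) * resolvent_kernel \<alpha> k j l x y = (\<integral>\<tau>. ?h \<tau> k \<partial>halfline)"
      using k by (simp add: integral_sin_interval[OF t k])
  qed
  also have "\<dots> = (\<integral>\<tau>. (\<integral>k. ?h \<tau> k \<partial>halfline) \<partial>halfline)"
    using halfline_pair.Fubini_integral[of ?h] int by simp
  also have "\<dots> = (\<integral>\<tau>. pi / 2 * (indicator {..<t} \<tau> * cylinder \<alpha> \<tau> j l x y) \<partial>halfline)"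
    unfolding integral_mult_right_zero cylinder_eq_sine_transform[OF \<alpha> x y xy] by (simp add: mult_ac)
  finally show ?thesis unfolding integral_mult_right_zero .
qed

text \<open>In the sine transform the time enters only through sin (k t), so dominated convergence
  with the bound of \<open>resolvent_kernel_k_le\<close> settles all terms at once.\<close>

lemma isCont_cylinder:
  fixes j l :: "'n::finite"
  assumes \<alpha>: "0 < \<alpha>" and x: "0 < x" and y: "0 < y" and xy: "x \<noteq> y" and lim: "T \<longlonglongrightarrow> t"
  shows "(\<lambda>n. cylinder \<alpha> (T n) j l x y) \<longlonglongrightarrow> cylinder \<alpha> t j l x y"
proof -
  have d: "0 < \<bar>x - y\<bar>" using xy by simp
  have [measurable]: "(\<lambda>k. resolvent_kernel \<alpha> k j l x y) \<in> borel_measurable borel" by (rule resolvent_kernel_borel_k)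
  have "(\<lambda>n. \<integral>k. sin (k * T n) * (k * resolvent_kernel \<alpha> k j l x y) \<partial>halfline) \<longlonglongrightarrow>
     (\<integral>k. sin (k * t) * (k * resolvent_kernel \<alpha> k j l x y) \<partial>halfline)"
  proof (rule integral_dominated_convergence)
    show "integrable halfline (\<lambda>k. 3 / 2 * exp (- (\<bar>x - y\<bar> * k)))"
      using integrable_exp_halfline[OF d] by simp
    show "AE k in halfline. (\<lambda>n. sin (k * T n) * (k * resolvent_kernel \<alpha> k j l x y)) \<longlonglongrightarrow> sin (k * t) * (k * resolvent_kernel \<alpha> k j l x y)"
      by (intro AE_I2 tendsto_intros lim)
    show "AE k in halfline. norm (sin (k * T n) * (k * resolvent_kernel \<alpha> k j l x y)) \<le> 3 / 2 * exp (- (\<bar>x - y\<bar> * k))" for n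
      using AE_halfline_pos
    proof eventually_elim
      case (elim k)
      have "\<bar>sin (k * T n)\<bar> * \<bar>k * resolvent_kernel \<alpha> k j l x y\<bar> \<le> 1 * (3 / 2 * exp (- (\<bar>x - y\<bar> * k)))"
        using resolvent_kernel_k_le[OF \<alpha> elim x y, of j l] by (intro mult_mono) auto
      then show ?case by (simp add: abs_mult)
    qed
  qed measurable
  then have "(\<lambda>n. 2 / pi * (pi / 2 * cylinder \<alpha> (T n) j l x y)) \<longlonglongrightarrow> 2 / pi * (pi / 2 * cylinder \<alpha> t j l x y)"
    unfolding cylinder_eq_sine_transform[OF \<alpha> x y xy] by (rule tendsto_mult_left)
  moreover have "2 / pi * (pi / 2 * c) = c" for c :: real by simp
  ultimately show ?thesis by (simp only:)
qed

section \<open>Reduction of the exponential integral\<close>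

lemma integral_halfline_scale:
  fixes f :: "real \<Rightarrow> real"
  assumes a: "0 < a"
  shows "(\<integral>r. f r \<partial>halfline) = a * (\<integral>s. f (a * s) \<partial>halfline)"
proof -
  have "indicator {0<..} (a * s) = (indicator {0<..} s :: real)" for s
    using a by (auto split: split_indicator simp: zero_less_mult_iff)
  then show ?thesis
    unfolding integral_halfline using a
    by (subst lborel_integral_real_affine[where c=a and t=0]) auto
qed

text \<open>With \<zeta> = a z - i a t, multiplying by exp \<zeta> turns the integrand of
  \<open>Ei (- \<zeta>)\<close> into exp (-r)/(\<zeta> + r). Its imaginary part is exp (-r) times a
  Poisson kernel up to constants, and r = a s gives the shape of \<open>robin_tail\<close>.\<close>

lemma exp_Ei_eq:
  assumes a: "0 < a" and t: "0 < t" and z: "0 < z"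
  shows "exp (a * z) * Im (exp (- \<i> * of_real (a * t)) * Ei (\<i> * of_real (a * t) - of_real (a * z))) =
    - (pi / a) * robin_tail a t z"
proof -
  define \<zeta> where "\<zeta> = complex_of_real (a * z) - \<i> * of_real (a * t)"
  let ?g = "\<lambda>r. exp (- (\<zeta> + of_real r)) / (\<zeta> + of_real r)"
  have at: "0 < a * t" using a t by simp
  have n: "a * t \<le> cmod (\<zeta> + of_real r)" for r
    using abs_Im_le_cmod[of "\<zeta> + of_real r"] at by (simp add: \<zeta>_def)
  have nz: "\<zeta> + of_real r \<noteq> 0" for r using n[of r] at by auto
  have [measurable]: "complex_of_real \<in> borel_measurable halfline"
    by (rule borel_measurable_halflineI) simp
  have "exp \<zeta> * Ei (- \<zeta>) = - (\<integral>r. exp \<zeta> * ?g r \<partial>halfline)"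
    unfolding Ei_def integral_mult_right_zero by simp
  also have "(\<lambda>r. exp \<zeta> * ?g r) = (\<lambda>r. of_real (exp (- r)) / (\<zeta> + of_real r))"
  proof
    fix r
    have "exp \<zeta> * exp (- (\<zeta> + of_real r)) = of_real (exp (- r))"
      by (simp add: exp_of_real[symmetric] flip: exp_add)
    then show "exp \<zeta> * ?g r = of_real (exp (- r)) / (\<zeta> + of_real r)"
      by (simp only: times_divide_eq_right)
  qed
  finally have 1: "exp \<zeta> * Ei (- \<zeta>) = - (\<integral>r. of_real (exp (- r)) / (\<zeta> + of_real r) \<partial>halfline)" .
  have int: "integrable halfline (\<lambda>r. of_real (exp (- r)) / (\<zeta> + of_real r))"
  proof (rule Bochner_Integration.integrable_bound)
    show "integrable halfline (\<lambda>r. exp (- (1 * r)) / (a * t))"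
      using integrable_exp_halfline[of 1] by simp
    show "AE r in halfline. norm (of_real (exp (- r)) / (\<zeta> + of_real r)) \<le> norm (exp (- (1 * r)) / (a * t))"
      using n at by (intro AE_I2) (simp add: norm_divide frac_le)
    show "(\<lambda>r. of_real (exp (- r)) / (\<zeta> + of_real r)) \<in> borel_measurable halfline"
      by (rule borel_measurable_halflineI) measurable
  qed
  have "Im (of_real (exp (- r)) / (\<zeta> + of_real r)) = exp (- r) * (a * t) / ((a * z + r)\<^sup>2 + (a * t)\<^sup>2)" for r
    using nz[of r] by (simp add: \<zeta>_def Im_divide power2_eq_square)
  then have "Im (exp \<zeta> * Ei (- \<zeta>)) = - (\<integral>r. exp (- r) * (a * t) / ((a * z + r)\<^sup>2 + (a * t)\<^sup>2) \<partial>halfline)"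
    unfolding 1 using integral_Im[OF int] by simp
  also have "(\<integral>r. exp (- r) * (a * t) / ((a * z + r)\<^sup>2 + (a * t)\<^sup>2) \<partial>halfline) =
     a * (\<integral>s. exp (- (a * s)) * (a * t) / ((a * z + a * s)\<^sup>2 + (a * t)\<^sup>2) \<partial>halfline)"
    by (rule integral_halfline_scale[OF a])
  also have "(\<lambda>s. exp (- (a * s)) * (a * t) / ((a * z + a * s)\<^sup>2 + (a * t)\<^sup>2)) =
     (\<lambda>s. pi / a\<^sup>2 * (a * exp (- (a * s)) * poisson t (z + s)))"
  proof
    fix s
    have e: "(a * z + a * s)\<^sup>2 + (a * t)\<^sup>2 = a\<^sup>2 * (t\<^sup>2 + (z + s)\<^sup>2)"
      by (simp add: power2_eq_square algebra_simps)
    have p: "0 < t\<^sup>2 + (z + s)\<^sup>2" using t by (simp add: add_pos_nonneg)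
    show "exp (- (a * s)) * (a * t) / ((a * z + a * s)\<^sup>2 + (a * t)\<^sup>2) = pi / a\<^sup>2 * (a * exp (- (a * s)) * poisson t (z + s))"
    proof -
      have "exp (- (a * s)) * (a * t) / (a\<^sup>2 * q) = pi / a\<^sup>2 * (a * exp (- (a * s)) * (t / pi / q))" if "0 < q" for q
        using a that by (simp add: field_simps)
      from this[OF p] show ?thesis unfolding e poisson_def .
    qed
  qed
  finally have 2: "Im (exp \<zeta> * Ei (- \<zeta>)) = - (pi / a) * robin_tail a t z"
    unfolding integral_mult_right_zero robin_tail_def[symmetric] using a by (simp add: power2_eq_square)
  have "exp \<zeta> = of_real (exp (a * z)) * exp (- \<i> * of_real (a * t))"
    by (simp add: \<zeta>_def exp_diff exp_minus exp_of_real[symmetric] field_simps)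
  moreover have "- \<zeta> = \<i> * of_real (a * t) - of_real (a * z)" by (simp add: \<zeta>_def)
  ultimately show ?thesis using 2 by (simp add: mult.assoc)
qed

lemma star_cylinder_kernel_eq:
  fixes j l :: "'n::finite"
  assumes "0 < \<alpha>" "0 < t" "0 < x" "0 < y"
  shows "star_cylinder_kernel \<alpha> t j l x y = cylinder \<alpha> t j l x y"
proof -
  let ?N = "real CARD('n)"
  have N: "0 < ?N" by simp
  have "exp (\<alpha> * (x + y) / ?N) * Im (exp (- \<i> * of_real (\<alpha> * t / ?N))
                * Ei (\<i> * of_real (\<alpha> * t / ?N) - of_real (\<alpha> / ?N * (x + y)))) =
     - (pi / (\<alpha> / ?N)) * robin_tail (\<alpha> / ?N) t (x + y)"
    using exp_Ei_eq[of "\<alpha> / ?N" t "x + y"] assms N by simp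
  \<comment> \<open>The prefactor 2 \<alpha>/(pi N^2) times -pi N/\<alpha> is -2/N, the coefficient
    in \<open>cylinder\<close>.\<close>
  then show ?thesis
    unfolding star_cylinder_kernel_def cylinder_def poisson_def Let_def mult.assoc
    using assms N by (simp add: power2_eq_square)
qed

section \<open>Identification of the cylinder kernel\<close>

lemma kop_scale: "kop (\<lambda>x y. c * K x y) f x = of_real c * kop K f x"
  unfolding kop_def by (simp add: mult.assoc)

lemma form_scale:
  "(\<integral>x. cnj (v x) * kop (\<lambda>x y. c * K x y) w x \<partial>halfline) = of_real c * (\<integral>x. cnj (v x) * kop K w x \<partial>halfline)"
  unfolding kop_scale by (subst integral_mult_right_zero[symmetric]) (simp add: mult.left_commute)

lemma dominated_kernel_scale:
  assumes "dominated_kernel K q c Q" "0 \<le> b"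
  shows "dominated_kernel (\<lambda>x y. b * K x y) (\<lambda>d. b * q d) (b * c) (b * Q)"
proof -
  interpret dominated_kernel K q c Q by fact
  show ?thesis
  proof
    show "(\<lambda>(x, y). b * K x y) \<in> borel_measurable (borel \<Otimes>\<^sub>M borel)"
      using K_borel by (simp add: case_prod_unfold)
    show "b * q d \<le> b * Q" if "0 \<le> d" for d using q_le[OF that] assms(2) by (rule mult_left_mono)
    show "\<bar>b * K x y\<bar> \<le> b * q \<bar>x - y\<bar>" if "0 < x" "0 < y" for x y
      using K_le[OF that] assms(2) by (simp add: abs_mult mult_left_mono)
    have "2 * (\<integral>\<^sup>+d. ennreal (b * q d) \<partial>halfline) = ennreal b * (2 * (\<integral>\<^sup>+d. ennreal (q d) \<partial>halfline))"
      using assms(2) by (simp add: ennreal_mult' nn_integral_cmult mult_ac)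
    also have "\<dots> \<le> ennreal b * ennreal c" using q_int by (rule mult_left_mono) simp
    finally show "2 * (\<integral>\<^sup>+d. ennreal (b * q d) \<partial>halfline) \<le> ennreal (b * c)"
      using assms(2) by (simp add: ennreal_mult')
  qed (use assms(2) c_nonneg in auto)
qed

lemma star_inner_skop:
  assumes K: "\<And>j l. dominated_kernel (K j l) q c Q" and f: "f \<in> star_L2" and g: "g \<in> star_L2"
  shows "star_inner g (skop K f) = (\<Sum>j\<in>UNIV. \<Sum>l\<in>UNIV. \<integral>x. cnj (g j x) * kop (K j l) (f l) x \<partial>halfline)"
proof -
  have f': "f l \<in> hL2" and g': "g l \<in> hL2" for l using f g by (auto simp: star_L2_iff)
  have "integrable halfline (\<lambda>x. cnj (g j x) * kop (K j l) (f l) x)" for j l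
    by (intro hL2_mult_integrable g' dominated_kernel.kop_hL2[OF K f'])
  then show ?thesis by (simp add: star_inner_def skop_def sum_distrib_left)
qed

lemma AE_halfline_pair_neq: "AE p in halfline \<Otimes>\<^sub>M halfline. 0 < fst p \<and> 0 < snd p \<and> fst p \<noteq> snd p"
proof -
  have "AE p in halfline \<Otimes>\<^sub>M halfline. (\<lambda>x y. x \<noteq> y) (fst p) (snd p)"
  proof (rule halfline_pair.AE_pair_measure)
    show "{p \<in> space (halfline \<Otimes>\<^sub>M halfline). fst p \<noteq> snd p} \<in> sets (halfline \<Otimes>\<^sub>M halfline)"
    proof -
      have "Measurable.pred (halfline \<Otimes>\<^sub>M halfline) (\<lambda>p. fst p \<noteq> (snd p :: real))"
        by (rule measurable_borel_halfline(3)[OF refl]) measurable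
      then show ?thesis by (simp add: pred_def)
    qed
    show "AE x in halfline. AE y in halfline. fst (x, y) \<noteq> snd (x, y)"
      using AE_halfline_neq by (auto intro!: AE_I2 simp: eq_commute)
  qed
  moreover have "AE p in halfline \<Otimes>\<^sub>M halfline. 0 < fst p \<and> 0 < snd p"
    by (rule AE_I2) (auto simp: space_pair_measure)
  ultimately show ?thesis by eventually_elim auto
qed

lemma integrable_one_minus_cos:
  assumes t: "0 < t"
  shows "integrable halfline (\<lambda>k. (1 - cos (k * t)) / k\<^sup>2)"
proof (rule integrableI_nonneg)
  have "(\<integral>\<^sup>+k. ennreal ((1 - cos (k * t)) / k\<^sup>2) \<partial>halfline) =
      ennreal (pi / 2) * (\<integral>\<^sup>+z. ennreal (indicator {..<t} z) \<partial>halfline)"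
    using nn_integral_one_minus_cos[of 0 t] t by (simp add: ennreal_indicator)
  moreover have "(\<integral>\<^sup>+z. ennreal (indicator {..<t} z) \<partial>halfline) < \<infinity>"
    using integrable_indicator_lessThan_halfline[of t] by (subst nn_integral_eq_integral) auto
  ultimately show "(\<integral>\<^sup>+k. ennreal ((1 - cos (k * t)) / k\<^sup>2) \<partial>halfline) < \<infinity>"
    by (simp only: ennreal_mult_less_top infinity_ennreal_def ennreal_less_top simp_thms)
qed (auto intro!: AE_I2)

context
  fixes \<alpha> :: real and f :: "('n::finite) star_fun"
  assumes \<alpha>: "0 < \<alpha>" and f: "f \<in> star_L2"
begin

lemma f_hL2: "f j \<in> hL2" using f by (simp add: star_L2_iff)

text \<open>\<open>dominated_family\<close> is applied twice, with the integrable constants 3 (1 -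
  cos (k t))/k^2 and 5 on \<tau> < t. This reduces the claim to the integrated kernels, which agree
  up to pi/2 off the diagonal, hence almost everywhere on the quadrant.\<close>

lemma integral_resolvent_form_eq:
  assumes t: "0 < t"
  shows "integrable halfline (\<lambda>k. of_real (1 - cos (k * t)) * star_inner f (skop (resolvent_kernel \<alpha> k) f))"
    and "integrable halfline (\<lambda>\<tau>. indicator {..<t} \<tau> * star_inner f (skop (cylinder \<alpha> \<tau>) f))"
    and "(\<integral>k. of_real (1 - cos (k * t)) * star_inner f (skop (resolvent_kernel \<alpha> k) f) \<partial>halfline) =
      of_real (pi / 2) * (\<integral>\<tau>. indicator {..<t} \<tau> * star_inner f (skop (cylinder \<alpha> \<tau>) f) \<partial>halfline)"
proof -
  define K where "K = (\<lambda>k j l x y. (1 - cos (k * t)) * resolvent_kernel \<alpha> k (j::'n) l x y)"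
  define G where "G = (\<lambda>\<tau> j l x y. indicator {..<t} \<tau> * cylinder \<alpha> \<tau> (j::'n) l x y)"
  have K: "dominated_kernel (K k j l) (\<lambda>d. (1 - cos (k * t)) * (3 / (2 * k) * exp (- (k * d))))
      ((1 - cos (k * t)) * (3 / k\<^sup>2)) ((1 - cos (k * t)) * (3 / (2 * k)))" if "0 < k" for k j l
    unfolding K_def by (intro dominated_kernel_scale dominated_resolvent_kernel \<alpha> that) simp
  have G: "dominated_kernel (G \<tau> j l) (\<lambda>d. indicator {..<t} \<tau> * (5 * poisson \<tau> d))
      (indicator {..<t} \<tau> * 5) (indicator {..<t} \<tau> * (5 * poisson \<tau> 0))" if "0 < \<tau>" for \<tau> j l
    unfolding G_def by (intro dominated_kernel_scale dominated_cylinder \<alpha> that) simp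
  have Kb: "(\<lambda>(k, x, y). K k j l x y) \<in> borel_measurable (borel \<Otimes>\<^sub>M (borel \<Otimes>\<^sub>M borel))" for j l
    unfolding K_def resolvent_kernel_def case_prod_unfold by measurable
  have Gb: "(\<lambda>(\<tau>, x, y). G \<tau> j l x y) \<in> borel_measurable (borel \<Otimes>\<^sub>M (borel \<Otimes>\<^sub>M borel))" for j l
  proof -
    have [measurable]: "(\<lambda>p. cylinder \<alpha> (fst p) j l (fst (snd p)) (snd (snd p))) \<in> borel_measurable (borel \<Otimes>\<^sub>M (borel \<Otimes>\<^sub>M borel))"
      using cylinder_borel[of \<alpha> j l] by (simp add: case_prod_unfold)
    show ?thesis unfolding G_def case_prod_unfold by measurable
  qed
  have Kc: "integrable halfline (\<lambda>k. (1 - cos (k * t)) * (3 / k\<^sup>2))"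
    using integrable_mult_right[OF integrable_one_minus_cos[OF t], of 3] by (simp add: mult.commute)
  have Gc: "integrable halfline (\<lambda>\<tau>. indicator {..<t} \<tau> * 5 :: real)"
    using integrable_indicator_lessThan_halfline[of t] by simp
  note famK = dominated_family[OF K Kb Kc f_hL2 f_hL2] and famG = dominated_family[OF G Gb Gc f_hL2 f_hL2]
  have sK: "(\<Sum>j\<in>UNIV. \<Sum>l\<in>UNIV. \<integral>x. cnj (f j x) * kop (K k j l) (f l) x \<partial>halfline) =
      of_real (1 - cos (k * t)) * star_inner f (skop (resolvent_kernel \<alpha> k) f)" if "0 < k" for k
    unfolding star_inner_skop[OF dominated_resolvent_kernel[OF \<alpha> that] f f] K_def form_scale
    by (simp add: sum_distrib_left)
  have sG: "(\<Sum>j\<in>UNIV. \<Sum>l\<in>UNIV. \<integral>x. cnj (f j x) * kop (G \<tau> j l) (f l) x \<partial>halfline) =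
      indicator {..<t} \<tau> * star_inner f (skop (cylinder \<alpha> \<tau>) f)" if "0 < \<tau>" for \<tau>
    unfolding star_inner_skop[OF dominated_cylinder[OF \<alpha> that] f f] G_def form_scale
    by (simp add: sum_distrib_left of_real_indicator)
  have "integrable halfline (\<lambda>k. \<Sum>j\<in>UNIV. \<Sum>l\<in>UNIV. \<integral>x. cnj (f j x) * kop (K k j l) (f l) x \<partial>halfline)"
    using famK(1) by (intro Bochner_Integration.integrable_sum)
  then show "integrable halfline (\<lambda>k. of_real (1 - cos (k * t)) * star_inner f (skop (resolvent_kernel \<alpha> k) f))"
    by (subst (asm) Bochner_Integration.integrable_cong[OF refl sK]) auto
  have "integrable halfline (\<lambda>\<tau>. \<Sum>j\<in>UNIV. \<Sum>l\<in>UNIV. \<integral>x. cnj (f j x) * kop (G \<tau> j l) (f l) x \<partial>halfline)"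
    using famG(1) by (intro Bochner_Integration.integrable_sum)
  then show "integrable halfline (\<lambda>\<tau>. indicator {..<t} \<tau> * star_inner f (skop (cylinder \<alpha> \<tau>) f))"
    by (subst (asm) Bochner_Integration.integrable_cong[OF refl sG]) auto
  have "(\<integral>k. of_real (1 - cos (k * t)) * star_inner f (skop (resolvent_kernel \<alpha> k) f) \<partial>halfline) =
     (\<integral>k. (\<Sum>j\<in>UNIV. \<Sum>l\<in>UNIV. \<integral>x. cnj (f j x) * kop (K k j l) (f l) x \<partial>halfline) \<partial>halfline)"
    using sK by (intro Bochner_Integration.integral_cong) auto
  also have "\<dots> = (\<Sum>j\<in>UNIV. \<Sum>l\<in>UNIV. \<integral>k. (\<integral>x. cnj (f j x) * kop (K k j l) (f l) x \<partial>halfline) \<partial>halfline)"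
    using famK(1) by simp
  also have "\<dots> = (\<Sum>j\<in>UNIV. \<Sum>l\<in>UNIV. of_real (pi / 2) * (\<integral>\<tau>. (\<integral>x. cnj (f j x) * kop (G \<tau> j l) (f l) x \<partial>halfline) \<partial>halfline))"
  proof (intro sum.cong refl)
    fix j l :: 'n
    let ?B = "\<lambda>p. cnj (f j (fst p)) * f l (snd p)"
    have "(\<integral>k. (\<integral>x. cnj (f j x) * kop (K k j l) (f l) x \<partial>halfline) \<partial>halfline) =
       (\<integral>p. of_real (\<integral>k. K k j l (fst p) (snd p) \<partial>halfline) * ?B p \<partial>(halfline \<Otimes>\<^sub>M halfline))"
      by (rule famK(2))
    also have "\<dots> = (\<integral>p. of_real (pi / 2) * (of_real (\<integral>\<tau>. G \<tau> j l (fst p) (snd p) \<partial>halfline) * ?B p) \<partial>(halfline \<Otimes>\<^sub>M halfline))"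
    proof (rule Bochner_Integration.integral_cong_AE)
      have [measurable]: "f j \<in> borel_measurable halfline" "f l \<in> borel_measurable halfline"
        using f_hL2 by (auto dest: hL2_measurable)
      have *: "(\<lambda>p. \<integral>\<theta>. F \<theta> (fst p) (snd p) \<partial>halfline) \<in> borel_measurable (halfline \<Otimes>\<^sub>M halfline)"
        if F: "(\<lambda>(\<theta>, x, y). F \<theta> x y) \<in> borel_measurable (borel \<Otimes>\<^sub>M (borel \<Otimes>\<^sub>M borel))" for F :: "real \<Rightarrow> real \<Rightarrow> real \<Rightarrow> real"
      proof -
        have "(\<lambda>q. (snd q, fst (fst q), snd (fst q))) \<in> measurable ((halfline \<Otimes>\<^sub>M halfline) \<Otimes>\<^sub>M halfline) (borel \<Otimes>\<^sub>M (borel \<Otimes>\<^sub>M borel))"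
          by (intro measurable_Pair measurable_compose[OF _ id_halfline_borel]) measurable
        from measurable_compose[OF this F]
        have "(\<lambda>(p, \<theta>). F \<theta> (fst p) (snd p)) \<in> borel_measurable ((halfline \<Otimes>\<^sub>M halfline) \<Otimes>\<^sub>M halfline)"
          by (simp add: case_prod_unfold)
        then show ?thesis by (rule halfline.borel_measurable_lebesgue_integral)
      qed
      note [measurable] = *[OF Kb[of j l]] *[OF Gb[of j l]]
      show "(\<lambda>p. of_real (\<integral>k. K k j l (fst p) (snd p) \<partial>halfline) * ?B p) \<in> borel_measurable (halfline \<Otimes>\<^sub>M halfline)"
        by measurable
      show "(\<lambda>p. of_real (pi / 2) * (of_real (\<integral>\<tau>. G \<tau> j l (fst p) (snd p) \<partial>halfline) * ?B p)) \<in> borel_measurable (halfline \<Otimes>\<^sub>M halfline)"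
        by measurable
      show "AE p in halfline \<Otimes>\<^sub>M halfline. of_real (\<integral>k. K k j l (fst p) (snd p) \<partial>halfline) * ?B p =
         of_real (pi / 2) * (of_real (\<integral>\<tau>. G \<tau> j l (fst p) (snd p) \<partial>halfline) * ?B p)"
        using AE_halfline_pair_neq
      proof eventually_elim
        case (elim p)
        then have "(\<integral>k. K k j l (fst p) (snd p) \<partial>halfline) = pi / 2 * (\<integral>\<tau>. G \<tau> j l (fst p) (snd p) \<partial>halfline)"
          unfolding K_def G_def by (intro integral_cylinder_eq \<alpha> t) auto
        then show ?case by (simp only: of_real_mult mult.assoc)
      qed
    qed
    also have "\<dots> = of_real (pi / 2) * (\<integral>\<tau>. (\<integral>x. cnj (f j x) * kop (G \<tau> j l) (f l) x \<partial>halfline) \<partial>halfline)"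
    proof -
      have "(\<integral>\<tau>. (\<integral>x. cnj (f j x) * kop (G \<tau> j l) (f l) x \<partial>halfline) \<partial>halfline) =
         (\<integral>p. of_real (\<integral>\<tau>. G \<tau> j l (fst p) (snd p) \<partial>halfline) * ?B p \<partial>(halfline \<Otimes>\<^sub>M halfline))"
        by (rule famG(2))
      then show ?thesis unfolding integral_mult_right_zero by (simp only:)
    qed
    finally show "(\<integral>k. (\<integral>x. cnj (f j x) * kop (K k j l) (f l) x \<partial>halfline) \<partial>halfline) = \<dots>" .
  qed
  also have "\<dots> = of_real (pi / 2) * (\<integral>\<tau>. (\<Sum>j\<in>UNIV. \<Sum>l\<in>UNIV. \<integral>x. cnj (f j x) * kop (G \<tau> j l) (f l) x \<partial>halfline) \<partial>halfline)"
    using famG(1) by (simp add: sum_distrib_left)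
  also have "(\<integral>\<tau>. (\<Sum>j\<in>UNIV. \<Sum>l\<in>UNIV. \<integral>x. cnj (f j x) * kop (G \<tau> j l) (f l) x \<partial>halfline) \<partial>halfline) =
     (\<integral>\<tau>. indicator {..<t} \<tau> * star_inner f (skop (cylinder \<alpha> \<tau>) f) \<partial>halfline)"
    using sG by (intro Bochner_Integration.integral_cong) auto
  finally show "(\<integral>k. of_real (1 - cos (k * t)) * star_inner f (skop (resolvent_kernel \<alpha> k) f) \<partial>halfline) =
      of_real (pi / 2) * (\<integral>\<tau>. indicator {..<t} \<tau> * star_inner f (skop (cylinder \<alpha> \<tau>) f) \<partial>halfline)" .
qed

lemma continuous_cylinder_form: "continuous_on {0<..} (\<lambda>\<tau>. star_inner f (skop (cylinder \<alpha> \<tau>) f))"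
proof (rule continuous_on_sequentiallyI)
  fix T :: "nat \<Rightarrow> real" and t :: real assume T: "\<forall>n. T n \<in> {0<..}" and "t \<in> {0<..}" and lim: "T \<longlonglongrightarrow> t"
  then have t: "0 < t" by simp
  have T0: "0 < T n" for n using T by simp
  have eq: "star_inner f (skop (cylinder \<alpha> \<tau>) f) = (\<Sum>j\<in>UNIV. \<Sum>l\<in>UNIV. \<integral>p. of_real (cylinder \<alpha> \<tau> j l (fst p) (snd p)) *
      (cnj (f j (fst p)) * f l (snd p)) \<partial>(halfline \<Otimes>\<^sub>M halfline))" if "0 < \<tau>" for \<tau>
    unfolding star_inner_skop[OF dominated_cylinder[OF \<alpha> that] f f]
    by (intro sum.cong refl dominated_kernel.form_eq[OF dominated_cylinder[OF \<alpha> that] f_hL2 f_hL2])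
  \<comment> \<open>The majorant has 40 = 5 * 8: the kernel bound times the comparison constant for
    times between t/2 and 2 t.\<close>
  have P: "dominated_kernel (\<lambda>x y. 40 * poisson t \<bar>x - y\<bar>) (\<lambda>d. 40 * poisson t d) 40 (40 * poisson t 0)"
  proof (rule dominated_kernel_poisson[OF t])
    show "(\<lambda>(x, y). 40 * poisson t \<bar>x - y\<bar>) \<in> borel_measurable (borel \<Otimes>\<^sub>M borel)"
      unfolding case_prod_unfold by measurable
    show "\<bar>40 * poisson t \<bar>x - y\<bar>\<bar> \<le> 40 * poisson t \<bar>x - y\<bar>" for x y
      using poisson_nonneg[OF t, of "\<bar>x - y\<bar>"] by simp
  qed simp
  have ev: "\<forall>\<^sub>F n in sequentially. t / 2 \<le> T n \<and> T n \<le> 2 * t"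
  proof -
    have "\<forall>\<^sub>F n in sequentially. t / 2 < T n" "\<forall>\<^sub>F n in sequentially. T n < 2 * t"
      using t by (intro order_tendstoD[OF lim]; simp)+
    then show ?thesis by eventually_elim auto
  qed
  \<comment> \<open>Only a tail of the sequence lies in that window of times, hence the shift by
    M.\<close>
  obtain M where M: "\<And>n. M \<le> n \<Longrightarrow> t / 2 \<le> T n \<and> T n \<le> 2 * t"
    using ev unfolding eventually_sequentially by blast
  have "(\<lambda>n. star_inner f (skop (cylinder \<alpha> (T (n + M))) f)) \<longlonglongrightarrow> star_inner f (skop (cylinder \<alpha> t) f)"
    unfolding eq[OF T0] eq[OF t]
  proof (intro tendsto_sum integral_dominated_convergence)
    fix j l
    let ?B = "\<lambda>p. cnj (f j (fst p)) * f l (snd p)"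
    show "(\<lambda>p. of_real (cylinder \<alpha> t j l (fst p) (snd p)) * ?B p) \<in> borel_measurable (halfline \<Otimes>\<^sub>M halfline)"
      by (rule dominated_kernel.form_measurable[OF dominated_cylinder[OF \<alpha> t] f_hL2 f_hL2])
    show "(\<lambda>p. of_real (cylinder \<alpha> (T (n + M)) j l (fst p) (snd p)) * ?B p) \<in> borel_measurable (halfline \<Otimes>\<^sub>M halfline)" for n
      by (rule dominated_kernel.form_measurable[OF dominated_cylinder[OF \<alpha> T0] f_hL2 f_hL2])
    show "integrable (halfline \<Otimes>\<^sub>M halfline) (\<lambda>p. norm (of_real (40 * poisson t \<bar>fst p - snd p\<bar>) * ?B p))"
      by (rule integrable_norm[OF dominated_kernel.form_integrable[OF P f_hL2 f_hL2]])
    show "AE p in halfline \<Otimes>\<^sub>M halfline. (\<lambda>n. of_real (cylinder \<alpha> (T (n + M)) j l (fst p) (snd p)) * ?B p)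
        \<longlonglongrightarrow> of_real (cylinder \<alpha> t j l (fst p) (snd p)) * ?B p"
      using AE_halfline_pair_neq
      by eventually_elim (intro tendsto_mult tendsto_of_real tendsto_const isCont_cylinder \<alpha> LIMSEQ_ignore_initial_segment[OF lim]; simp)
    show "AE p in halfline \<Otimes>\<^sub>M halfline. norm (of_real (cylinder \<alpha> (T (n + M)) j l (fst p) (snd p)) * ?B p) \<le>
       norm (of_real (40 * poisson t \<bar>fst p - snd p\<bar>) * ?B p)" for n
      using AE_halfline_pair_neq
    proof eventually_elim
      case (elim p)
      have "\<bar>cylinder \<alpha> (T (n + M)) j l (fst p) (snd p)\<bar> \<le> 5 * poisson (T (n + M)) \<bar>fst p - snd p\<bar>"
        using elim by (intro cylinder_abs_le \<alpha> T0) auto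
      also have "\<dots> \<le> 5 * (8 * poisson t \<bar>fst p - snd p\<bar>)"
        using M[of "n + M"] by (intro mult_left_mono poisson_comparable t) auto
      finally have "\<bar>cylinder \<alpha> (T (n + M)) j l (fst p) (snd p)\<bar> \<le> \<bar>40 * poisson t \<bar>fst p - snd p\<bar>\<bar>"
        by (simp add: order.trans[OF _ abs_ge_self])
      then show ?case by (simp only: norm_mult norm_of_real mult_right_mono norm_ge_zero mult_nonneg_nonneg)
    qed
  qed
  then show "(\<lambda>n. star_inner f (skop (cylinder \<alpha> (T n)) f)) \<longlonglongrightarrow> star_inner f (skop (cylinder \<alpha> t) f)"
    by (rule LIMSEQ_offset)
qed

end

text \<open>Subtracting the integrals up to some a > 0 removes a neighbourhood of 0, where
  continuity is not given. On {a..b} the difference then integrates to zero up to every x, and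
  differentiating at the interior point t gives its value.\<close>

lemma continuous_eq_of_integrals_eq:
  fixes A B :: "real \<Rightarrow> complex"
  assumes A: "continuous_on {0<..} A" and B: "continuous_on {0<..} B"
    and iA: "\<And>t. 0 < t \<Longrightarrow> integrable halfline (\<lambda>\<tau>. indicator {..<t} \<tau> * A \<tau>)"
    and iB: "\<And>t. 0 < t \<Longrightarrow> integrable halfline (\<lambda>\<tau>. indicator {..<t} \<tau> * B \<tau>)"
    and eq: "\<And>t. 0 < t \<Longrightarrow> (\<integral>\<tau>. indicator {..<t} \<tau> * A \<tau> \<partial>halfline) = (\<integral>\<tau>. indicator {..<t} \<tau> * B \<tau> \<partial>halfline)"
    and t: "0 < t"
  shows "A t = B t"
proof -
  define a b where "a = t / 2" and "b = 2 * t"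
  have ab: "0 < a" "a < t" "t < b" using t by (auto simp: a_def b_def)
  let ?D = "\<lambda>\<tau>. A \<tau> - B \<tau>"
  have D: "continuous_on {a..b} ?D"
    using ab by (intro continuous_intros continuous_on_subset[OF A] continuous_on_subset[OF B]) auto
  have z: "integral {a..x} ?D = 0" if x: "x \<in> {a..b}" for x
  proof -
    have x0: "0 < x" using x ab by auto
    have D': "continuous_on {a..x} ?D" using D x by (auto intro: continuous_on_subset)
    have 1: "(\<integral>\<tau>. indicator {..<s} \<tau> * ?D \<tau> \<partial>halfline) = 0" "integrable halfline (\<lambda>\<tau>. indicator {..<s} \<tau> * ?D \<tau>)" if "0 < s" for s
      using iA[OF that] iB[OF that] eq[OF that] by (simp_all add: right_diff_distrib)
    have "(\<integral>\<tau>. indicator {..<x} \<tau> * ?D \<tau> - indicator {..<a} \<tau> * ?D \<tau> \<partial>halfline) = 0"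
      using 1[OF x0] 1[OF ab(1)] by simp
    moreover have "(\<integral>\<tau>. indicator {..<x} \<tau> * ?D \<tau> - indicator {..<a} \<tau> * ?D \<tau> \<partial>halfline) =
        (\<integral>\<tau>. indicator {a..x} \<tau> *\<^sub>R ?D \<tau> \<partial>lborel)"
      unfolding integral_halfline
    proof (rule Bochner_Integration.integral_cong_AE)
      show "(\<lambda>\<tau>. indicator {0<..} \<tau> *\<^sub>R (indicator {..<x} \<tau> * ?D \<tau> - indicator {..<a} \<tau> * ?D \<tau>)) \<in> borel_measurable lborel"
        using Bochner_Integration.integrable_diff[OF 1(2)[OF x0] 1(2)[OF ab(1)]]
        unfolding integrable_halfline by (rule borel_measurable_integrable)
      show "(\<lambda>\<tau>. indicator {a..x} \<tau> *\<^sub>R ?D \<tau>) \<in> borel_measurable lborel"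
        using D' borel_measurable_continuous_on_indicator[of "{a..x}" ?D] by simp
      show "AE \<tau> in lborel. indicator {0<..} \<tau> *\<^sub>R (indicator {..<x} \<tau> * ?D \<tau> - indicator {..<a} \<tau> * ?D \<tau>) =
          indicator {a..x} \<tau> *\<^sub>R ?D \<tau>"
        using AE_lborel_singleton[of x] by eventually_elim (use ab x in \<open>auto split: split_indicator\<close>)
    qed
    moreover have "(\<integral>\<tau>. indicator {a..x} \<tau> *\<^sub>R ?D \<tau> \<partial>lborel) = integral {a..x} ?D"
      using set_borel_integral_eq_integral(2)[of "{a..x}" ?D] borel_integrable_atLeastAtMost'[OF D']
      by (simp add: set_lebesgue_integral_def)
    ultimately show ?thesis by simp
  qed
  have "((\<lambda>x. integral {a..x} ?D) has_vector_derivative ?D t) (at t within {a..b})"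
    using ab by (intro integral_has_vector_derivative[OF D]) auto
  then have "((\<lambda>x. 0) has_vector_derivative ?D t) (at t within {a..b})"
    by (rule has_vector_derivative_transform[rotated 2]) (use z ab in auto)
  moreover have "((\<lambda>x. 0) has_vector_derivative (0::complex)) (at t within {a..b})" by (rule has_vector_derivative_const)
  ultimately have "?D t = 0"
    using ab by (intro vector_derivative_unique_within_closed_interval[of a b t "\<lambda>x. 0"]) auto
  then show ?thesis by simp
qed

section \<open>Agreement of the quadratic forms and polarization\<close>

locale star_spectral = star_projections E for E :: "real set \<Rightarrow> ('n::finite) star_fun \<Rightarrow> 'n star_fun" +
  fixes \<alpha> :: real
  assumes \<alpha>: "0 < \<alpha>" and H: "star_H \<alpha> = spectral_integral E (\<lambda>s. s)"
begin

text \<open>The constant is \<open>skop_norm\<close> with c = 3/k^2: the square of N * 3/k^2 is 9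
  N^2/k^4.\<close>

sublocale star_resolvent E "\<lambda>k. skop (resolvent_kernel \<alpha> k)" "9 * (real CARD('n))\<^sup>2"
proof
  show "Re (star_inner (skop (resolvent_kernel \<alpha> k) f) (skop (resolvent_kernel \<alpha> k) f)) \<le>
      9 * (real CARD('n))\<^sup>2 / k ^ 4 * Re (star_inner f f)" if "0 < k" "f \<in> star_L2" for k and f :: "'n star_fun"
    using skop_norm[OF dominated_resolvent_kernel[OF \<alpha> that(1)] that(2)]
    by (simp add: power_mult_distrib power_divide mult.commute flip: power_mult)
  show "(skop (resolvent_kernel \<alpha> k) f, lin_comb f (- of_real (k\<^sup>2)) (skop (resolvent_kernel \<alpha> k) f))
      \<in> spectral_integral E (\<lambda>s. s)" if "0 < k" "f \<in> star_L2" for k f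
    unfolding H[symmetric] by (rule resolvent_in_star_H[OF \<alpha> that])
qed simp

lemma integrable_exp_sqrt:
  assumes f: "f \<in> star_L2" and t: "0 \<le> t"
  shows "integrable (\<mu> f) (\<lambda>s. exp (- t * sqrt s))"
proof (rule integrable_spectral_bounded[OF f, where b=1])
  show "AE s in \<mu> f. \<bar>exp (- t * sqrt s)\<bar> \<le> 1"
    using AE_spectral_nonneg[OF f] by eventually_elim (use t in simp)
qed measurable

text \<open>Both sides are continuous for t > 0 and have the same integral over every interval from
  0 to t: the left one by \<open>integral_resolvent_form_eq\<close>, the right one because <f, R_k
  f> is the spectral integral of 1/(s + k^2), to which Tonelli's theorem and
  \<open>nn_integral_one_minus_cos\<close> apply.\<close>

lemma cylinder_form:
  assumes f: "f \<in> star_L2" and t: "0 < t"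
  shows "star_inner f (skop (cylinder \<alpha> t) f) = of_real (\<integral>s. exp (- t * sqrt s) \<partial>\<mu> f)"
proof -
  interpret M: finite_measure "\<mu> f" by (rule finite_measure_spectral[OF f])
  interpret P: pair_sigma_finite "\<mu> f" halfline
    by (simp add: pair_sigma_finite_def sigma_finite_halfline M.sigma_finite_measure_axioms)
  define B where "B = (\<lambda>t. \<integral>s. exp (- t * sqrt s) \<partial>\<mu> f)"
  define r where "r = (\<lambda>k. Re (star_inner f (skop (resolvent_kernel \<alpha> k) f)))"
  have B_nonneg: "0 \<le> B z" for z unfolding B_def by (intro integral_nonneg_AE AE_I2) simp
  have B_le: "B z \<le> measure (\<mu> f) UNIV" if "0 \<le> z" for z
  proof -
    have "B z \<le> (\<integral>s. 1 \<partial>\<mu> f)"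
      unfolding B_def using AE_spectral_nonneg[OF f]
      by (intro integral_mono_AE integrable_exp_sqrt f that) (auto elim!: eventually_mono simp: that)
    then show ?thesis by simp
  qed
  have B_cont: "continuous_on {0..} B"
  proof (rule continuous_on_sequentiallyI)
    fix X x assume X: "\<forall>n. X n \<in> {0..}" and lim: "X \<longlonglongrightarrow> (x::real)"
    show "(\<lambda>n. B (X n)) \<longlonglongrightarrow> B x"
      unfolding B_def
    proof (rule integral_dominated_convergence[where w="\<lambda>_. 1"])
      show "AE s in \<mu> f. (\<lambda>n. exp (- X n * sqrt s)) \<longlonglongrightarrow> exp (- x * sqrt s)"
        by (intro AE_I2 tendsto_intros lim)
      show "AE s in \<mu> f. norm (exp (- X n * sqrt s)) \<le> 1" for n
        using AE_spectral_nonneg[OF f] by eventually_elim (use X in simp)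
    qed auto
  qed
  have iB: "integrable halfline (\<lambda>\<tau>. indicator {..<t} \<tau> * B \<tau>)" for t
  proof (rule Bochner_Integration.integrable_bound)
    show "integrable halfline (\<lambda>x. indicator {..<t} x * measure (\<mu> f) UNIV)"
      using integrable_indicator_lessThan_halfline[of t] by simp
    have "(\<lambda>x. indicator {0..} x *\<^sub>R B x) \<in> borel_measurable borel"
      by (rule borel_measurable_continuous_on_indicator[OF _ B_cont]) simp
    then have "(\<lambda>x. indicator {..<t} x * (indicator {0..} x *\<^sub>R B x)) \<in> borel_measurable halfline"
      by measurable
    then show "(\<lambda>\<tau>. indicator {..<t} \<tau> * B \<tau>) \<in> borel_measurable halfline"
      by (rule measurable_cong[THEN iffD1, rotated]) (auto split: split_indicator)
    show "AE x in halfline. norm (indicator {..<t} x * B x) \<le> norm (indicator {..<t} x * measure (\<mu> f) UNIV)"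
      using AE_halfline_pos by eventually_elim (use B_le B_nonneg in \<open>auto split: split_indicator\<close>)
  qed
  \<comment> \<open>All integrands are nonnegative almost everywhere, so k and s, and then s and z,
    are exchanged by Tonelli's theorem.\<close>
  have nn: "(\<integral>\<^sup>+k. ennreal ((1 - cos (k * t)) * r k) \<partial>halfline) = ennreal (pi / 2 * (\<integral>\<tau>. indicator {..<t} \<tau> * B \<tau> \<partial>halfline))"
    if t: "0 < t" for t
  proof -
    have m1: "(\<lambda>(s, k). ennreal ((1 - cos (k * t)) / (k\<^sup>2 + s))) \<in> borel_measurable (\<mu> f \<Otimes>\<^sub>M halfline)"
      by (rule measurable_borel_halfline(1)[OF sets_spectral]) measurable
    have m2: "(\<lambda>(s, z). ennreal (exp (- (sqrt s * z))) * indicator {..<t} z) \<in> borel_measurable (\<mu> f \<Otimes>\<^sub>M halfline)"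
      by (rule measurable_borel_halfline(1)[OF sets_spectral]) measurable
    have "(\<integral>\<^sup>+k. ennreal ((1 - cos (k * t)) * r k) \<partial>halfline) =
      (\<integral>\<^sup>+k. (\<integral>\<^sup>+s. ennreal ((1 - cos (k * t)) / (k\<^sup>2 + s)) \<partial>\<mu> f) \<partial>halfline)"
    proof (intro nn_integral_cong)
      fix k assume "k \<in> space halfline"
      then have k: "0 < k" by simp
      have "ennreal ((1 - cos (k * t)) * r k) = ennreal (1 - cos (k * t)) * (\<integral>\<^sup>+s. ennreal (1 / (s + k\<^sup>2)) \<partial>\<mu> f)"
        unfolding r_def resolvent_form(1)[OF k f] by (rule ennreal_mult') simp
      also have "\<dots> = (\<integral>\<^sup>+s. ennreal (1 - cos (k * t)) * ennreal (1 / (s + k\<^sup>2)) \<partial>\<mu> f)"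
        by (rule nn_integral_cmult[symmetric]) measurable
      also have "\<dots> = (\<integral>\<^sup>+s. ennreal ((1 - cos (k * t)) / (k\<^sup>2 + s)) \<partial>\<mu> f)"
        by (intro nn_integral_cong) (simp add: add.commute flip: ennreal_mult')
      finally show "ennreal ((1 - cos (k * t)) * r k) = \<dots>" .
    qed
    also have "\<dots> = (\<integral>\<^sup>+s. (\<integral>\<^sup>+k. ennreal ((1 - cos (k * t)) / (k\<^sup>2 + s)) \<partial>halfline) \<partial>\<mu> f)"
      by (rule P.Fubini'[OF m1])
    also have "\<dots> = (\<integral>\<^sup>+s. ennreal (pi / 2) * (\<integral>\<^sup>+z. ennreal (exp (- (sqrt s * z))) * indicator {..<t} z \<partial>halfline) \<partial>\<mu> f)"
      using AE_spectral_nonneg[OF f]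
    proof (intro nn_integral_cong_AE, eventually_elim)
      case (elim s)
      then show ?case using nn_integral_one_minus_cos[of "sqrt s" t] t by simp
    qed
    also have "\<dots> = ennreal (pi / 2) * (\<integral>\<^sup>+s. (\<integral>\<^sup>+z. ennreal (exp (- (sqrt s * z))) * indicator {..<t} z \<partial>halfline) \<partial>\<mu> f)"
      by (intro nn_integral_cmult halfline.borel_measurable_nn_integral m2)
    also have "(\<integral>\<^sup>+s. (\<integral>\<^sup>+z. ennreal (exp (- (sqrt s * z))) * indicator {..<t} z \<partial>halfline) \<partial>\<mu> f) =
        (\<integral>\<^sup>+z. (\<integral>\<^sup>+s. ennreal (exp (- (sqrt s * z))) * indicator {..<t} z \<partial>\<mu> f) \<partial>halfline)"
      by (rule P.Fubini'[OF m2, symmetric])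
    also have "\<dots> = (\<integral>\<^sup>+z. ennreal (indicator {..<t} z * B z) \<partial>halfline)"
    proof (intro nn_integral_cong)
      fix z assume "z \<in> space halfline"
      then have z: "0 \<le> z" by simp
      have "(\<integral>\<^sup>+s. ennreal (exp (- (sqrt s * z))) * indicator {..<t} z \<partial>\<mu> f) = (\<integral>\<^sup>+s. ennreal (exp (- z * sqrt s)) \<partial>\<mu> f) * indicator {..<t} z"
        by (subst nn_integral_multc[symmetric]) (auto simp: mult.commute)
      also have "(\<integral>\<^sup>+s. ennreal (exp (- z * sqrt s)) \<partial>\<mu> f) = ennreal (B z)"
        unfolding B_def by (intro nn_integral_eq_integral integrable_exp_sqrt f z) simp
      finally show "(\<integral>\<^sup>+s. ennreal (exp (- (sqrt s * z))) * indicator {..<t} z \<partial>\<mu> f) = ennreal (indicator {..<t} z * B z)"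
        by (auto split: split_indicator)
    qed
    also have "\<dots> = ennreal (\<integral>\<tau>. indicator {..<t} \<tau> * B \<tau> \<partial>halfline)"
      using iB B_nonneg by (intro nn_integral_eq_integral AE_I2) auto
    finally show ?thesis by (rule trans) (rule ennreal_mult'[symmetric], simp)
  qed
  have key: "(\<integral>\<tau>. indicator {..<t} \<tau> * star_inner f (skop (cylinder \<alpha> \<tau>) f) \<partial>halfline) =
      (\<integral>\<tau>. indicator {..<t} \<tau> * of_real (B \<tau>) \<partial>halfline)" if t: "0 < t" for t
  proof -
    note R = integral_resolvent_form_eq[OF \<alpha> f t]
    have e: "of_real (1 - cos (k * t)) * star_inner f (skop (resolvent_kernel \<alpha> k) f) = of_real ((1 - cos (k * t)) * r k)"
      if "0 < k" for k
      using resolvent_form(2)[OF that f] by (simp add: r_def)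
    have "integrable halfline (\<lambda>k. complex_of_real ((1 - cos (k * t)) * r k))"
      using R(1) by (subst (asm) Bochner_Integration.integrable_cong[OF refl e]) auto
    then have i: "integrable halfline (\<lambda>k. (1 - cos (k * t)) * r k)"
      by (simp only: complex_of_real_integrable_eq)
    have "0 \<le> (1 - cos (k * t)) * r k" if "0 < k" for k
      using resolvent_form(3)[OF that f] by (simp add: r_def)
    then have "(\<integral>\<^sup>+k. ennreal ((1 - cos (k * t)) * r k) \<partial>halfline) = ennreal (\<integral>k. (1 - cos (k * t)) * r k \<partial>halfline)"
      and n: "0 \<le> (\<integral>k. (1 - cos (k * t)) * r k \<partial>halfline)"
      by (auto intro!: nn_integral_eq_integral i AE_I2 integral_nonneg_AE)
    \<comment> \<open>Nonnegativity of both sides allows passing from the equality in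
      \<open>ennreal\<close> to one between reals.\<close>
    moreover have "0 \<le> (\<integral>\<tau>. indicator {..<t} \<tau> * B \<tau> \<partial>halfline)"
      using B_nonneg by (intro integral_nonneg_AE AE_I2) simp
    ultimately have 1: "(\<integral>k. (1 - cos (k * t)) * r k \<partial>halfline) = pi / 2 * (\<integral>\<tau>. indicator {..<t} \<tau> * B \<tau> \<partial>halfline)"
      using nn[OF t] by simp
    have "of_real (pi / 2) * (\<integral>\<tau>. indicator {..<t} \<tau> * star_inner f (skop (cylinder \<alpha> \<tau>) f) \<partial>halfline) =
      (\<integral>k. complex_of_real ((1 - cos (k * t)) * r k) \<partial>halfline)"
      unfolding R(3)[symmetric] using e by (intro Bochner_Integration.integral_cong) auto
    also have "\<dots> = of_real (pi / 2) * of_real (\<integral>\<tau>. indicator {..<t} \<tau> * B \<tau> \<partial>halfline)"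
      unfolding integral_complex_of_real 1 by (rule of_real_mult)
    also have "of_real (\<integral>\<tau>. indicator {..<t} \<tau> * B \<tau> \<partial>halfline) = (\<integral>\<tau>. indicator {..<t} \<tau> * complex_of_real (B \<tau>) \<partial>halfline)"
      by (subst integral_complex_of_real[symmetric]) (simp add: of_real_indicator)
    finally show ?thesis by simp
  qed
  have "star_inner f (skop (cylinder \<alpha> t) f) = of_real (B t)"
  proof (rule continuous_eq_of_integrals_eq[OF continuous_cylinder_form[OF \<alpha> f] _ _ _ key t])
    show "continuous_on {0<..} (\<lambda>\<tau>. complex_of_real (B \<tau>))"
      by (intro continuous_intros continuous_on_subset[OF B_cont]) auto
    show "integrable halfline (\<lambda>\<tau>. indicator {..<t} \<tau> * star_inner f (skop (cylinder \<alpha> \<tau>) f))" if "0 < t" for t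
      by (rule integral_resolvent_form_eq(2)[OF \<alpha> f that])
    show "integrable halfline (\<lambda>\<tau>. indicator {..<t} \<tau> * complex_of_real (B \<tau>))" for t
    proof -
      have "integrable halfline (\<lambda>\<tau>. complex_of_real (indicator {..<t} \<tau> * B \<tau>))"
        using iB[of t] by (simp only: complex_of_real_integrable_eq)
      then show ?thesis by (simp add: of_real_indicator)
    qed
  qed
  then show ?thesis by (simp add: B_def)
qed

lemma skop_cylinder_lin_comb:
  assumes f: "f \<in> star_L2" and g: "g \<in> star_L2" and t: "0 < t" and x: "0 < x"
  shows "skop (cylinder \<alpha> t) (lin_comb g c f) j x = skop (cylinder \<alpha> t) g j x + c * skop (cylinder \<alpha> t) f j x"
proof -
  have "kop (cylinder \<alpha> t j l) (lin_comb g c f l) x = kop (cylinder \<alpha> t j l) (g l) x + c * kop (cylinder \<alpha> t j l) (f l) x" for l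
  proof -
    interpret dominated_kernel "cylinder \<alpha> t j l" "\<lambda>d. 5 * poisson t d" 5 "5 * poisson t 0"
      by (rule dominated_cylinder[OF \<alpha> t])
    have "integrable halfline (\<lambda>y. of_real (cylinder \<alpha> t j l x y) * f l y)"
      "integrable halfline (\<lambda>y. of_real (cylinder \<alpha> t j l x y) * g l y)"
      using f g x by (auto intro!: kop_integrable simp: star_L2_iff)
    then have "(\<integral>y. of_real (cylinder \<alpha> t j l x y) * g l y + c * (of_real (cylinder \<alpha> t j l x y) * f l y) \<partial>halfline) =
       kop (cylinder \<alpha> t j l) (g l) x + c * kop (cylinder \<alpha> t j l) (f l) x"
      by (simp add: kop_def)
    then show ?thesis by (simp add: kop_def algebra_simps)
  qed
  then show ?thesis by (simp add: skop_def sum.distrib sum_distrib_left)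
qed

text \<open>Expand the quadratic form at g + c f with c = i^k. In the sum weighted by (-i)^k the
  coefficients of 1, of cnj c and of |c|^2 cancel, while c receives 4, which leaves <g, G
  f>.\<close>

lemma cylinder_polarized:
  assumes f: "f \<in> star_L2" and g: "g \<in> star_L2" and t: "0 < t"
  shows "star_inner g (skop (cylinder \<alpha> t) f) = spectral_form E (\<lambda>s. exp (- t * sqrt s)) g f"
proof -
  let ?G = "skop (cylinder \<alpha> t)"
  have G: "?G h \<in> star_L2" if "h \<in> star_L2" for h :: "'n star_fun"
    by (rule skop_L2[OF dominated_cylinder[OF \<alpha> t] that])
  have q: "complex_of_real (\<integral>s. exp (- t * sqrt s) \<partial>\<mu> (lin_comb g c f)) =
     star_inner g (?G g) + c * star_inner g (?G f) + cnj c * star_inner f (?G g) + cnj c * c * star_inner f (?G f)" for c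
  proof -
    have L: "lin_comb g c f \<in> star_L2" by (rule star_L2_lin_comb[OF f g])
    have "complex_of_real (\<integral>s. exp (- t * sqrt s) \<partial>\<mu> (lin_comb g c f)) = star_inner (lin_comb g c f) (?G (lin_comb g c f))"
      by (rule cylinder_form[OF L t, symmetric])
    also have "\<dots> = star_inner (lin_comb g c f) (lin_comb (?G g) c (?G f))"
    proof (rule star_inner_cong[OF L L G[OF L] star_L2_lin_comb[OF G[OF f] G[OF g]] star_eq_refl])
      show "star_eq (?G (lin_comb g c f)) (lin_comb (?G g) c (?G f))"
        unfolding star_eq_def using skop_cylinder_lin_comb[OF f g t] by (auto intro!: AE_I2)
    qed
    also have "\<dots> = star_inner g (?G g) + c * star_inner g (?G f) + cnj c * star_inner f (?G g) + cnj c * c * star_inner f (?G f)"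
      unfolding star_inner_lin_left[OF f g star_L2_lin_comb[OF G[OF f] G[OF g]]]
        star_inner_lin_right[OF G[OF f] G[OF g] g] star_inner_lin_right[OF G[OF f] G[OF g] f]
      by (simp add: algebra_simps)
    finally show ?thesis .
  qed
  show ?thesis
    unfolding spectral_form_def q by (simp add: eval_nat_numeral lessThan_Suc algebra_simps)
qed

lemma skop_cylinder_spectral_integral:
  assumes f: "f \<in> star_L2" and t: "0 < t"
  shows "(f, skop (cylinder \<alpha> t) f) \<in> spectral_integral E (\<lambda>s. exp (- t * sqrt s))"
proof -
  \<comment> \<open>Squaring the exponential doubles t, so it is square integrable for every
    spectral measure and the operator is defined everywhere.\<close>
  have dom: "spectral_domain E (\<lambda>s. exp (- t * sqrt s)) = star_L2"
  proof -
    have "(exp (- t * sqrt s))\<^sup>2 = exp (- (2 * t) * sqrt s)" for s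
      by (simp add: power2_eq_square flip: exp_add)
    then show ?thesis using integrable_exp_sqrt[of _ "2 * t"] t by (auto simp: spectral_domain_def)
  qed
  have "skop (cylinder \<alpha> t) f \<in> star_L2"
    by (rule skop_L2[OF dominated_cylinder[OF \<alpha> t] f])
  then show ?thesis
    unfolding spectral_integral_def dom
    by (intro CollectI case_prodI conjI ballI f cylinder_polarized t)
qed

end

theorem mainTheorem7:
  fixes \<alpha> t :: real
    and E :: "real set \<Rightarrow> ('n::finite) star_fun \<Rightarrow> 'n star_fun"
  assumes "\<alpha> > 0" and "t > 0"
    and "is_spectral_measure_of E (star_H \<alpha>)"
  shows "has_integral_kernel (spectral_integral E (\<lambda>s. exp (- t * sqrt s)))
           (\<lambda>j l x y. complex_of_real (star_cylinder_kernel \<alpha> t j l x y))"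
proof -
  interpret star_spectral E \<alpha>
    using assms by unfold_locales (auto simp: is_spectral_measure_of_def)
  let ?K = "\<lambda>j l x y. complex_of_real (star_cylinder_kernel \<alpha> t j l x y)"
  \<comment> \<open>The kernels are compared on the open quadrant, which is all that
    \<open>halfline\<close> sees.\<close>
  have eq: "?K j l x y = of_real (cylinder \<alpha> t j l x y)" if "0 < x" "0 < y" for j l :: 'n and x y
    using star_cylinder_kernel_eq[OF assms(1,2) that] by simp
  note dk = dominated_cylinder[OF assms(1,2)]
  have meas: "(\<lambda>(x, y). ?K j l x y) \<in> borel_measurable (halfline \<Otimes>\<^sub>M halfline)" for j l
  proof -
    have "(\<lambda>p. complex_of_real (case_prod (cylinder \<alpha> t j l) p)) \<in> borel_measurable (halfline \<Otimes>\<^sub>M halfline)"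
      using dominated_kernel.K_meas[OF dk, of j l] by measurable
    then show ?thesis
      by (rule measurable_cong[THEN iffD1, rotated]) (auto simp: space_pair_measure star_cylinder_kernel_eq assms(1,2))
  qed
  have int: "integrable halfline (\<lambda>y. ?K j l x y * f l y)" if f: "f \<in> star_L2" and x: "0 < x" for f :: "'n star_fun" and j l x
  proof -
    have "integrable halfline (\<lambda>y. of_real (cylinder \<alpha> t j l x y) * f l y)"
      using f by (intro dominated_kernel.kop_integrable[OF dk _ x]) (simp add: star_L2_iff)
    then show ?thesis
      by (rule Bochner_Integration.integrable_cong[OF refl, THEN iffD1, rotated]) (use x in \<open>simp add: eq\<close>)
  qed
  have graph: "(f, \<lambda>j x. \<Sum>l\<in>UNIV. \<integral>y. ?K j l x y * f l y \<partial>halfline) \<in> spectral_integral E (\<lambda>s. exp (- t * sqrt s))"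
    if f: "f \<in> star_L2" for f :: "'n star_fun"
  proof -
    let ?h = "\<lambda>j x. \<Sum>l\<in>UNIV. \<integral>y. ?K j l x y * f l y \<partial>halfline"
    let ?G = "skop (cylinder \<alpha> t) f"
    have h: "?h j x = ?G j x" if "0 < x" for j x
      unfolding skop_def kop_def using that
      by (intro sum.cong refl Bochner_Integration.integral_cong) (simp_all add: eq)
    have G: "?G \<in> star_L2" by (rule skop_L2[OF dk f])
    have hL2: "?h \<in> star_L2"
    proof -
      have "?G j \<in> borel_measurable halfline \<Longrightarrow> ?h j \<in> borel_measurable halfline" for j
        by (rule measurable_cong[THEN iffD1, rotated]) (auto simp: h)
      moreover have "integrable halfline (\<lambda>x. (cmod (?G j x))\<^sup>2) \<Longrightarrow> integrable halfline (\<lambda>x. (cmod (?h j x))\<^sup>2)" for j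
        by (rule Bochner_Integration.integrable_cong[OF refl, THEN iffD1, rotated]) (auto simp: h)
      ultimately show ?thesis using G by (simp add: star_L2_def)
    qed
    \<comment> \<open>The second component of the graph matters only through \<open>star_L2\<close>
      and \<open>star_inner\<close>, which ignore values outside the open half-line, so equality for
      x > 0 suffices.\<close>
    have "star_inner g ?h = star_inner g ?G" for g
      unfolding star_inner_def by (intro sum.cong refl Bochner_Integration.integral_cong) (simp_all add: h)
    then show ?thesis
      using skop_cylinder_spectral_integral[OF f assms(2)] hL2 by (simp add: spectral_integral_def)
  qed
  show ?thesis
    unfolding has_integral_kernel_def using meas int graph by blast
qed

end
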